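(* Let $n\ge 2$ be an integer, $p>1$, $\alpha\in\mathbb{R}$. If $\alpha\neq p-n$ and $q>p$, then the problem $$-\operatorname{div}(|x|^\alpha|\nabla u|^{p-2}\nabla u)=|x|^{-n+q\frac{n-p+\alpha}{p}}|u|^{q-2}u\quad\text{on } \mathbb{R}^n$$ has a nontrivial radial solution $U$ in $\mathcal D^{1,p}_{\rm r}(\mathbb{R}^n;|x|^\alpha dx)$, which is unique (among nontrivial solutions in $\mathcal D^{1,p}_{\rm r}(\mathbb{R}^n;|x|^\alpha dx)$) up to a change of sign and up to a transform of the type $u(x)\mapsto\rho^{\frac{n-p+\alpha}{p}}u(\rho x)$, $\rho>0$. Moreover, $U$ achieves the best constant $$S_{1,q,0}(\alpha)=\inf_{\substack{u\in\mathcal D^{1,p}_{\rm r}(\mathbb{R}^n;|x|^\alpha dx)\\ u\ne 0}}\frac{\displaystyle\int_{\mathbb{R}^n}|x|^{\alpha}|\nabla u|^p\,dx}{\left(\displaystyle\int_{\mathbb{R}^n}|x|^{-n+q\frac{n-p+\alpha}{p}}|u|^q\,dx\right)^{p/q}}$$ and it is given by $$U(|x|)=\left(\frac{q}{p}\,\frac{|n-p+\alpha|^p}{(p-1)^{p-1}}\right)^{\frac{1}{q-p}}\left(1+|x|^{\frac{(n-p+\alpha)(q-p)}{p(p-1)}}\right)^{\frac{p}{p-q}}.$$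
   Context: $C^1_{c,r}(\mathbb{R}^n\setminus\{0\})$ is the space of radially symmetric functions in $C^1_c(\mathbb{R}^n\setminus\{0\})$. For $\alpha\ne p-n$, $\mathcal D^{1,p}_{\rm r}(\mathbb{R}^n;|x|^\alpha dx)$ is the completion of $C^1_{c,r}(\mathbb{R}^n\setminus\{0\})$ with respect to the norm $\left(\int_{\mathbb{R}^n}|x|^\alpha|\nabla u|^p\,dx\right)^{1/p}$; by the Hardy inequality it is continuously embedded in $L^p(\mathbb{R}^n;|x|^{\alpha-p}dx)$, so its elements are radial functions on $\mathbb{R}^n\setminus\{0\}$. A solution $u\in\mathcal D^{1,p}_{\rm r}(\mathbb{R}^n;|x|^\alpha dx)$ is meant in the weak sense: $\int_{\mathbb{R}^n}|x|^\alpha|\nabla u|^{p-2}\nabla u\cdot\nabla\varphi\,dx=\int_{\mathbb{R}^n}|x|^{-n+q\frac{n-p+\alpha}{p}}|u|^{q-2}u\,\varphi\,dx$ for all $\varphi\in\mathcal D^{1,p}_{\rm r}(\mathbb{R}^n;|x|^\alpha dx)$. No sign condition on $u$ is assumed. *)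

theory Defs
  imports "HOL-Analysis.Analysis"
begin

definition radial :: "(real ^ 'n \<Rightarrow> real) \<Rightarrow> bool" where
  "radial f \<longleftrightarrow> (\<forall>x y. norm x = norm y \<longrightarrow> f x = f y)"

definition gradient :: "(real ^ 'n \<Rightarrow> real) \<Rightarrow> real ^ 'n \<Rightarrow> real ^ 'n" where
  "gradient f x = (THE D. GDERIV f x :> D)"

(* The support is a compact set avoiding the origin; functions are extended by 0 to the origin. *)
definition C1_c_radial :: "(real ^ 'n \<Rightarrow> real) set" where
  "C1_c_radial = {f. radial f
      \<and> compact (closure {x. f x \<noteq> 0}) \<and> 0 \<notin> closure {x. f x \<noteq> 0}
      \<and> (\<forall>x. \<exists>D. GDERIV f x :> D) \<and> continuous_on UNIV (gradient f)}"

(* The completion of C1_c_radial in the norm (\<integral> |x|^\<alpha> |\<nabla>u|^p)^(1/p), realised as a space of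
   functions through its Hardy embedding into L^p(|x|^(\<alpha>-p) dx): u is the L^p(|x|^(\<alpha>-p) dx)-limit
   of a sequence in C1_c_radial whose gradients converge in L^p(|x|^\<alpha> dx), and G, the limit of
   these gradients, is the gradient of u.  Elements are Borel functions, to be identified when
   they agree almost everywhere.  The convergence is expressed with nonnegative integrals, as the
   Bochner integral of a non-integrable function is 0. *)
definition has_D_gradient ::
  "real \<Rightarrow> real \<Rightarrow> (real ^ 'n \<Rightarrow> real) \<Rightarrow> (real ^ 'n \<Rightarrow> real ^ 'n) \<Rightarrow> bool" where
  "has_D_gradient p \<alpha> u G \<longleftrightarrow>
     u \<in> borel_measurable borel \<and> G \<in> borel_measurable borel \<and>
     (\<exists>f :: nat \<Rightarrow> real ^ 'n \<Rightarrow> real. (\<forall>k. f k \<in> C1_c_radial) \<and>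
        (\<lambda>k. \<integral>\<^sup>+ x. ennreal (norm x powr (\<alpha> - p) * \<bar>f k x - u x\<bar> powr p) \<partial>lborel)
          \<longlonglongrightarrow> 0 \<and>
        (\<lambda>k. \<integral>\<^sup>+ x. ennreal (norm x powr \<alpha> * norm (gradient (f k) x - G x) powr p) \<partial>lborel)
          \<longlonglongrightarrow> 0)"

definition D_radial :: "real \<Rightarrow> real \<Rightarrow> (real ^ 'n \<Rightarrow> real) set" where
  "D_radial p \<alpha> = {u. \<exists>G. has_D_gradient p \<alpha> u G}"

(* For p > 1 and \<alpha> \<noteq> p - n the gradient of an element of D_radial is unique up to null sets. *)
definition D_grad ::
  "real \<Rightarrow> real \<Rightarrow> (real ^ 'n \<Rightarrow> real) \<Rightarrow> real ^ 'n \<Rightarrow> real ^ 'n" where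
  "D_grad p \<alpha> u = (SOME G. has_D_gradient p \<alpha> u G)"

definition ae_nonzero :: "(real ^ 'n \<Rightarrow> real) \<Rightarrow> bool" where
  "ae_nonzero u \<longleftrightarrow> \<not> (AE x in lborel. u x = 0)"

definition rhs_weight :: "real \<Rightarrow> real \<Rightarrow> real \<Rightarrow> real ^ 'n \<Rightarrow> real" where
  "rhs_weight p \<alpha> q x =
     norm x powr (- real CARD('n) + q * ((real CARD('n) - p + \<alpha>) / p))"

(* At points where the gradient or u vanishes, 0 powr a = 0 makes the nonlinearities
   |\<nabla>u|^(p-2) \<nabla>u and |u|^(q-2) u vanish also when the exponent is negative. *)
definition weak_solution ::
  "real \<Rightarrow> real \<Rightarrow> real \<Rightarrow> (real ^ 'n \<Rightarrow> real) \<Rightarrow> bool" where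
  "weak_solution p \<alpha> q u \<longleftrightarrow> u \<in> D_radial p \<alpha> \<and>
     (\<forall>\<phi> \<in> D_radial p \<alpha>.
        integrable lborel (\<lambda>x. norm x powr \<alpha> * norm (D_grad p \<alpha> u x) powr (p - 2)
          * (D_grad p \<alpha> u x \<bullet> D_grad p \<alpha> \<phi> x)) \<and>
        integrable lborel (\<lambda>x. rhs_weight p \<alpha> q x * \<bar>u x\<bar> powr (q - 2) * u x * \<phi> x) \<and>
        (LINT x|lborel. norm x powr \<alpha> * norm (D_grad p \<alpha> u x) powr (p - 2)
          * (D_grad p \<alpha> u x \<bullet> D_grad p \<alpha> \<phi> x))
        = (LINT x|lborel. rhs_weight p \<alpha> q x * \<bar>u x\<bar> powr (q - 2) * u x * \<phi> x))"

definition rayleigh_quotient ::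
  "real \<Rightarrow> real \<Rightarrow> real \<Rightarrow> (real ^ 'n \<Rightarrow> real) \<Rightarrow> real" where
  "rayleigh_quotient p \<alpha> q u =
     (LINT x|lborel. norm x powr \<alpha> * norm (D_grad p \<alpha> u x) powr p)
     / (LINT x|lborel. rhs_weight p \<alpha> q x * \<bar>u x\<bar> powr q) powr (p / q)"

(* S_{1,q,0}(\<alpha>) in dimension n = CARD('n); the type argument only fixes the dimension. *)
definition best_constant :: "'n::finite itself \<Rightarrow> real \<Rightarrow> real \<Rightarrow> real \<Rightarrow> real" where
  "best_constant _ p \<alpha> q =
     (INF u \<in> {u :: real ^ 'n \<Rightarrow> real. u \<in> D_radial p \<alpha> \<and> ae_nonzero u}. rayleigh_quotient p \<alpha> q u)"

end

theory Submission
  imports Defs "HOL-Real_Asymp.Real_Asymp"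
begin

text \<open>
  Write \<open>n - p + \<alpha> = \<kappa> (p - 1)\<close>. In the variable \<open>s = \<bar>x\<bar>\<^bsup>-\<kappa>\<^esup>\<close> the radial problem becomes, for either
  sign of \<open>\<kappa>\<close>, the problem of Bliss on the half line: \<open>u(x) = v(s)\<close> with \<open>v(0) = 0\<close>, energy
  \<open>\<integral> \<bar>v'\<bar>\<^bsup>p\<^esup> ds\<close> and constraint \<open>\<integral> s\<^bsup>-1-q\<gamma>\<^esup> \<bar>v\<bar>\<^bsup>q\<^esup> ds\<close>, where \<open>\<gamma> = 1 - 1/p\<close>.

  The sharp inequality is proved by calibration. Put \<open>w = s\<^bsup>-\<gamma>\<^esup> v\<close> and scale \<open>v\<close> so that \<open>max \<bar>w\<bar>\<close> is the
  maximum \<open>M\<close> attained by the extremal. The Lagrangian \<open>\<bar>v'\<bar>\<^bsup>p\<^esup> - (p - 1) s\<^bsup>-1-q\<gamma>\<^esup> \<bar>v\<bar>\<^bsup>q\<^esup>\<close> dominates the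
  derivatives of \<open>\<Phi>1(w)\<close> and of \<open>\<Phi>2(w)\<close>, and the extremal gives equality with \<open>\<Phi>1\<close> before and with
  \<open>\<Phi>2\<close> after its maximum point; the tangent line inequality for \<open>t\<^bsup>p/q\<^esup>\<close> turns the resulting bound
  into the homogeneous one.

  For uniqueness, the lemma of du Bois-Reymond makes weak solutions regular. Their energy is
  conserved and vanishes as \<open>s\<close> tends to 0. Hence \<open>v\<^sup>2\<close> is nondecreasing and \<open>\<bar>v'\<bar>\<close> is nonincreasing, which
  excludes zeros and sign changes, and a second first integral identifies \<open>v\<close>.
\<close>

text \<open>The exponent \<open>\<kappa>\<close> is the one for which weight and Jacobian cancel, so
  that the energy in s carries no weight. With respect to ln s the problem for w is autonomous: the
  velocity of w is \<xi> = \<Theta> - \<gamma> w with \<Theta> = s^(1/p) v'. Hence a calibration may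
  be a function of w alone, and the inequality asked of it says that its derivative is the slope of
  a line through the origin lying below the Lagrangian as a function of \<xi>. For 0 < |w| < M two
  such lines are tangent, one for rising and one for falling w, so no single function gives equality
  along the whole extremal. For |w| > M there is no such line: this obstacle forces the
  normalisation by max |w| and not by the constraint. The return to the homogeneous inequality loses
  nothing, because the multiplier p - 1 is the one for which the profile \<open>V\<close> itself is
  critical.

  General elements of the space are reached by Fatou's lemma and by the bound |v| \<le> s^\<gamma>
  times the L^p norm of v', which turns convergence in energy into pointwise convergence of
  profiles.\<close>

section \<open>Powers, integrals and null sets on the line\<close>

text \<open>\<open>spow a x\<close> is \<open>\<bar>x\<bar>\<^bsup>a-1\<^esup> x\<close>. Since \<open>ln\<close> is even on the reals, \<open>x powr a\<close> depends only on \<open>\<bar>x\<bar>\<close>.\<close>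

definition spow :: "real \<Rightarrow> real \<Rightarrow> real" where
  "spow a x = sgn x * \<bar>x\<bar> powr a"

lemma abs_powr_real [simp]: "\<bar>x\<bar> powr a = x powr a" for x a :: real
  by (cases "x \<ge> 0") (auto simp: uminus_powr_eq)

lemma powr_mult_self_eq_spow: "x powr (a - 1) * x = spow a x" for x a :: real
proof (cases "x = 0")
  case False
  then have "x powr a = x powr (a - 1) * \<bar>x\<bar>"
    using powr_add[of x "a - 1" 1] by simp
  with False show ?thesis by (simp add: spow_def sgn_if)
qed (simp add: spow_def)

lemma spow_0 [simp]: "spow a 0 = 0" by (simp add: spow_def)

lemma spow_pos: "x > 0 \<Longrightarrow> spow a x = x powr a" by (simp add: spow_def)

lemma spow_nonneg: "x \<ge> 0 \<Longrightarrow> spow a x = x powr a" by (cases "x = 0") (auto simp: spow_def)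

lemma spow_minus [simp]: "spow a (- x) = - spow a x"
  by (simp add: spow_def uminus_powr_eq sgn_minus)

lemma spow_mult: "spow a (x * y) = spow a x * spow a y"
  by (simp add: spow_def sgn_mult powr_mult)

lemma abs_spow [simp]: "\<bar>spow a x\<bar> = x powr a"
  by (simp add: spow_def abs_mult abs_sgn_eq)

lemma spow_powr [simp]: "spow a x powr b = x powr (a * b)"
  by (subst abs_powr_real[symmetric]) (simp add: powr_powr)

lemma sgn_spow [simp]: "sgn (spow a x) = sgn x"
  by (auto simp: spow_def sgn_mult sgn_if)

lemma spow_spow: "spow a (spow b x) = spow (b * a) x"
  by (simp add: spow_def[of a] spow_def[of "b * a"] powr_powr)

lemma spow_1 [simp]: "spow 1 x = x"
  by (simp add: spow_def sgn_mult_abs)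

lemma spow_mult_self: "spow a x * x = x powr (a + 1)"
  by (cases "x = 0") (auto simp: spow_def powr_add sgn_if abs_if uminus_powr_eq)

lemma continuous_on_abs_powr:
  fixes a :: real
  assumes "a > 0" shows "continuous_on S (\<lambda>x. x powr a)"
proof -
  have "continuous_on S (\<lambda>x. \<bar>x\<bar> powr a)"
    using assms by (intro continuous_on_powr' continuous_on_rabs continuous_on_id continuous_on_const) auto
  then show ?thesis by simp
qed

lemma isCont_abs_powr: "a > 0 \<Longrightarrow> isCont (\<lambda>x. x powr a) y" for a y :: real
  using continuous_on_abs_powr[of a UNIV] by (simp add: continuous_on_eq_continuous_at)

lemma continuous_on_spow: assumes "a > 0" shows "continuous_on S (spow a)"
proof -
  have "spow a = (\<lambda>x. (max x 0) powr a - (max (-x) 0) powr a)"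
    by (intro ext, rename_tac x)
      (case_tac "x > 0"; case_tac "x < 0"; auto simp: spow_def uminus_powr_eq)
  moreover have "continuous_on S (\<lambda>x. (max x 0) powr a - (max (-x) 0) powr a)"
    using assms by (intro continuous_intros continuous_on_powr') auto
  ultimately show ?thesis by presburger
qed

lemma isCont_spow: "a > 0 \<Longrightarrow> isCont (spow a) y"
  using continuous_on_spow[of a UNIV] by (simp add: continuous_on_eq_continuous_at)

lemma borel_measurable_spow [measurable]: "spow a \<in> borel_measurable borel"
  unfolding spow_def[abs_def] by measurable

text \<open>At 0 the difference quotient is \<open>spow (a - 1) h\<close> itself, which tends to 0
  because a > 1. Elsewhere the usual rule applies, after a reflection if x < 0.\<close>

lemma DERIV_abs_powr:
  assumes "a > 1" shows "((\<lambda>x. x powr a) has_real_derivative a * spow (a - 1) x) (at x)"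
proof (cases "x = 0")
  case True
  have "((\<lambda>h. spow (a - 1) h) \<longlongrightarrow> spow (a - 1) 0) (at 0)"
    using isCont_spow[of "a - 1" 0] assms by (auto simp: isCont_def)
  moreover have "(h powr a - 0 powr a) / (h - 0) = spow (a - 1) h" for h
    using spow_mult_self[of "a - 1" h] by (cases "h = 0") (auto simp: field_simps)
  ultimately show ?thesis using True by (simp add: has_field_derivative_iff)
next
  case False
  show ?thesis
  proof (cases "x > 0")
    case True
    then show ?thesis using has_real_derivative_powr[of x a] by (simp add: spow_pos)
  next
    case n: False
    then have x: "x < 0" using False by simp
    have "((\<lambda>x. (- x) powr a) has_real_derivative a * (- x) powr (a - 1) * (- 1)) (at x)"
      using x by (auto intro!: derivative_eq_intros)
    moreover have "a * (- x) powr (a - 1) * (- 1) = a * spow (a - 1) x"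
      using x by (simp add: spow_def)
    ultimately show ?thesis by (simp add: uminus_powr_eq)
  qed
qed

text \<open>Young's inequality for \<theta>^(p-1) and |z| turns into this tangent line inequality
  once the powers of \<theta> are collected. As \<open>powr\<close> is even, z may have either
  sign.\<close>

lemma powr_tangent:
  assumes "p > 1" "\<theta> \<ge> (0::real)"
  shows "\<theta> powr p + p * \<theta> powr (p - 1) * (z - \<theta>) \<le> z powr p"
proof -
  have "\<theta> powr (p - 1) * \<bar>z\<bar> \<le> (\<theta> powr (p - 1)) powr (p / (p - 1)) / (p / (p - 1)) + \<bar>z\<bar> powr p / p"
    using assms by (intro Youngs_inequality) (auto simp: field_simps)
  then have "\<theta> powr (p - 1) * \<bar>z\<bar> \<le> \<theta> powr p * (p - 1) / p + z powr p / p"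
    using assms by (simp add: powr_powr)
  then have 1: "p * \<theta> powr (p - 1) * \<bar>z\<bar> \<le> \<theta> powr p * (p - 1) + z powr p"
    using assms by (simp add: field_simps)
  have 2: "\<theta> powr (p - 1) * \<theta> = \<theta> powr p"
    using assms powr_mult_self_eq_spow[of \<theta> p] by (simp add: spow_nonneg)
  have "p * \<theta> powr (p - 1) * z \<le> p * \<theta> powr (p - 1) * \<bar>z\<bar>"
    using assms by (intro mult_left_mono) auto
  with 1 2 show ?thesis by (simp add: algebra_simps)
qed

text \<open>Young's inequality with its constants rounded up to 1. It serves to bound the mixed term
  of the conserved energy near s = 0, where only the order of magnitude matters.\<close>

lemma mult_spow_le:
  fixes a b :: real
  assumes "p > 1" shows "\<bar>a * spow (p - 1) b\<bar> \<le> a powr p + b powr p"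
proof -
  have "\<bar>a\<bar> * \<bar>b\<bar> powr (p - 1) \<le> \<bar>a\<bar> powr p / p + (\<bar>b\<bar> powr (p - 1)) powr (p / (p - 1)) / (p / (p - 1))"
    using assms by (intro Youngs_inequality) (auto simp: field_simps)
  also have "\<dots> = a powr p / p + b powr p * ((p - 1) / p)" using assms by (simp add: powr_powr)
  also have "\<dots> \<le> a powr p * 1 + b powr p * 1"
    using assms mult_right_mono[of 1 p "a powr p"] by (intro add_mono mult_left_mono) (auto simp: field_simps)
  finally show ?thesis by (simp add: abs_mult)
qed

text \<open>Young's inequality for f / a and g / b, where a and b are the two norms. If one of the
  norms vanishes, the product is 0 almost everywhere.\<close>

lemma Holder_inequality_integral:
  fixes f g :: "'a \<Rightarrow> real"
  assumes [measurable]: "f \<in> borel_measurable M" "g \<in> borel_measurable M"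
    and r: "r > 1" "r' > 1" "1 / r + 1 / r' = 1"
    and f: "integrable M (\<lambda>x. f x powr r)" and g: "integrable M (\<lambda>x. g x powr r')"
  shows "integrable M (\<lambda>x. f x * g x)"
    and "(\<integral>x. \<bar>f x * g x\<bar> \<partial>M) \<le> (\<integral>x. f x powr r \<partial>M) powr (1 / r) * (\<integral>x. g x powr r' \<partial>M) powr (1 / r')"
proof -
  have Y: "\<bar>f x * g x\<bar> \<le> f x powr r / r + g x powr r' / r'" for x
    using Youngs_inequality[OF r, of "\<bar>f x\<bar>" "\<bar>g x\<bar>"] by (simp add: abs_mult)
  show I: "integrable M (\<lambda>x. f x * g x)"
    by (rule Bochner_Integration.integrable_bound[of M "\<lambda>x. f x powr r / r + g x powr r' / r'"])
       (use f g Y in \<open>auto intro!: AE_I2 order.trans[OF Y]\<close>)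
  define A where "A = (\<integral>x. f x powr r \<partial>M)"
  define B where "B = (\<integral>x. g x powr r' \<partial>M)"
  have AB: "A \<ge> 0" "B \<ge> 0" by (auto simp: A_def B_def)
  show "(\<integral>x. \<bar>f x * g x\<bar> \<partial>M) \<le> A powr (1 / r) * B powr (1 / r')"
  proof (cases "A = 0 \<or> B = 0")
    case True
    have "AE x in M. f x * g x = 0"
      using True integral_nonneg_eq_0_iff_AE[OF f] integral_nonneg_eq_0_iff_AE[OF g]
      by (auto simp: A_def B_def)
    then have "(\<integral>x. \<bar>f x * g x\<bar> \<partial>M) = 0"
      by (intro integral_eq_zero_AE) auto
    then show ?thesis by simp
  next
    case False
    with AB have pos: "A > 0" "B > 0" by auto
    define a where "a = A powr (1 / r)"
    define b where "b = B powr (1 / r')"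
    have ab: "a > 0" "b > 0" "a powr r = A" "b powr r' = B"
      using pos r by (auto simp: a_def b_def powr_powr)
    have "\<bar>f x * g x\<bar> \<le> a * b * (f x powr r / A / r + g x powr r' / B / r')" for x
    proof -
      have "\<bar>f x / a * (g x / b)\<bar> \<le> (f x / a) powr r / r + (g x / b) powr r' / r'"
        using Youngs_inequality[OF r, of "\<bar>f x / a\<bar>" "\<bar>g x / b\<bar>"] by (simp only: abs_mult abs_powr_real abs_ge_zero)
      then have "\<bar>f x * g x\<bar> / (a * b) \<le> f x powr r / A / r + g x powr r' / B / r'"
        using ab by (simp add: powr_divide abs_mult)
      then show ?thesis using ab by (simp add: field_simps)
    qed
    then have "(\<integral>x. \<bar>f x * g x\<bar> \<partial>M) \<le> (\<integral>x. a * b * (f x powr r / A / r + g x powr r' / B / r') \<partial>M)"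
      using I f g by (intro integral_mono) auto
    also have "\<dots> = a * b * (A / A / r + B / B / r')"
      using f g by (simp add: A_def B_def)
    also have "\<dots> = a * b" using pos r by simp
    finally show ?thesis by (simp add: a_def b_def)
  qed
qed

text \<open>On a compact interval the positive and the negative part of h are densities of finite
  measures, and the vanishing integrals make these measures agree on all half-lines, hence
  everywhere. So the two parts agree almost everywhere, which forces both to be 0.\<close>

lemma AE_eq_0_of_integral_Icc_eq_0:
  fixes h :: "real \<Rightarrow> real"
  assumes [measurable]: "h \<in> borel_measurable borel"
    and int: "\<And>a b. 0 < a \<Longrightarrow> a < b \<Longrightarrow> set_integrable lborel {a..b} h"
    and zero: "\<And>a b. 0 < a \<Longrightarrow> a < b \<Longrightarrow> (LINT s:{a..b}|lborel. h s) = 0"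
  shows "AE s in lborel. 0 < s \<longrightarrow> h s = 0"
proof -
  have *: "AE s in lborel. s \<in> {a..b} \<longrightarrow> h s = 0" if ab: "0 < a" "a < b" for a b
  proof -
    define u where "u = (\<lambda>s. indicator {a..b} s * max 0 (h s))"
    define v where "v = (\<lambda>s. indicator {a..b} s * max 0 (- h s))"
    have [measurable]: "u \<in> borel_measurable borel" "v \<in> borel_measurable borel"
      by (auto simp: u_def v_def)
    have hI: "integrable lborel (\<lambda>s. indicator {a..b} s * h s)"
      using int[OF ab] by (simp add: set_integrable_def)
    have uI: "integrable lborel u" and vI: "integrable lborel v"
      by (rule Bochner_Integration.integrable_bound[OF hI]; auto simp: u_def v_def indicator_def)+
    have um: "emeasure (density lborel (\<lambda>s. ennreal (u s))) {x<..} = ennreal (LINT s:{x<..}|lborel. u s)" for x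
    proof -
      have "integrable lborel (\<lambda>s. indicator {x<..} s *\<^sub>R u s)"
        by (rule integrable_mult_indicator[OF _ uI]) simp
      from nn_integral_eq_integral[OF this] have "(\<integral>\<^sup>+ s. ennreal (indicator {x<..} s *\<^sub>R u s) \<partial>lborel) = ennreal (LINT s:{x<..}|lborel. u s)"
        by (simp add: set_lebesgue_integral_def u_def)
      then show ?thesis
        by (subst emeasure_density) (auto simp: indicator_def intro!: nn_integral_cong simp flip: \<open>(\<integral>\<^sup>+ s. ennreal (indicator {x<..} s *\<^sub>R u s) \<partial>lborel) = _\<close>)
    qed
    have vm: "emeasure (density lborel (\<lambda>s. ennreal (v s))) {x<..} = ennreal (LINT s:{x<..}|lborel. v s)" for x
    proof -
      have "integrable lborel (\<lambda>s. indicator {x<..} s *\<^sub>R v s)"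
        by (rule integrable_mult_indicator[OF _ vI]) simp
      from nn_integral_eq_integral[OF this] have "(\<integral>\<^sup>+ s. ennreal (indicator {x<..} s *\<^sub>R v s) \<partial>lborel) = ennreal (LINT s:{x<..}|lborel. v s)"
        by (simp add: set_lebesgue_integral_def v_def)
      then show ?thesis
        by (subst emeasure_density) (auto simp: indicator_def intro!: nn_integral_cong simp flip: \<open>(\<integral>\<^sup>+ s. ennreal (indicator {x<..} s *\<^sub>R v s) \<partial>lborel) = _\<close>)
    qed
    have "density lborel (\<lambda>s. ennreal (u s)) = density lborel (\<lambda>s. ennreal (v s))"
    proof (rule measure_eqI_lessThan)
      fix x :: real
      show "emeasure (density lborel (\<lambda>s. ennreal (u s))) {x<..} < \<infinity>" by (simp add: um)
      have "(LINT s:{x<..}|lborel. u s) - (LINT s:{x<..}|lborel. v s) =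
            (LINT s|lborel. indicator {x<..} s * u s - indicator {x<..} s * v s)"
        unfolding set_lebesgue_integral_def
        using integrable_mult_indicator[OF _ uI, of "{x<..}"] integrable_mult_indicator[OF _ vI, of "{x<..}"]
        by simp
      also have "\<dots> = (LINT s|lborel. indicator ({a..b} \<inter> {x<..}) s * h s)"
        by (intro Bochner_Integration.integral_cong) (auto simp: u_def v_def indicator_def)
      also have "\<dots> = 0"
      proof (cases "x < b")
        case True
        define c where "c = max a x"
        have "(LINT s|lborel. indicator ({a..b} \<inter> {x<..}) s * h s) = (LINT s|lborel. indicator {c..b} s * h s)"
          using AE_lborel_singleton[of x]
          by (intro integral_cong_AE) (auto simp: c_def indicator_def)
        also have "\<dots> = 0"
          using zero[of c b] ab True by (auto simp: set_lebesgue_integral_def c_def max_def)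
        finally show ?thesis .
      next
        case False
        then have e: "{a..b} \<inter> {x<..} = {}" by auto
        show ?thesis unfolding e by simp
      qed
      finally show "emeasure (density lborel (\<lambda>s. ennreal (u s))) {x<..} =
         emeasure (density lborel (\<lambda>s. ennreal (v s))) {x<..}" by (simp add: um vm)
    qed auto
    then have "AE s in lborel. ennreal (u s) = ennreal (v s)"
      using integrableD(2)[OF uI]
      by (subst finite_density_unique[symmetric]) (auto simp: u_def)
    then show ?thesis
      by eventually_elim (auto simp: u_def v_def max_def split: if_splits)
  qed
  \<comment> \<open>Countably many intervals exhaust the open half line. The right end point is
    shifted so that the interval is nondegenerate already for n = 0.\<close>
  have "AE s in lborel. \<forall>n::nat. s \<in> {inverse (real (Suc n))..real (Suc (Suc n))} \<longrightarrow> h s = 0"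
    by (subst AE_all_countable, intro allI *) (auto simp: field_simps intro!: add_pos_nonneg)
  then show ?thesis
  proof eventually_elim
    fix s assume A: "\<forall>n::nat. s \<in> {inverse (real (Suc n))..real (Suc (Suc n))} \<longrightarrow> h s = 0"
    show "0 < s \<longrightarrow> h s = 0"
    proof
      assume s: "0 < s"
      obtain m where m: "inverse (real (Suc m)) < s" using reals_Archimedean[OF s] by auto
      obtain l :: nat where l: "s < real l" using reals_Archimedean2 by blast
      have "inverse (real (Suc (max m l))) \<le> inverse (real (Suc m))" by (intro le_imp_inverse_le) auto
      moreover have "real l \<le> real (Suc (Suc (max m l)))" by simp
      ultimately show "h s = 0" using A[rule_format, of "max m l"] m l
        unfolding atLeastAtMost_iff by linarith
    qed
  qed
qed

section \<open>One-dimensional reduction and calibrations\<close>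

locale bliss =
  fixes p q :: real
  assumes p: "p > 1" and q: "q > p"
begin

text \<open>The Hoelder exponent of functions with derivative in L^p. It makes w = s^(-\<gamma>) v
  the quantity whose size is bounded by the energy at every scale.\<close>

definition \<gamma> :: real where "\<gamma> = 1 - 1 / p"
definition k :: real where "k = (q - p) / p"
text \<open>The extremal of Bliss, normalised to have slope 1 at the origin. The extension by 0
  allows integrals over the half line to be written over the whole line.\<close>

definition V :: "real \<Rightarrow> real" where "V s = (if s > 0 then s * (1 + s powr k) powr (- 1 / k) else 0)"

abbreviation wt :: "real \<Rightarrow> real" where "wt s \<equiv> s powr (- 1 - q * \<gamma>)"

lemma \<gamma>_pos: "\<gamma> > 0" using p by (simp add: \<gamma>_def)
lemma k_pos: "k > 0" using p q by (simp add: k_def)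
lemma p_\<gamma>: "p * \<gamma> = p - 1" using p by (simp add: \<gamma>_def field_simps)
lemma q_div_p: "q / p = k + 1" using p by (simp add: k_def field_simps)
lemma q_minus_q_\<gamma>: "q - q * \<gamma> = k + 1" using p by (simp add: k_def \<gamma>_def field_simps)

text \<open>For w > 0 and 0 \<le> y < 1, the tangent to \<xi> \<mapsto> |\<xi> + \<gamma> w|^p - (p
  - 1) w^q at the point \<xi> + \<gamma> w = w (1 - y) passes through the origin exactly when
  \<open>h y = w powr (q - p)\<close>.\<close>

definition h :: "real \<Rightarrow> real" where "h y = y * (1 - y) powr (p - 1)"
text \<open>The largest w for which \<open>h y = w powr (q - p)\<close> is solvable in [0, 1], as
  \<open>h\<close> has its maximum at 1 / p. Since 1 - 1 / p = \<gamma>, the tangent point there is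
  \<xi> = 0: the two tangents merge and a calibrated curve turns back.\<close>

definition M :: real where "M = h (1 / p) powr (1 / (q - p))"
text \<open>The factor p - 1 is chosen such that \<open>V\<close> solves the Euler-Lagrange equation
  without rescaling: p (|v'|^(p-1))' = - (p - 1) q \<open>wt\<close> v^(q-1) for positive increasing
  v, and p \<gamma> = p - 1 gives the factor q \<gamma> satisfied by \<open>V\<close>.\<close>

definition lagrangian :: "(real \<Rightarrow> real) \<Rightarrow> (real \<Rightarrow> real) \<Rightarrow> real \<Rightarrow> real" where
  "lagrangian \<psi> \<psi>' s = \<psi>' s powr p - (p - 1) * (wt s * \<psi> s powr q)"
text \<open>With \<Theta> = s^(1/p) v', the difference \<Theta> - \<gamma> w is the derivative of w
  with respect to ln s. The inequality is confined to |w| \<le> M because for larger |w| and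
  \<Theta> = \<gamma> w its right-hand side is negative while the left-hand side is 0, whatever P
  is.\<close>

definition calibration :: "(real \<Rightarrow> real) \<Rightarrow> (real \<Rightarrow> real) \<Rightarrow> bool" where
  "calibration \<Phi> P \<longleftrightarrow> continuous_on UNIV P \<and>
     (\<forall>w. \<bar>w\<bar> \<le> M \<longrightarrow> (\<Phi> has_real_derivative P w) (at w)) \<and>
     (\<forall>w \<Theta>. \<bar>w\<bar> \<le> M \<longrightarrow> P w * (\<Theta> - \<gamma> * w) \<le> \<Theta> powr p - (p - 1) * w powr q)"

section \<open>The function \<open>h\<close> and its two monotone branches\<close>

lemma continuous_on_h: "continuous_on S h"
  unfolding h_def[abs_def] using p
  by (intro continuous_intros continuous_on_compose2[OF continuous_on_abs_powr[of "p - 1" UNIV]]) auto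

lemma h_pos: "h (1 / p) > 0"
  using p by (auto simp: h_def)

lemma M_pos: "M > 0" using h_pos by (simp add: M_def)

lemma M_powr: "M powr (q - p) = h (1 / p)"
  using h_pos q by (simp add: M_def powr_powr)

lemma DERIV_h:
  assumes "0 < y" "y < 1"
  shows "(h has_real_derivative (1 - y) powr (p - 2) * (1 - p * y)) (at y)"
proof -
  have "(1 - y) powr (p - 1) = (1 - y) powr (p - 2) * (1 - y)"
    using assms powr_add[of "1 - y" "p - 2" 1] by simp
  then show ?thesis
    unfolding h_def[abs_def] using assms by (auto intro!: derivative_eq_intros simp: algebra_simps)
qed

lemma h_less_left:
  assumes xy: "x < y" "x \<in> {0..1 / p}" "y \<in> {0..1 / p}" shows "h x < h y"
proof (rule DERIV_pos_imp_increasing_open[OF xy(1) _ continuous_on_h])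
  fix z assume z: "x < z" "z < y"
  have z1: "0 < z" "z < 1 / p" using z xy by auto
  moreover have "1 / p < 1" using p by simp
  ultimately have "z < 1" by linarith
  have "p * z < 1" using z1 p by (simp add: field_simps)
  with \<open>z < 1\<close> have "0 < (1 - z) powr (p - 2) * (1 - p * z)" by (intro mult_pos_pos) auto
  then show "\<exists>y. (h has_real_derivative y) (at z) \<and> 0 < y"
    using DERIV_h[OF z1(1) \<open>z < 1\<close>] by blast
qed

lemma h_less_right:
  assumes xy: "x < y" "x \<in> {1 / p..1}" "y \<in> {1 / p..1}" shows "h y < h x"
proof (rule DERIV_neg_imp_decreasing_open[OF xy(1) _ continuous_on_h])
  fix z assume z: "x < z" "z < y"
  have z1: "1 / p < z" "z < 1" using z xy by auto
  moreover have "0 < 1 / p" using p by simp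
  ultimately have "0 < z" by linarith
  have "1 < p * z" using z1 p by (simp add: field_simps)
  with z1 have "(1 - z) powr (p - 2) * (1 - p * z) < 0" by (intro mult_pos_neg) auto
  then show "\<exists>y. (h has_real_derivative y) (at z) \<and> y < 0"
    using DERIV_h[OF \<open>0 < z\<close> z1(2)] by blast
qed

lemma h_inj_left: "inj_on h {0..1 / p}"
proof (rule linorder_inj_onI)
  fix x y assume "x < y" "x \<in> {0..1 / p}" "y \<in> {0..1 / p}"
  from h_less_left[OF this] show "h x \<noteq> h y" by simp
qed auto

lemma h_inj_right: "inj_on h {1 / p..1}"
proof (rule linorder_inj_onI)
  fix x y assume "x < y" "x \<in> {1 / p..1}" "y \<in> {1 / p..1}"
  from h_less_right[OF this] show "h x \<noteq> h y" by simp
qed auto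

lemma h_le_max:
  assumes "0 \<le> y" "y \<le> 1" shows "h y \<le> h (1 / p)"
proof (cases y "1 / p" rule: linorder_cases)
  case less
  then show ?thesis using h_less_left[of y "1 / p"] assms p by auto
next
  case greater
  then show ?thesis using h_less_right[of "1 / p" y] assms p by auto
qed auto

lemma h_image_left: "{0..h (1 / p)} \<subseteq> h ` {0..1 / p}"
proof
  fix z assume "z \<in> {0..h (1 / p)}"
  then have "\<exists>y\<ge>0. y \<le> 1 / p \<and> h y = z"
    using p by (intro IVT' continuous_on_h) (auto simp: h_def)
  then show "z \<in> h ` {0..1 / p}" by auto
qed

lemma h_image_right: "{0..h (1 / p)} \<subseteq> h ` {1 / p..1}"
proof
  fix z assume "z \<in> {0..h (1 / p)}"
  then have "\<exists>y\<ge>1 / p. y \<le> 1 \<and> h y = z"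
    using p by (intro IVT2' continuous_on_h) (auto simp: h_def)
  then show "z \<in> h ` {1 / p..1}" by auto
qed

text \<open>For \<open>0 \<le> w \<le> M\<close> the two solutions \<open>y\<close> of \<open>h y = w\<^bsup>q-p\<^esup>\<close> give the two lines through the
  origin that are tangent to the graph of
  \<open>\<xi> \<mapsto> \<bar>\<xi> + \<gamma> w\<bar>\<^bsup>p\<^esup> - (p - 1) w\<^bsup>q\<^esup>\<close>, one touching it from each side.\<close>

lemma calibration_exists:
  assumes cd: "0 \<le> c" "d \<le> 1" and inj: "inj_on h {c..d}" and im: "{0..h (1 / p)} \<subseteq> h ` {c..d}"
  obtains \<Phi> P where "calibration \<Phi> P"
    "\<And>w y. 0 \<le> w \<Longrightarrow> w \<le> M \<Longrightarrow> y \<in> {c..d} \<Longrightarrow> h y = w powr (q - p) \<Longrightarrow>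
      P w * (w * (1 - y) - \<gamma> * w) = (w * (1 - y)) powr p - (p - 1) * w powr q"
proof -
  define Y where "Y = the_inv_into {c..d} h"
  \<comment> \<open>The slope of the tangent line is the derivative of |\<Theta>|^p at the tangent
    point \<Theta> = w (1 - y). Cutting |w| off at M in the argument of \<open>Y\<close> keeps P
    continuous on the whole line; P is odd in w.\<close>
  define P where "P w = p * spow (p - 1) (w * (1 - Y ((min \<bar>w\<bar> M) powr (q - p))))" for w
  have inM: "(min \<bar>w\<bar> M) powr (q - p) \<in> {0..h (1 / p)}" for w
    using q M_pos unfolding M_powr[symmetric] by (auto intro!: powr_mono2)
  have Y: "Y z \<in> {c..d}" "h (Y z) = z" if "z \<in> {0..h (1 / p)}" for z
  proof -
    have z: "z \<in> h ` {c..d}" using that im by auto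
    show "Y z \<in> {c..d}" unfolding Y_def by (rule the_inv_into_into[OF inj z]) simp
    show "h (Y z) = z" unfolding Y_def by (rule f_the_inv_into_f[OF inj z])
  qed
  have contY: "continuous_on {0..h (1 / p)} Y"
    unfolding Y_def
    by (rule continuous_on_subset[OF continuous_on_inv_into[OF continuous_on_h compact_Icc inj] im])
  have contW: "continuous_on UNIV (\<lambda>w. (min \<bar>w\<bar> M) powr (q - p))"
    using q M_pos by (intro continuous_on_powr' continuous_intros) auto
  have contP: "continuous_on UNIV P"
    unfolding P_def[abs_def]
    by (intro continuous_intros continuous_on_compose2[OF continuous_on_spow[of "p - 1" UNIV]]
          continuous_on_compose2[OF contY contW]) (use p inM in auto)
  \<comment> \<open>The antiderivative is taken on an interval twice as long, so that its derivative
    is two-sided at w = M and w = - M as well.\<close>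
  obtain \<Phi> where \<Phi>: "\<And>w. w \<in> {- (2 * M)..2 * M} \<Longrightarrow> (\<Phi> has_vector_derivative P w) (at w within {- (2 * M)..2 * M})"
    by (rule antiderivative_continuous[OF continuous_on_subset[OF contP subset_UNIV]]) blast
  have D\<Phi>: "(\<Phi> has_real_derivative P w) (at w)" if "\<bar>w\<bar> \<le> M" for w
  proof -
    have w: "w \<in> {- (2 * M)<..<2 * M}" using that M_pos by auto
    have "(\<Phi> has_vector_derivative P w) (at w within {- (2 * M)<..<2 * M})"
      by (rule has_vector_derivative_within_subset[OF \<Phi>]) (use w in auto)
    then have "(\<Phi> has_vector_derivative P w) (at w)"
      using has_vector_derivative_within_open[OF w open_greaterThanLessThan] by blast
    then show ?thesis by (simp only: has_real_derivative_iff_has_vector_derivative)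
  qed
  \<comment> \<open>The tangent at \<theta> passes through the origin. After the factor
    \<theta>^(p-1) w is taken out, the difference of the two sides is a linear expression in y,
    which vanishes because p \<gamma> = p - 1.\<close>
  have key: "\<theta> powr p - (p - 1) * w powr q = p * \<theta> powr (p - 1) * (\<theta> - \<gamma> * w)"
    if w: "0 \<le> w" and y: "0 \<le> y" "y \<le> 1" and hy: "h y = w powr (q - p)" and \<theta>: "\<theta> = w * (1 - y)" for w y \<theta>
  proof -
    have "w powr q = w powr p * (y * (1 - y) powr (p - 1))"
      using hy by (simp add: h_def flip: powr_add)
    moreover have "\<theta> powr p = \<theta> powr (p - 1) * \<theta>"
      using powr_mult_self_eq_spow[of \<theta> p] w y \<theta> by (simp add: spow_nonneg)
    moreover have "w powr p = w powr (p - 1) * w"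
      using powr_mult_self_eq_spow[of w p] w by (simp add: spow_nonneg)
    moreover have "\<theta> powr (p - 1) = w powr (p - 1) * (1 - y) powr (p - 1)" by (simp add: \<theta> powr_mult)
    ultimately have "\<theta> powr p - (p - 1) * w powr q - p * \<theta> powr (p - 1) * (\<theta> - \<gamma> * w)
       = \<theta> powr (p - 1) * w * ((1 - y) - (p - 1) * y - p * (1 - y) + p * \<gamma>)"
      by (simp add: \<theta> algebra_simps)
    then show ?thesis by (simp add: p_\<gamma> algebra_simps)
  qed
  have low: "P w * (\<Theta> - \<gamma> * w) \<le> \<Theta> powr p - (p - 1) * w powr q" if w: "0 \<le> w" "w \<le> M" for w \<Theta>
  proof -
    define y where "y = Y ((min \<bar>w\<bar> M) powr (q - p))"
    have y: "y \<in> {c..d}" "h y = w powr (q - p)" using Y[OF inM[of w]] w by (auto simp: y_def)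
    define \<theta> where "\<theta> = w * (1 - y)"
    have \<theta>0: "\<theta> \<ge> 0" using w y cd by (auto simp: \<theta>_def)
    have Pw: "P w = p * \<theta> powr (p - 1)" using \<theta>0 by (simp add: P_def y_def[symmetric] \<theta>_def[symmetric] spow_nonneg)
    have "\<theta> powr p - (p - 1) * w powr q = p * \<theta> powr (p - 1) * (\<theta> - \<gamma> * w)"
      by (rule key[OF w(1) _ _ y(2) \<theta>_def]) (use y cd in auto)
    with powr_tangent[OF p \<theta>0, of \<Theta>] show ?thesis unfolding Pw by (simp add: algebra_simps)
  qed
  have "calibration \<Phi> P"
    unfolding calibration_def
  proof (intro conjI allI impI contP D\<Phi>)
    fix w \<Theta> :: real assume w: "\<bar>w\<bar> \<le> M"
    show "P w * (\<Theta> - \<gamma> * w) \<le> \<Theta> powr p - (p - 1) * w powr q"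
    proof (cases "w \<ge> 0")
      case False
      have "P (- w) * (- \<Theta> - \<gamma> * - w) \<le> (- \<Theta>) powr p - (p - 1) * (- w) powr q"
        using False w by (intro low) auto
      moreover have "P (- w) = - P w" by (simp add: P_def)
      ultimately show ?thesis by (simp add: uminus_powr_eq algebra_simps)
    qed (use low w in auto)
  qed
  moreover have "P w * (w * (1 - y) - \<gamma> * w) = (w * (1 - y)) powr p - (p - 1) * w powr q"
    if w: "0 \<le> w" "w \<le> M" and y: "y \<in> {c..d}" "h y = w powr (q - p)" for w y
  proof -
    have "Y ((min \<bar>w\<bar> M) powr (q - p)) = y"
      using y Y[OF inM[of w]] w by (subst inj_on_eq_iff[OF inj, symmetric]) auto
    then have "P w = p * (w * (1 - y)) powr (p - 1)"
      using w y cd by (simp add: P_def spow_nonneg)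
    then show ?thesis using key[OF w(1) _ _ y(2) refl] y cd by simp
  qed
  ultimately show ?thesis by (rule that)
qed

text \<open>Fixed by a choice once and for all, since the bound for test profiles and the value at
  the extremal must refer to the same function. Only differences of its values enter, so the
  constant of integration is immaterial. For y \<le> 1 / p the velocity w (1 - y) - \<gamma> w is
  nonnegative: this is the rising half.\<close>

definition \<Phi>1 where "\<Phi>1 = (SOME \<Phi>. \<exists>P. calibration \<Phi> P \<and> (\<forall>w y. 0 \<le> w \<longrightarrow> w \<le> M \<longrightarrow> y \<in> {0..1 / p} \<longrightarrow> h y = w powr (q - p) \<longrightarrow>
      P w * (w * (1 - y) - \<gamma> * w) = (w * (1 - y)) powr p - (p - 1) * w powr q))"
text \<open>The counterpart for y \<ge> 1 / p, where the velocity at the tangent point is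
  nonpositive.\<close>

definition \<Phi>2 where "\<Phi>2 = (SOME \<Phi>. \<exists>P. calibration \<Phi> P \<and> (\<forall>w y. 0 \<le> w \<longrightarrow> w \<le> M \<longrightarrow> y \<in> {1 / p..1} \<longrightarrow> h y = w powr (q - p) \<longrightarrow>
      P w * (w * (1 - y) - \<gamma> * w) = (w * (1 - y)) powr p - (p - 1) * w powr q))"

lemma calibration_\<Phi>1:
  obtains P where "calibration \<Phi>1 P" "\<And>w y. 0 \<le> w \<Longrightarrow> w \<le> M \<Longrightarrow> y \<in> {0..1 / p} \<Longrightarrow> h y = w powr (q - p) \<Longrightarrow>
      P w * (w * (1 - y) - \<gamma> * w) = (w * (1 - y)) powr p - (p - 1) * w powr q"
proof -
  have "\<exists>\<Phi> P. calibration \<Phi> P \<and> (\<forall>w y. 0 \<le> w \<longrightarrow> w \<le> M \<longrightarrow> y \<in> {0..1 / p} \<longrightarrow> h y = w powr (q - p) \<longrightarrow>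
      P w * (w * (1 - y) - \<gamma> * w) = (w * (1 - y)) powr p - (p - 1) * w powr q)"
    by (rule calibration_exists[OF _ _ h_inj_left h_image_left]) (use p in auto)
  from someI_ex[OF this] show ?thesis unfolding \<Phi>1_def[symmetric] using that by blast
qed

lemma calibration_\<Phi>2:
  obtains P where "calibration \<Phi>2 P" "\<And>w y. 0 \<le> w \<Longrightarrow> w \<le> M \<Longrightarrow> y \<in> {1 / p..1} \<Longrightarrow> h y = w powr (q - p) \<Longrightarrow>
      P w * (w * (1 - y) - \<gamma> * w) = (w * (1 - y)) powr p - (p - 1) * w powr q"
proof -
  have "\<exists>\<Phi> P. calibration \<Phi> P \<and> (\<forall>w y. 0 \<le> w \<longrightarrow> w \<le> M \<longrightarrow> y \<in> {1 / p..1} \<longrightarrow> h y = w powr (q - p) \<longrightarrow>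
      P w * (w * (1 - y) - \<gamma> * w) = (w * (1 - y)) powr p - (p - 1) * w powr q)"
    by (rule calibration_exists[OF _ _ h_inj_right h_image_right]) (use p in auto)
  from someI_ex[OF this] show ?thesis unfolding \<Phi>2_def[symmetric] using that by blast
qed

section \<open>Calibrations evaluated along a profile\<close>

lemma scaled_deriv:
  assumes s: "s > 0" and D: "(\<psi> has_real_derivative \<psi>' s) (at s)"
  shows "((\<lambda>s. s powr (- \<gamma>) * \<psi> s) has_real_derivative
    (s powr (1 / p) * \<psi>' s - \<gamma> * (s powr (- \<gamma>) * \<psi> s)) / s) (at s)"
proof -
  have 1: "((\<lambda>s. s powr (- \<gamma>)) has_real_derivative - \<gamma> * s powr (- \<gamma> - 1)) (at s)"
    by (rule has_real_derivative_powr[OF s])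
  have 2: "s powr (1 / p) = s powr (- \<gamma>) * s"
    using s powr_add[of s "- \<gamma>" 1] by (simp add: \<gamma>_def)
  have 3: "s powr (- \<gamma> - 1) = s powr (- \<gamma>) / s"
    using s by (simp add: powr_diff)
  show ?thesis
    by (rule DERIV_cong[OF DERIV_mult[OF 1 D]]) (use s in \<open>simp add: 2 3 field_simps\<close>)
qed

text \<open>With respect to the measure ds / s the Lagrangian depends on s only through w and
  s^(1/p) v'. This autonomy is why a function of w alone can calibrate.\<close>

lemma lagrangian_scaled:
  assumes s: "s > 0"
  shows "lagrangian \<psi> \<psi>' s = ((s powr (1 / p) * \<psi>' s) powr p - (p - 1) * (s powr (- \<gamma>) * \<psi> s) powr q) / s"
proof -
  have 1: "wt s = s powr (- (\<gamma> * q)) / s"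
  proof -
    have "- 1 - q * \<gamma> = - (\<gamma> * q) - 1" by simp
    then show ?thesis using s powr_diff[of s "- (\<gamma> * q)" 1] by (simp only: powr_one' abs_of_pos)
  qed
  show ?thesis
    unfolding lagrangian_def powr_mult powr_powr 1 using p s by (simp add: field_simps)
qed

lemma calibration_deriv:
  assumes cal: "calibration \<Phi> P" and s: "s > 0" and D: "(\<psi> has_real_derivative \<psi>' s) (at s)"
    and bd: "\<bar>s powr (- \<gamma>) * \<psi> s\<bar> \<le> M"
  defines "w \<equiv> s powr (- \<gamma>) * \<psi> s"
  shows "((\<lambda>s. \<Phi> (s powr (- \<gamma>) * \<psi> s)) has_real_derivative
      P w * (s powr (1 / p) * \<psi>' s - \<gamma> * w) / s) (at s)"
    and "P w * (s powr (1 / p) * \<psi>' s - \<gamma> * w) / s \<le> lagrangian \<psi> \<psi>' s"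
proof -
  have "(\<Phi> has_real_derivative P w) (at w)" using cal bd by (auto simp: calibration_def w_def)
  from DERIV_chain2[OF this[unfolded w_def] scaled_deriv[where s = s and \<psi> = \<psi> and \<psi>' = \<psi>', OF s D]]
  show "((\<lambda>s. \<Phi> (s powr (- \<gamma>) * \<psi> s)) has_real_derivative
      P w * (s powr (1 / p) * \<psi>' s - \<gamma> * w) / s) (at s)" by (simp add: w_def)
  show "P w * (s powr (1 / p) * \<psi>' s - \<gamma> * w) / s \<le> lagrangian \<psi> \<psi>' s"
    unfolding lagrangian_scaled[OF s] w_def[symmetric]
    using cal s bd by (intro divide_right_mono) (auto simp: calibration_def w_def)
qed

lemma continuous_on_lagrangian:
  assumes "continuous_on S \<psi>" "continuous_on S \<psi>'" "S \<subseteq> {0<..}"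
  shows "continuous_on S (lagrangian \<psi> \<psi>')"
  unfolding lagrangian_def[abs_def] using assms p q
  by (intro continuous_intros continuous_on_compose2[OF continuous_on_abs_powr[of p UNIV]]
      continuous_on_compose2[OF continuous_on_abs_powr[of q UNIV]]) auto

lemma calibration_bound:
  assumes cal: "calibration \<Phi> P" and ab: "0 < a" "a \<le> b"
    and D: "\<And>s. a \<le> s \<Longrightarrow> s \<le> b \<Longrightarrow> (\<psi> has_real_derivative \<psi>' s) (at s)"
    and cont: "continuous_on {a..b} \<psi>'"
    and bd: "\<And>s. a \<le> s \<Longrightarrow> s \<le> b \<Longrightarrow> \<bar>s powr (- \<gamma>) * \<psi> s\<bar> \<le> M"
  shows "\<Phi> (b powr (- \<gamma>) * \<psi> b) - \<Phi> (a powr (- \<gamma>) * \<psi> a)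
    \<le> (LINT s|lborel. indicator {a..b} s * lagrangian \<psi> \<psi>' s)"
proof -
  define w where "w s = s powr (- \<gamma>) * \<psi> s" for s
  define F where "F s = P (w s) * (s powr (1 / p) * \<psi>' s - \<gamma> * w s) / s" for s
  have cont\<psi>: "continuous_on {a..b} \<psi>"
    by (rule DERIV_continuous_on[where D = \<psi>'], rule has_field_derivative_at_within, rule D) auto
  have contw: "continuous_on {a..b} w"
    unfolding w_def[abs_def] using ab by (intro continuous_intros cont\<psi>) auto
  have contP: "continuous_on UNIV P" using cal by (simp add: calibration_def)
  have contF: "continuous_on {a..b} F"
    unfolding F_def[abs_def] using ab
    by (intro continuous_intros continuous_on_compose2[OF contP contw] cont contw) auto
  have "\<Phi> (b powr (- \<gamma>) * \<psi> b) - \<Phi> (a powr (- \<gamma>) * \<psi> a) = (LBINT s. indicator {a..b} s *\<^sub>R F s)"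
  proof (rule integral_FTC_atLeastAtMost[symmetric, OF ab(2) _ contF])
    fix s assume s: "a \<le> s" "s \<le> b"
    then have "s > 0" using ab by simp
    have "((\<lambda>s. \<Phi> (s powr (- \<gamma>) * \<psi> s)) has_real_derivative F s) (at s)"
      unfolding F_def w_def by (rule calibration_deriv(1)[where \<psi> = \<psi> and \<psi>' = \<psi>' and s = s, OF cal \<open>s > 0\<close> D[OF s] bd[OF s]])
    then show "((\<lambda>s. \<Phi> (s powr (- \<gamma>) * \<psi> s)) has_vector_derivative F s) (at s within {a..b})"
      by (metis has_real_derivative_iff_has_vector_derivative has_vector_derivative_at_within)
  qed
  also have "\<dots> \<le> (LBINT s. indicator {a..b} s *\<^sub>R lagrangian \<psi> \<psi>' s)"
  proof (rule integral_mono)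
    show "integrable lborel (\<lambda>s. indicator {a..b} s *\<^sub>R F s)"
      unfolding set_integrable_def[symmetric] by (intro borel_integrable_atLeastAtMost' contF)
    show "integrable lborel (\<lambda>s. indicator {a..b} s *\<^sub>R lagrangian \<psi> \<psi>' s)"
      unfolding set_integrable_def[symmetric]
      by (intro borel_integrable_atLeastAtMost' continuous_on_lagrangian cont\<psi> cont) (use ab in auto)
    show "indicator {a..b} s *\<^sub>R F s \<le> indicator {a..b} s *\<^sub>R lagrangian \<psi> \<psi>' s" for s
      using calibration_deriv(2)[where \<psi> = \<psi> and \<psi>' = \<psi>' and s = s, OF cal _ D bd] ab
      by (auto simp: F_def w_def indicator_def)
  qed
  finally show ?thesis by simp
qed

text \<open>Test profiles: C^1 functions with compact support in the open half line, carried along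
  with their derivative.\<close>

definition cc1 :: "(real \<Rightarrow> real) \<Rightarrow> (real \<Rightarrow> real) \<Rightarrow> bool" where
  "cc1 \<psi> \<psi>' \<longleftrightarrow> (\<forall>s. (\<psi> has_real_derivative \<psi>' s) (at s)) \<and> continuous_on UNIV \<psi>' \<and>
     (\<exists>a b. 0 < a \<and> a < b \<and> (\<forall>s. s \<notin> {a..b} \<longrightarrow> \<psi> s = 0 \<and> \<psi>' s = 0))"

text \<open>The integral of the Lagrangian along a curve that has equality with
  \<open>\<Phi>1\<close> while w rises from 0 to M and with \<open>\<Phi>2\<close> while w returns
  to 0.\<close>

definition action_gap :: real where "action_gap = (\<Phi>1 M - \<Phi>1 0) + (\<Phi>2 0 - \<Phi>2 M)"

text \<open>With \<open>\<Phi>1\<close> to the left of the maximum point m and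
  \<open>\<Phi>2\<close> to its right, the boundary values of w are 0, M and 0, whatever the profile
  does in between; w need not be monotone on either side.\<close>

lemma cc1_normalized_bound:
  assumes cc: "cc1 \<psi> \<psi>'" and bd: "\<And>s. s > 0 \<Longrightarrow> \<bar>s powr (- \<gamma>) * \<psi> s\<bar> \<le> M"
    and m: "m > 0" "m powr (- \<gamma>) * \<psi> m = M"
  shows "integrable lborel (lagrangian \<psi> \<psi>')" "action_gap \<le> (LINT s|lborel. lagrangian \<psi> \<psi>' s)"
proof -
  obtain a0 b0 where ab0: "0 < a0" "a0 < b0" "\<And>s. s \<notin> {a0..b0} \<Longrightarrow> \<psi> s = 0 \<and> \<psi>' s = 0"
    using cc by (auto simp: cc1_def)
  \<comment> \<open>The support interval is enlarged so that the profile vanishes at both end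
    points.\<close>
  define a where "a = a0 / 2"
  define b where "b = b0 + 1"
  have ab: "0 < a" "\<psi> a = 0" "\<psi> b = 0" "\<And>s. s \<notin> {a..b} \<Longrightarrow> \<psi> s = 0 \<and> \<psi>' s = 0"
    using ab0 by (auto simp: a_def b_def)
  have "\<psi> m \<noteq> 0" using m M_pos by auto
  then have mab: "a \<le> m" "m \<le> b" using ab(4)[of m] by auto
  have D: "(\<psi> has_real_derivative \<psi>' s) (at s)" for s using cc by (simp add: cc1_def)
  have cont': "continuous_on S \<psi>'" for S using cc continuous_on_subset by (auto simp: cc1_def)
  have cont: "continuous_on S \<psi>" for S
    by (rule DERIV_continuous_on[where D = \<psi>'], rule has_field_derivative_at_within, rule D)
  have Lab: "lagrangian \<psi> \<psi>' s = indicator {a..b} s * lagrangian \<psi> \<psi>' s" for s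
    using ab(4)[of s] by (cases "s \<in> {a..b}") (auto simp: lagrangian_def)
  have I: "integrable lborel (\<lambda>s. indicator {x..y} s * lagrangian \<psi> \<psi>' s)" if "x \<ge> a" for x y
  proof -
    have "{x..y} \<subseteq> {0<..}" using that ab(1) by auto
    from borel_integrable_atLeastAtMost'[OF continuous_on_lagrangian[OF cont cont' this]]
    show ?thesis by (simp add: set_integrable_def)
  qed
  show "integrable lborel (lagrangian \<psi> \<psi>')"
    using I[of a b] unfolding Lab[symmetric] by simp
  obtain P1 where P1: "calibration \<Phi>1 P1" by (rule calibration_\<Phi>1) (rule that)
  obtain P2 where P2: "calibration \<Phi>2 P2" by (rule calibration_\<Phi>2) (rule that)
  have "\<Phi>1 (m powr (- \<gamma>) * \<psi> m) - \<Phi>1 (a powr (- \<gamma>) * \<psi> a)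
      \<le> (LINT s|lborel. indicator {a..m} s * lagrangian \<psi> \<psi>' s)"
    by (rule calibration_bound[OF P1]) (use ab mab D cont' bd in auto)
  moreover have "\<Phi>2 (b powr (- \<gamma>) * \<psi> b) - \<Phi>2 (m powr (- \<gamma>) * \<psi> m)
      \<le> (LINT s|lborel. indicator {m..b} s * lagrangian \<psi> \<psi>' s)"
    by (rule calibration_bound[OF P2]) (use ab mab m(1) D cont' bd in auto)
  moreover have "(LINT s|lborel. lagrangian \<psi> \<psi>' s) =
      (LINT s|lborel. indicator {a..m} s * lagrangian \<psi> \<psi>' s + indicator {m..b} s * lagrangian \<psi> \<psi>' s)"
  proof (rule integral_cong_AE)
    show "lagrangian \<psi> \<psi>' \<in> borel_measurable lborel"
      using \<open>integrable lborel (lagrangian \<psi> \<psi>')\<close> by simp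
    show "(\<lambda>s. indicator {a..m} s * lagrangian \<psi> \<psi>' s + indicator {m..b} s * lagrangian \<psi> \<psi>' s) \<in> borel_measurable lborel"
      using I[of a m] I[of m b] mab by (intro borel_measurable_add) auto
    show "AE s in lborel. lagrangian \<psi> \<psi>' s = indicator {a..m} s * lagrangian \<psi> \<psi>' s + indicator {m..b} s * lagrangian \<psi> \<psi>' s"
      using AE_lborel_singleton[of m]
      proof eventually_elim
      case (elim s)
      show ?case
      proof (cases "s \<in> {a..b}")
        case True
        then show ?thesis using elim mab by (auto simp: indicator_def)
      next
        case False
        then have "lagrangian \<psi> \<psi>' s = 0" using Lab[of s] by simp
        then show ?thesis by simp
      qed
    qed
  qed
  ultimately show "action_gap \<le> (LINT s|lborel. lagrangian \<psi> \<psi>' s)"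
    using I[of a m] I[of m b] mab ab m by (simp add: action_gap_def)
qed

end

section \<open>The extremal profile\<close>

lemma integrable_powr_0_1:
  fixes a :: real assumes "a > -1"
  shows "set_integrable lborel {0<..<1} (\<lambda>s. s powr a)"
proof -
  have "((\<lambda>s. s powr (a + 1) / (a + 1)) \<longlongrightarrow> 0 powr (a + 1) / (a + 1)) (at_right 0)"
  proof (rule tendsto_divide)
    show "((\<lambda>s. s powr (a + 1)) \<longlongrightarrow> 0 powr (a + 1)) (at_right 0)"
      using assms isCont_abs_powr[of "a + 1" 0] by (simp add: isCont_def filterlim_at_split)
    show "a + 1 \<noteq> 0" using assms by simp
  qed auto
  moreover have "((\<lambda>s. s powr (a + 1) / (a + 1)) \<longlongrightarrow> 1 powr (a + 1) / (a + 1)) (at_left 1)"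
    using assms by (intro tendsto_intros) auto
  ultimately have "set_integrable lborel (einterval (ereal 0) (ereal 1)) (\<lambda>s. s powr a)"
    using assms
    by (intro interval_integral_FTC_nonneg[where F = "\<lambda>s. s powr (a + 1) / (a + 1)"])
      (auto intro!: derivative_eq_intros continuous_intros simp: ereal_tendsto_simps)
  then show ?thesis by simp
qed

lemma integrable_powr_1_inf:
  fixes b :: real assumes "b < -1"
  shows "set_integrable lborel {1<..} (\<lambda>s. s powr b)"
proof -
  have "((\<lambda>s. s powr (b + 1) / (b + 1)) \<longlongrightarrow> 0 / (b + 1)) at_top"
    using assms by (intro tendsto_divide tendsto_neg_powr tendsto_const filterlim_ident) auto
  moreover have "((\<lambda>s. s powr (b + 1) / (b + 1)) \<longlongrightarrow> 1 powr (b + 1) / (b + 1)) (at_right 1)"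
    using assms by (intro tendsto_intros) auto
  ultimately have "set_integrable lborel (einterval (ereal 1) \<infinity>) (\<lambda>s. s powr b)"
    using assms
    by (intro interval_integral_FTC_nonneg[where F = "\<lambda>s. s powr (b + 1) / (b + 1)"])
      (auto intro!: derivative_eq_intros continuous_intros simp: ereal_tendsto_simps)
  then show ?thesis by simp
qed

context bliss begin

definition G :: "real \<Rightarrow> real" where "G s = (if s > 0 then (1 + s powr k) powr (- 1 / k - 1) else 0)"
text \<open>A family closed under products which contains the powers of \<open>V\<close> and of its
  derivative \<open>G\<close>, also with power weights. It behaves like s^a at 0 and like s^(a - k
  c) at infinity, which settles every integral and every boundary term below.\<close>

definition J :: "real \<Rightarrow> real \<Rightarrow> real \<Rightarrow> real" where
  "J a c s = (if s > 0 then s powr a * (1 + s powr k) powr (- c) else 0)"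

lemma V_nonneg: "V s \<ge> 0" by (simp add: V_def)
lemma G_nonneg: "G s \<ge> 0" by (simp add: G_def)
lemma V_pos: "s > 0 \<Longrightarrow> V s > 0"
  using powr_ge_zero[of s k] by (auto simp: V_def simp del: powr_ge_zero intro!: mult_pos_pos)
lemma borel_measurable_V [measurable]: "V \<in> borel_measurable borel"
  unfolding V_def[abs_def] by measurable
lemma borel_measurable_G [measurable]: "G \<in> borel_measurable borel"
  unfolding G_def[abs_def] by measurable
lemma borel_measurable_J [measurable]: "J a c \<in> borel_measurable borel"
  unfolding J_def[abs_def] by measurable

lemma one_plus_powr_pos: "1 + s powr c > (0::real)"
  using powr_ge_zero[of s c] by linarith

lemma DERIV_one_plus_powr:
  assumes "s > 0"
  shows "((\<lambda>s. (1 + s powr k) powr e) has_real_derivative e * k * s powr (k - 1) * (1 + s powr k) powr (e - 1)) (at s)"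
proof -
  have "((\<lambda>s. 1 + s powr k) has_real_derivative 0 + k * s powr (k - 1)) (at s)"
    by (intro DERIV_add DERIV_const has_real_derivative_powr assms)
  from DERIV_chain2[OF has_real_derivative_powr[OF one_plus_powr_pos[of s k], of e] this]
  show ?thesis by (simp add: mult_ac)
qed

lemma DERIV_V:
  assumes s: "s > 0" shows "(V has_real_derivative G s) (at s)"
proof -
  define b where "b = 1 + s powr k"
  have "((\<lambda>s. s * (1 + s powr k) powr (- 1 / k)) has_real_derivative
     1 * b powr (- 1 / k) + (- 1 / k) * k * s powr (k - 1) * b powr (- 1 / k - 1) * s) (at s)"
    unfolding b_def by (intro DERIV_mult DERIV_ident DERIV_one_plus_powr s)
  moreover have "1 * b powr (- 1 / k) + (- 1 / k) * k * s powr (k - 1) * b powr (- 1 / k - 1) * s = G s"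
  proof -
    have "b powr (- 1 / k) = b powr (- 1 / k - 1) * b"
      using powr_add[of b "- 1 / k - 1" 1] one_plus_powr_pos[of s k] by (simp add: b_def)
    moreover have "s powr (k - 1) * s = s powr k" using powr_add[of s "k - 1" 1] s by simp
    ultimately have "1 * b powr (- 1 / k) + (- 1 / k) * k * s powr (k - 1) * b powr (- 1 / k - 1) * s
      = b powr (- 1 / k - 1) * (b - s powr k)" using k_pos by (simp add: algebra_simps)
    then show ?thesis using s by (simp add: b_def G_def)
  qed
  ultimately have "((\<lambda>s. s * (1 + s powr k) powr (- 1 / k)) has_real_derivative G s) (at s)" by simp
  then show ?thesis
    by (rule has_field_derivative_transform_within_open[of _ _ _ "{0<..}"]) (use s in \<open>auto simp: V_def\<close>)
qed

lemma G_powr: "G s powr c = J 0 ((1 / k + 1) * c) s"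
proof -
  have "(- 1 / k - 1) * c = - ((1 / k + 1) * c)" by (simp add: algebra_simps)
  then show ?thesis by (simp add: G_def J_def powr_powr)
qed

lemma V_powr: "s powr a * V s powr c = J (a + c) (c / k) s"
  by (simp add: V_def J_def powr_powr powr_mult powr_add)

lemma J_mult: "J a c s * J b d s = J (a + b) (c + d) s"
  by (simp add: J_def powr_add powr_diff powr_minus field_simps)

lemma isCont_J: "s > 0 \<Longrightarrow> isCont (J a c) s"
proof -
  assume s: "s > 0"
  have "isCont (\<lambda>s. s powr a * (1 + s powr k) powr (- c)) s"
    using s one_plus_powr_pos[of s k] by (intro continuous_intros) auto
  moreover have ev: "eventually (\<lambda>s. J a c s = s powr a * (1 + s powr k) powr (- c)) (nhds s)"
    using s eventually_nhds_in_open[of "{0<..}" s] by (auto simp: J_def elim: eventually_mono)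
  ultimately show "isCont (J a c) s" by (simp only: isCont_cong[OF ev])
qed

lemma integrable_J:
  assumes "a > -1" "a - k * c < -1" "c \<ge> 0"
  shows "integrable lborel (J a c)"
proof (rule Bochner_Integration.integrable_bound)
  show "integrable lborel (\<lambda>s. indicator {0<..<1} s *\<^sub>R s powr a + indicator {1<..} s *\<^sub>R s powr (a - k * c))"
    using integrable_powr_0_1[OF assms(1)] integrable_powr_1_inf[OF assms(2)]
    unfolding set_integrable_def by (rule Bochner_Integration.integrable_add)
  show "AE s in lborel. norm (J a c s) \<le> norm (indicator {0<..<1} s *\<^sub>R s powr a + indicator {1<..} s *\<^sub>R s powr (a - k * c))"
    using AE_lborel_singleton[of 1]
  proof eventually_elim
    fix s :: real assume "s \<noteq> 1"
    then consider "s \<le> 0" | "0 < s" "s < 1" | "s > 1" by linarith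
    then show "norm (J a c s) \<le> norm (indicator {0<..<1} s *\<^sub>R s powr a + indicator {1<..} s *\<^sub>R s powr (a - k * c))"
    proof cases
      case 2
      have "(1 + s powr k) powr (- c) \<le> 1 powr (- c)" using assms by (intro powr_mono2') auto
      then have "s powr a * (1 + s powr k) powr (- c) \<le> s powr a * 1" by (intro mult_left_mono) auto
      then show ?thesis using 2 by (auto simp: J_def)
    next
      case 3
      have "(1 + s powr k) powr (- c) \<le> (s powr k) powr (- c)" using assms 3 by (intro powr_mono2') auto
      then have "s powr a * (1 + s powr k) powr (- c) \<le> s powr a * s powr (- (k * c))"
        by (intro mult_left_mono) (auto simp: powr_powr)
      then show ?thesis using 3 by (auto simp: J_def simp flip: powr_add)
    qed (auto simp: J_def)
  qed
qed measurable

lemma J_limit_0: "a > 0 \<Longrightarrow> c \<ge> 0 \<Longrightarrow> (J a c \<longlongrightarrow> 0) (at_right 0)"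
proof -
  assume a: "a > 0" "c \<ge> 0"
  show ?thesis
  proof (rule tendsto_sandwich[of "\<lambda>_. 0" _ _ "\<lambda>s. s powr a"])
    show "eventually (\<lambda>s. 0 \<le> J a c s) (at_right 0)" by (auto simp: J_def intro: always_eventually)
    show "eventually (\<lambda>s. J a c s \<le> s powr a) (at_right 0)"
      using eventually_at_right_less[of 0]
    proof eventually_elim
      case (elim s)
      have "(1 + s powr k) powr (- c) \<le> 1 powr (- c)" using a by (intro powr_mono2') auto
      then have "s powr a * (1 + s powr k) powr (- c) \<le> s powr a * 1" by (intro mult_left_mono) auto
      then show ?case using elim by (auto simp: J_def)
    qed
    show "((\<lambda>s. s powr a) \<longlongrightarrow> 0) (at_right 0)"
      using isCont_abs_powr[OF a(1), of 0] by (auto simp: isCont_def filterlim_at_split)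
  qed auto
qed

lemma J_limit_inf: "a < k * c \<Longrightarrow> c \<ge> 0 \<Longrightarrow> (J a c \<longlongrightarrow> 0) at_top"
proof -
  assume a: "a < k * c" "c \<ge> 0"
  show ?thesis
  proof (rule tendsto_sandwich[of "\<lambda>_. 0" _ _ "\<lambda>s. s powr (a - k * c)"])
    show "eventually (\<lambda>s. 0 \<le> J a c s) at_top" by (auto simp: J_def intro: always_eventually)
    show "eventually (\<lambda>s. J a c s \<le> s powr (a - k * c)) at_top"
      using eventually_gt_at_top[of 0]
    proof eventually_elim
      case (elim s)
      have "(1 + s powr k) powr (- c) \<le> (s powr k) powr (- c)" using a elim by (intro powr_mono2') auto
      then have "s powr a * (1 + s powr k) powr (- c) \<le> s powr a * s powr (- (k * c))"
        by (intro mult_left_mono) (auto simp: powr_powr)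
      then show ?case using elim by (auto simp: J_def simp flip: powr_add)
    qed
    show "((\<lambda>s. s powr (a - k * c)) \<longlongrightarrow> 0) at_top"
      using a by (intro tendsto_neg_powr filterlim_ident) auto
  qed auto
qed

lemma integrable_G_powr: "integrable lborel (\<lambda>s. G s powr p)"
proof -
  have "k * ((1 / k + 1) * p) = q" using k_pos p by (simp add: k_def field_simps)
  then show ?thesis unfolding G_powr using p q k_pos by (intro integrable_J) auto
qed

lemma integrable_V_powr: "integrable lborel (\<lambda>s. wt s * V s powr q)"
proof -
  have 1: "- 1 - q * \<gamma> + q = k" using q_minus_q_\<gamma> by simp
  have "0 < q * \<gamma>" using \<gamma>_pos p q by simp
  then have "k - k * (q / k) < -1" using k_pos q_minus_q_\<gamma> by (simp add: field_simps)
  then show ?thesis unfolding V_powr 1 using p q k_pos by (intro integrable_J) auto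
qed

lemma integrable_V_hardy: "integrable lborel (\<lambda>s. s powr (- p) * V s powr p)"
  unfolding V_powr using p k_pos by (intro integrable_J) (auto simp: field_simps)

lemma integrable_V_test: "integrable lborel (\<lambda>s. s powr (\<gamma> - 1 - q * \<gamma>) * V s powr (q - 1))"
proof -
  have "\<gamma> - 1 - q * \<gamma> + (q - 1) = (q - 1) / p - 1" using p by (simp add: \<gamma>_def field_simps)
  moreover have "(q - 1) / p - 1 - k * ((q - 1) / k) < -1"
  proof -
    have "(q - 1) / p - 1 - k * ((q - 1) / k) = - 1 - (q - 1) * \<gamma>"
    proof -
      have "k * ((q - 1) / k) = q - 1" using k_pos by simp
      then show ?thesis by (simp add: \<gamma>_def algebra_simps diff_divide_distrib)
    qed
    then show ?thesis using p q \<gamma>_pos by simp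
  qed
  ultimately show ?thesis unfolding V_powr using p q k_pos by (intro integrable_J) auto
qed

lemma q_\<gamma>_k: "(1 / k + 1) * (p - 1) = q * \<gamma> / k" "q * \<gamma> / k + 1 = (q - 1) / k"
  using k_pos p q_minus_q_\<gamma> by (simp_all add: \<gamma>_def k_def field_simps)

text \<open>This is the Euler-Lagrange equation of \<open>V\<close>: the power of \<open>G\<close>
  equals (1 + s^k)^(-q \<gamma> / k), and its derivative brings out the factor q \<gamma>.\<close>

lemma DERIV_G_powr:
  assumes s: "s > 0"
  shows "((\<lambda>s. G s powr (p - 1)) has_real_derivative - (q * \<gamma> * (wt s * V s powr (q - 1)))) (at s)"
proof -
  have "((\<lambda>s. (1 + s powr k) powr (- (q * \<gamma> / k))) has_real_derivative
      (- (q * \<gamma> / k)) * k * s powr (k - 1) * (1 + s powr k) powr (- (q * \<gamma> / k) - 1)) (at s)"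
    by (rule DERIV_one_plus_powr[OF s])
  moreover have "- (q * \<gamma> / k) - 1 = - ((q - 1) / k)" using q_\<gamma>_k(2) by simp
  moreover have "- 1 - q * \<gamma> + (q - 1) = k - 1" using q_minus_q_\<gamma> by simp
  ultimately have "((\<lambda>s. (1 + s powr k) powr (- (q * \<gamma> / k))) has_real_derivative
     - (q * \<gamma> * (wt s * V s powr (q - 1)))) (at s)"
    unfolding V_powr using s k_pos by (simp add: J_def mult_ac)
  then show ?thesis
    by (rule has_field_derivative_transform_within_open[of _ _ _ "{0<..}"])
       (use s in \<open>auto simp: G_powr J_def q_\<gamma>_k(1)\<close>)
qed

definition A0 :: real where "A0 = (LINT s|lborel. G s powr p)"
definition B0 :: real where "B0 = (LINT s|lborel. wt s * V s powr q)"

text \<open>The Euler-Lagrange equation is tested with \<open>V\<close> itself: the integrand is the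
  derivative of G^(p-1) V, which vanishes at both ends. The relation later matches the slope of the
  tangent line with the multiplier p - 1.\<close>

lemma A0_eq: "A0 = q * \<gamma> * B0"
proof -
  let ?F = "\<lambda>s. G s powr (p - 1) * V s"
  let ?f = "\<lambda>s. G s powr p - q * \<gamma> * (wt s * V s powr q)"
  have FJ: "?F s = J 1 (q * \<gamma> / k + 1 / k) s" for s
  proof -
    have "G s powr (p - 1) = J 0 (q * \<gamma> / k) s" unfolding G_powr q_\<gamma>_k(1) ..
    moreover have "V s = J 1 (1 / k) s" by (simp add: V_def J_def)
    ultimately show ?thesis by (simp add: J_mult)
  qed
  have D: "(?F has_real_derivative ?f s) (at s)" if s: "s > 0" for s
  proof -
    have "G s powr p = G s powr (p - 1) * G s" "V s powr q = V s powr (q - 1) * V s"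
      using powr_mult_self_eq_spow[of "G s" p] powr_mult_self_eq_spow[of "V s" q] V_nonneg[of s] G_nonneg[of s]
      by (auto simp: spow_nonneg)
    then show ?thesis
      by (intro DERIV_cong[OF DERIV_mult[OF DERIV_G_powr[OF s] DERIV_V[OF s]]]) (simp add: algebra_simps)
  qed
  have int: "integrable lborel ?f" using integrable_G_powr integrable_V_powr by auto
  have "(LBINT s=ereal 0..\<infinity>. ?f s) = 0 - 0"
  proof (rule interval_integral_FTC_integrable)
    show "(?F has_vector_derivative ?f s) (at s)" if "ereal 0 < ereal s" for s
      using D[of s] that by (simp add: has_real_derivative_iff_has_vector_derivative)
    show "isCont ?f s" if "ereal 0 < ereal s" for s
      unfolding G_powr V_powr using that by (intro continuous_intros isCont_J) auto
    show "set_integrable lborel (einterval (ereal 0) \<infinity>) ?f"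
      unfolding set_integrable_def by (rule integrable_mult_indicator[OF _ int]) auto
    have k: "q * \<gamma> / k + 1 / k \<ge> 0" "1 < k * (q * \<gamma> / k + 1 / k)"
      using k_pos \<gamma>_pos p q by (auto simp: field_simps)
    show "((?F \<circ> real_of_ereal) \<longlongrightarrow> 0) (at_right (ereal 0))"
      unfolding ereal_tendsto_simps FJ by (rule J_limit_0) (use k in auto)
    show "((?F \<circ> real_of_ereal) \<longlongrightarrow> 0) (at_left \<infinity>)"
      unfolding ereal_tendsto_simps FJ by (rule J_limit_inf) (use k in auto)
  qed auto
  moreover have "(LBINT s=ereal 0..\<infinity>. ?f s) = (LBINT s. ?f s)"
    unfolding interval_lebesgue_integral_def set_lebesgue_integral_def
    by (auto intro!: Bochner_Integration.integral_cong simp: indicator_def G_def V_def)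
  ultimately have "(LBINT s. ?f s) = 0" by simp
  then show ?thesis
    unfolding A0_def B0_def using integrable_G_powr integrable_V_powr by simp
qed

lemma B0_pos: "B0 > 0"
proof -
  have "B0 \<noteq> 0"
  proof
    assume "B0 = 0"
    then have "AE s in lborel. wt s * V s powr q = 0"
      unfolding B0_def by (subst (asm) integral_nonneg_eq_0_iff_AE[OF integrable_V_powr]) auto
    then have "AE s in lborel. s \<notin> {0<..<1::real}"
      by eventually_elim (auto simp: less_imp_neq dest: V_pos)
    then have "{s \<in> space lborel. \<not> s \<notin> {0<..<1::real}} \<in> null_sets lborel"
      by (subst AE_iff_null[symmetric]) auto
    moreover have "{s \<in> space lborel. \<not> s \<notin> {0<..<1::real}} = {0<..<1}" by auto
    ultimately have "{0<..<1::real} \<in> null_sets lborel" by simp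
    then show False by (auto simp: null_sets_def)
  qed
  moreover have "B0 \<ge> 0" unfolding B0_def by auto
  ultimately show ?thesis by simp
qed

end

section \<open>Bliss' inequality for test functions\<close>

text \<open>Young's inequality with weights a and 1 - a, applied to x and 1.\<close>

lemma powr_le_tangent_1:
  assumes "0 < (a::real)" "a < 1" "x \<ge> 0" shows "x powr a \<le> 1 + a * (x - 1)"
proof (cases "x = 0")
  case False
  then show ?thesis using Youngs_inequality_0[of a "1 - a" x 1] assms by (simp add: algebra_simps)
qed (use assms in simp)

context bliss begin

text \<open>Along \<open>V\<close> the tangency parameter runs monotonically from 0 to 1. It stays
  in the range of the first calibration until w = M and in that of the second afterwards, so both
  inequalities become equalities and the fundamental theorem gives the exact value.\<close>

lemma extremal_action: "A0 - (p - 1) * B0 = action_gap"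
proof -
  define w where "w s = s powr (- \<gamma>) * V s" for s
  \<comment> \<open>The tangency parameter of the extremal: 1 - y is its logarithmic derivative s G
    / V.\<close>
  define y where "y s = s powr k / (1 + s powr k)" for s
  \<comment> \<open>The point where y = 1 / p, that is where w reaches M.\<close>
  define s0 where "s0 = (1 / (p - 1)) powr (1 / k)"
  have s0: "s0 > 0" "s0 powr k = 1 / (p - 1)" using p k_pos by (auto simp: s0_def powr_powr)
  have wJ: "w s = J (1 / p) (1 / k) s" for s
    using V_powr[of s "- \<gamma>" 1] V_nonneg[of s] by (simp add: w_def \<gamma>_def)
  have y01: "0 \<le> y s" "y s \<le> 1" for s using one_plus_powr_pos[of s k] by (auto simp: y_def)
  have y1: "1 - y s = 1 / (1 + s powr k)" for s
    using one_plus_powr_pos[of s k] by (simp add: y_def field_simps)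
  have hy: "h (y s) = w s powr (q - p)" if s: "s > 0" for s
  proof -
    define b where "b = 1 + s powr k"
    have b: "b > 0" unfolding b_def by (rule one_plus_powr_pos)
    have "h (y s) = s powr k / b * (1 / b) powr (p - 1)" by (simp add: h_def y1 b_def) (simp add: y_def)
    also have "\<dots> = s powr k * b powr (- p)"
    proof -
      have "b powr (- p) = b powr (- (p - 1)) * b powr (- 1)" unfolding powr_add[symmetric] by simp
      also have "b powr (- 1) = 1 / b" using b by simp
      also have "b powr (- (p - 1)) = (1 / b) powr (p - 1)"
        using b by (simp only: powr_minus_divide powr_divide powr_one_eq_one)
      finally show ?thesis by simp
    qed
    also have "\<dots> = (s powr (1 / p) * b powr (- 1 / k)) powr (q - p)"
    proof -
      have "1 / p * (q - p) = k" "- 1 / k * (q - p) = - p" using p q by (auto simp: k_def)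
      then show ?thesis unfolding powr_mult powr_powr by simp
    qed
    finally show ?thesis using s by (simp add: wJ J_def b_def)
  qed
  have w_pos: "w s > 0" if "s > 0" for s using V_pos[OF that] that by (simp add: w_def)
  have w_le: "w s \<le> M" if s: "s > 0" for s
  proof (rule ccontr)
    assume "\<not> w s \<le> M"
    then have "M powr (q - p) < w s powr (q - p)" using M_pos q by (intro powr_less_mono2) auto
    then show False using h_le_max[OF y01[of s]] unfolding M_powr hy[OF s] by simp
  qed
  have \<theta>: "s powr (1 / p) * G s = w s * (1 - y s)" if s: "s > 0" for s
  proof -
    have "(1 + s powr k) powr (- 1 / k - 1) = (1 + s powr k) powr (- 1 / k) * (1 + s powr k) powr (- 1)"
      unfolding powr_add[symmetric] by simp
    also have "(1 + s powr k) powr (- 1) = 1 / (1 + s powr k)" using one_plus_powr_pos[of s k] by simp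
    finally show ?thesis using s unfolding y1 by (simp add: G_def wJ J_def)
  qed
  have y_left: "y s \<in> {0..1 / p}" if s: "0 < s" "s \<le> s0" for s
  proof -
    have "s powr k \<le> 1 / (p - 1)" unfolding s0(2)[symmetric] using s k_pos by (intro powr_mono2) auto
    then have "p * s powr k \<le> 1 + s powr k" using p by (simp add: field_simps)
    then show ?thesis using p one_plus_powr_pos[of s k] y01[of s] by (simp add: y_def field_simps)
  qed
  have y_right: "y s \<in> {1 / p..1}" if s: "s0 \<le> s" for s
  proof -
    have "1 / (p - 1) \<le> s powr k" unfolding s0(2)[symmetric] using s s0 k_pos by (intro powr_mono2) auto
    then have "1 + s powr k \<le> p * s powr k" using p by (simp add: field_simps)
    then show ?thesis using p one_plus_powr_pos[of s k] y01[of s] by (simp add: y_def field_simps)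
  qed
  have wM: "w s0 = M"
  proof -
    have "y s0 = 1 / p" using y_left[of s0] y_right[of s0] s0 by auto
    then have "w s0 powr (q - p) = M powr (q - p)" using hy[OF s0(1)] unfolding M_powr by simp
    then have "(w s0 powr (q - p)) powr (1 / (q - p)) = (M powr (q - p)) powr (1 / (q - p))" by simp
    then show ?thesis using M_pos w_pos[OF s0(1)] q by (simp add: powr_powr)
  qed
  define L where "L = lagrangian V G"
  have intL: "integrable lborel L"
    unfolding L_def lagrangian_def[abs_def] using integrable_G_powr integrable_V_powr by auto
  have LintL: "(LINT s|lborel. L s) = A0 - (p - 1) * B0"
    unfolding L_def lagrangian_def[abs_def] A0_def B0_def using integrable_G_powr integrable_V_powr by simp
  have setL: "set_integrable lborel (einterval x z) L" for x z
    unfolding set_integrable_def by (rule integrable_mult_indicator[OF _ intL]) auto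
  have contL: "isCont L s" if "s > 0" for s
    unfolding L_def lagrangian_def[abs_def] G_powr V_powr using that by (intro continuous_intros isCont_J) auto
  have D: "((\<lambda>s. \<Phi> (w s)) has_vector_derivative L s) (at s)"
    if s: "s > 0" and cal: "calibration \<Phi> P"
      and P: "P (w s) * (w s * (1 - y s) - \<gamma> * w s) = (w s * (1 - y s)) powr p - (p - 1) * w s powr q" for \<Phi> P s
  proof -
    have "((\<lambda>s. \<Phi> (s powr (- \<gamma>) * V s)) has_real_derivative
      P (s powr (- \<gamma>) * V s) * (s powr (1 / p) * G s - \<gamma> * (s powr (- \<gamma>) * V s)) / s) (at s)"
      by (rule calibration_deriv(1)[where \<psi> = V and \<psi>' = G and s = s, OF cal s DERIV_V[OF s]])
         (use w_le[OF s] w_pos[OF s] in \<open>simp add: w_def\<close>)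
    then show ?thesis
      unfolding w_def[symmetric] \<theta>[OF s] P L_def has_real_derivative_iff_has_vector_derivative[symmetric]
        lagrangian_scaled[OF s] .
  qed
  have cont\<Phi>: "isCont \<Phi> x" if "calibration \<Phi> P" "\<bar>x\<bar> \<le> M" for \<Phi> P x
    using that by (auto simp: calibration_def intro: DERIV_isCont)
  have kp: "1 / p < k * (1 / k)" "1 / k \<ge> 0" using p k_pos by auto
  have lim0: "(w \<longlongrightarrow> 0) (at_right 0)" and liminf: "(w \<longlongrightarrow> 0) at_top"
    unfolding wJ[abs_def] using p kp by (auto intro!: J_limit_0 J_limit_inf)
  have "isCont w s0" unfolding wJ[abs_def] by (rule isCont_J[OF s0(1)])
  then have limM: "(w \<longlongrightarrow> M) (at_left s0)" "(w \<longlongrightarrow> M) (at_right s0)"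
    by (auto simp: isCont_def wM filterlim_at_split)
  obtain P1 where P1: "calibration \<Phi>1 P1" "\<And>w y. 0 \<le> w \<Longrightarrow> w \<le> M \<Longrightarrow> y \<in> {0..1 / p} \<Longrightarrow> h y = w powr (q - p) \<Longrightarrow>
      P1 w * (w * (1 - y) - \<gamma> * w) = (w * (1 - y)) powr p - (p - 1) * w powr q"
    by (rule calibration_\<Phi>1) (rule that)
  obtain P2 where P2: "calibration \<Phi>2 P2" "\<And>w y. 0 \<le> w \<Longrightarrow> w \<le> M \<Longrightarrow> y \<in> {1 / p..1} \<Longrightarrow> h y = w powr (q - p) \<Longrightarrow>
      P2 w * (w * (1 - y) - \<gamma> * w) = (w * (1 - y)) powr p - (p - 1) * w powr q"
    by (rule calibration_\<Phi>2) (rule that)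
  have lim\<Phi>: "((\<lambda>s. \<Phi> (w s)) \<longlongrightarrow> \<Phi> x) F" if "calibration \<Phi> P" "\<bar>x\<bar> \<le> M" "(w \<longlongrightarrow> x) F" for \<Phi> P x F
    using isCont_tendsto_compose[OF cont\<Phi>[OF that(1,2)] that(3)] .
  have "(LBINT s=ereal 0..ereal s0. L s) = \<Phi>1 M - \<Phi>1 0"
  proof (rule interval_integral_FTC_integrable[where F = "\<lambda>s. \<Phi>1 (w s)", OF _ _ _ setL])
    fix s assume "ereal 0 < ereal s" "ereal s < ereal s0"
    then have s: "0 < s" "s \<le> s0" by auto
    show "((\<lambda>s. \<Phi>1 (w s)) has_vector_derivative L s) (at s)"
      by (rule D[OF s(1) P1(1) P1(2)[OF less_imp_le[OF w_pos] w_le y_left hy]]) (use s in auto)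
    show "isCont L s" by (rule contL[OF s(1)])
  next
    show "(((\<lambda>s. \<Phi>1 (w s)) \<circ> real_of_ereal) \<longlongrightarrow> \<Phi>1 0) (at_right (ereal 0))"
      unfolding ereal_tendsto_simps by (rule lim\<Phi>[OF P1(1) _ lim0]) (use M_pos in auto)
    show "(((\<lambda>s. \<Phi>1 (w s)) \<circ> real_of_ereal) \<longlongrightarrow> \<Phi>1 M) (at_left (ereal s0))"
      unfolding ereal_tendsto_simps by (rule lim\<Phi>[OF P1(1) _ limM(1)]) (use M_pos in auto)
  qed (use s0 in auto)
  moreover have "(LBINT s=ereal s0..\<infinity>. L s) = \<Phi>2 0 - \<Phi>2 M"
  proof (rule interval_integral_FTC_integrable[where F = "\<lambda>s. \<Phi>2 (w s)", OF _ _ _ setL])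
    fix s assume "ereal s0 < ereal s"
    then have s: "0 < s" "s0 \<le> s" using s0(1) by auto
    show "((\<lambda>s. \<Phi>2 (w s)) has_vector_derivative L s) (at s)"
      by (rule D[OF s(1) P2(1) P2(2)[OF less_imp_le[OF w_pos] w_le y_right hy]]) (use s in auto)
    show "isCont L s" by (rule contL[OF s(1)])
  next
    show "(((\<lambda>s. \<Phi>2 (w s)) \<circ> real_of_ereal) \<longlongrightarrow> \<Phi>2 M) (at_right (ereal s0))"
      unfolding ereal_tendsto_simps by (rule lim\<Phi>[OF P2(1) _ limM(2)]) (use M_pos in auto)
    show "(((\<lambda>s. \<Phi>2 (w s)) \<circ> real_of_ereal) \<longlongrightarrow> \<Phi>2 0) (at_left \<infinity>)"
      unfolding ereal_tendsto_simps by (rule lim\<Phi>[OF P2(1) _ liminf]) (use M_pos in auto)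
  qed auto
  moreover have "(LINT s|lborel. L s) = (LBINT s=ereal 0..ereal s0. L s) + (LBINT s=ereal s0..\<infinity>. L s)"
  proof -
    have "(LINT s|lborel. L s) = (LINT s|lborel. indicator {0<..<s0} s *\<^sub>R L s + indicator {s0<..} s *\<^sub>R L s)"
    proof (rule integral_cong_AE)
      show "AE s in lborel. L s = indicator {0<..<s0} s *\<^sub>R L s + indicator {s0<..} s *\<^sub>R L s"
        using AE_lborel_singleton[of s0]
      proof eventually_elim
        case (elim s)
        then consider "s \<le> 0" | "0 < s" "s < s0" | "s0 < s" by linarith
        then show ?case using s0
          by cases (auto simp: L_def lagrangian_def G_def V_def)
      qed
    qed (use intL in \<open>auto intro!: borel_measurable_add borel_measurable_scaleR\<close>)
    also have "\<dots> = (LINT s|lborel. indicator {0<..<s0} s *\<^sub>R L s) + (LINT s|lborel. indicator {s0<..} s *\<^sub>R L s)"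
      using setL[of "ereal 0" "ereal s0"] setL[of "ereal s0" \<infinity>]
      by (intro Bochner_Integration.integral_add) (auto simp: set_integrable_def)
    finally show ?thesis
      using s0 by (simp add: interval_lebesgue_integral_def set_lebesgue_integral_def)
  qed
  ultimately show ?thesis by (simp add: LintL action_gap_def)
qed

lemma cc1_integrable:
  fixes f :: "real \<Rightarrow> real"
  assumes "cc1 \<psi> \<psi>'" and f: "\<And>S. S \<subseteq> {0<..} \<Longrightarrow> continuous_on S f" and z: "\<And>s. \<psi> s = 0 \<Longrightarrow> \<psi>' s = 0 \<Longrightarrow> f s = 0"
  shows "integrable lborel f"
proof -
  obtain a b where ab: "0 < a" "a < b" "\<And>s. s \<notin> {a..b} \<Longrightarrow> \<psi> s = 0 \<and> \<psi>' s = 0"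
    using assms(1) by (auto simp: cc1_def)
  have "set_integrable lborel {a..b} f"
    by (rule borel_integrable_atLeastAtMost', rule f) (use ab in auto)
  moreover have "indicator {a..b} s *\<^sub>R f s = f s" for s
    using ab(3)[of s] z[of s] by (cases "s \<in> {a..b}") auto
  ultimately show ?thesis by (simp only: set_integrable_def)
qed

lemma cc1_cont:
  assumes "cc1 \<psi> \<psi>'" shows "continuous_on S \<psi>" "continuous_on S \<psi>'"
proof -
  show "continuous_on S \<psi>'" using assms continuous_on_subset by (auto simp: cc1_def)
  have "(\<psi> has_real_derivative \<psi>' s) (at s)" for s using assms by (simp add: cc1_def)
  then show "continuous_on S \<psi>"
    by (meson DERIV_isCont continuous_at_imp_continuous_on)
qed

lemma cc1_integrable_energy:
  assumes "cc1 \<psi> \<psi>'" shows "integrable lborel (\<lambda>s. \<psi>' s powr p)"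
proof (rule cc1_integrable[OF assms])
  show "continuous_on S (\<lambda>s. \<psi>' s powr p)" for S
    by (rule continuous_on_compose2[OF continuous_on_abs_powr[of p UNIV] cc1_cont(2)[OF assms]])
       (use p in auto)
qed simp

lemma cc1_integrable_potential:
  assumes "cc1 \<psi> \<psi>'" shows "integrable lborel (\<lambda>s. wt s * \<psi> s powr q)"
proof (rule cc1_integrable[OF assms])
  show "continuous_on S (\<lambda>s. wt s * \<psi> s powr q)" if "S \<subseteq> {0<..}" for S
    by (intro continuous_on_mult continuous_on_powr continuous_on_id continuous_on_const
          continuous_on_compose2[OF continuous_on_abs_powr[of q UNIV] cc1_cont(1)[OF assms]])
       (use p q that in auto)
qed simp

lemma cc1_cmult:
  assumes "cc1 \<psi> \<psi>'" shows "cc1 (\<lambda>s. c * \<psi> s) (\<lambda>s. c * \<psi>' s)"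
proof -
  obtain a b where ab: "0 < a" "a < b" "\<And>s. s \<notin> {a..b} \<Longrightarrow> \<psi> s = 0 \<and> \<psi>' s = 0"
    using assms by (auto simp: cc1_def)
  then have "\<exists>a b. 0 < a \<and> a < b \<and> (\<forall>s. s \<notin> {a..b} \<longrightarrow> c * \<psi> s = 0 \<and> c * \<psi>' s = 0)"
    by (metis mult_zero_right)
  then show ?thesis
    using assms unfolding cc1_def by (auto intro!: DERIV_cmult continuous_on_mult_left)
qed

lemma bliss_cc1:
  assumes cc: "cc1 \<psi> \<psi>'"
  shows "A0 * ((LINT s|lborel. wt s * \<psi> s powr q) / B0) powr (p / q) \<le> (LINT s|lborel. \<psi>' s powr p)"
proof (cases "\<forall>s>0. \<psi> s = 0")
  case True
  obtain a b where ab: "0 < a" "a < b" "\<And>s. s \<notin> {a..b} \<Longrightarrow> \<psi> s = 0 \<and> \<psi>' s = 0"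
    using cc by (auto simp: cc1_def)
  have "\<psi> s = 0" for s using True ab(1) ab(3)[of s] by (cases "s > 0") auto
  then show ?thesis by simp
next
  case False
  then obtain s1 where s1: "s1 > 0" "\<psi> s1 \<noteq> 0" by auto
  obtain a b where ab: "0 < a" "a < b" "\<And>s. s \<notin> {a..b} \<Longrightarrow> \<psi> s = 0 \<and> \<psi>' s = 0"
    using cc by (auto simp: cc1_def)
  define w where "w s = s powr (- \<gamma>) * \<psi> s" for s
  have "continuous_on {a..b} (\<lambda>s. \<bar>w s\<bar>)"
    unfolding w_def using ab by (intro continuous_intros cc1_cont[OF cc]) auto
  then obtain m where m: "m \<in> {a..b}" "\<And>s. s \<in> {a..b} \<Longrightarrow> \<bar>w s\<bar> \<le> \<bar>w m\<bar>"
    using continuous_attains_sup[of "{a..b}" "\<lambda>s. \<bar>w s\<bar>"] ab by fastforce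
  have le: "\<bar>w s\<bar> \<le> \<bar>w m\<bar>" for s
    using m(2)[of s] ab(3)[of s] by (cases "s \<in> {a..b}") (auto simp: w_def)
  have m0: "m > 0" using m ab by auto
  have "\<bar>w s1\<bar> > 0" using s1 by (simp add: w_def)
  then have wm: "w m \<noteq> 0" using le[of s1] by auto
  \<comment> \<open>The factor may be negative; it makes w itself, and not only |w|, equal to M at
    the point m.\<close>
  define c where "c = M / w m"
  have c: "\<bar>c\<bar> = M / \<bar>w m\<bar>" "c \<noteq> 0" using M_pos wm by (auto simp: c_def)
  define A where "A = (LINT s|lborel. \<psi>' s powr p)"
  define B where "B = (LINT s|lborel. wt s * \<psi> s powr q)"
  have B: "B \<ge> 0" unfolding B_def by auto
  have "action_gap \<le> (LINT s|lborel. lagrangian (\<lambda>s. c * \<psi> s) (\<lambda>s. c * \<psi>' s) s)"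
  proof (rule cc1_normalized_bound(2)[OF cc1_cmult[OF cc] _ m0])
    have eq: "s powr (- \<gamma>) * (c * \<psi> s) = c * w s" for s by (simp add: w_def)
    show "\<bar>s powr (- \<gamma>) * (c * \<psi> s)\<bar> \<le> M" if "s > 0" for s
    proof -
      have "\<bar>c * w s\<bar> \<le> \<bar>c\<bar> * \<bar>w m\<bar>" unfolding abs_mult using le[of s] by (intro mult_left_mono) auto
      also have "\<dots> = M" using wm c by simp
      finally show ?thesis unfolding eq .
    qed
    show "m powr (- \<gamma>) * (c * \<psi> m) = M" unfolding eq unfolding c_def using wm by simp
  qed
  also have "(LINT s|lborel. lagrangian (\<lambda>s. c * \<psi> s) (\<lambda>s. c * \<psi>' s) s)
      = (LINT s|lborel. c powr p * \<psi>' s powr p - ((p - 1) * c powr q) * (wt s * \<psi> s powr q))"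
    by (rule Bochner_Integration.integral_cong) (auto simp: lagrangian_def powr_mult)
  also have "\<dots> = c powr p * A - ((p - 1) * c powr q) * B"
    unfolding A_def B_def using cc1_integrable_energy[OF cc] cc1_integrable_potential[OF cc] by simp
  finally have main: "A0 - (p - 1) * B0 \<le> c powr p * A - (p - 1) * (c powr q * B)"
    unfolding extremal_action by (simp add: mult_ac)
  define x where "x = c powr q * B / B0"
  have x0: "x \<ge> 0" using B B0_pos by (simp add: x_def)
  \<comment> \<open>Here x is the constraint of the scaled profile relative to that of
    \<open>V\<close>, and the tangent is taken at x = 1. Its slope times \<open>A0\<close> is
    \<open>A0 * (p / q)\<close> = \<open>(p - 1) * B0\<close>, exactly the multiplier of the
    constraint in the Lagrangian, so the lower bound for the action applies. Afterwards c cancels by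
    homogeneity.\<close>
  have "x powr (p / q) \<le> 1 + p / q * (x - 1)"
    by (rule powr_le_tangent_1) (use p q x0 in auto)
  then have "A0 * x powr (p / q) \<le> A0 * (1 + p / q * (x - 1))"
    using B0_pos \<gamma>_pos p q unfolding A0_eq by (intro mult_left_mono) auto
  also have "\<dots> = A0 - (p - 1) * B0 + (p - 1) * (B0 * x)"
  proof -
    have "A0 * (p / q) = (p * \<gamma>) * B0" using p q unfolding A0_eq by simp
    then have e1: "A0 * (p / q) = (p - 1) * B0" unfolding p_\<gamma> .
    have e2: "A0 * (1 + p / q * (x - 1)) = A0 + (A0 * (p / q)) * (x - 1)"
      by (simp add: distrib_left mult.assoc)
    show ?thesis unfolding e2 e1 by (simp add: algebra_simps)
  qed
  also have "B0 * x = c powr q * B" using B0_pos by (simp add: x_def)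
  also have "A0 - (p - 1) * B0 + (p - 1) * (c powr q * B) \<le> c powr p * A" using main by simp
  finally have "A0 * x powr (p / q) \<le> c powr p * A" .
  moreover have "x powr (p / q) = c powr p * (B / B0) powr (p / q)"
  proof -
    have "x powr (p / q) = (c powr q * (B / B0)) powr (p / q)" by (simp add: x_def)
    also have "\<dots> = c powr (q * (p / q)) * (B / B0) powr (p / q)" unfolding powr_mult powr_powr ..
    finally show ?thesis using p q by simp
  qed
  ultimately have "c powr p * (A0 * (B / B0) powr (p / q)) \<le> c powr p * A" by (simp add: mult_ac)
  then show ?thesis using c(2) by (simp add: A_def B_def)
qed

end

section \<open>Classification of one-dimensional solutions\<close>

context bliss begin

text \<open>The degenerate second-order equation is written as a first-order system for v and the
  momentum y = |v'|^(p-2) v', in which no division by v' occurs. The integrability hypothesis is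
  finite energy, since |y|^(p/(p-1)) = |v'|^p.\<close>

lemma classify_extremals:
  fixes v y :: "real \<Rightarrow> real"
  assumes Dv: "\<And>s. s > 0 \<Longrightarrow> (v has_real_derivative spow (1 / (p - 1)) (y s)) (at s)"
    and Dy: "\<And>s. s > 0 \<Longrightarrow>
      (y has_real_derivative - (q * \<gamma> * spow (q - 1) (v s) * wt s)) (at s)"
    and lim: "((\<lambda>s. s powr (- \<gamma>) * v s) \<longlongrightarrow> 0) (at_right 0)"
    and int: "integrable lborel (\<lambda>s. indicator {0<..} s * y s powr (p / (p - 1)))"
    and nontriv: "\<exists>s>0. v s \<noteq> 0"
  shows "\<exists>\<tau>>0. \<exists>\<epsilon>\<in>{1,-1}. \<forall>s>0. v s = \<epsilon> * (\<tau> powr (- \<gamma>) * V (\<tau> * s))"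
proof -
  define p' where "p' = p / (p - 1)"
  have p': "p' > 1" "p' - 1 = 1 / (p - 1)" "p' * (q * \<gamma>) = q" "p' * (p - 1) = p"
  proof -
    have "p' * (q * \<gamma>) = q * (p * \<gamma>) / (p - 1)" by (simp add: p'_def)
    then show "p' * (q * \<gamma>) = q" unfolding p_\<gamma> using p by simp
  qed (use p in \<open>auto simp: p'_def field_simps\<close>)
  have p'1: "1 / (p - 1) + 1 = p'" using p'(2) by linarith
  \<comment> \<open>The Hamiltonian of the equation, which is autonomous in the variable \<open>ln s\<close>.\<close>
  define E where "E s = s * y s powr p' - v s * y s + s powr (- (q * \<gamma>)) * v s powr q" for s
  have q1: "q > 1" using p q by simp
  have DE: "(E has_real_derivative 0) (at s)" if s: "s > 0" for s
  proof -
    define g where "g = spow (1 / (p - 1)) (y s)"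
    define W where "W = spow (q - 1) (v s)"
    define a where "a = wt s"
    define y' where "y' = - (q * \<gamma> * W * a)"
    have sa: "s powr (- (q * \<gamma>)) = s * a"
      using s powr_mult_base[of s "- 1 - q * \<gamma>"] by (simp add: a_def)
    have yp: "y s powr p' = g * y s"
      using spow_mult_self[of "1 / (p - 1)" "y s"] by (simp add: g_def p'1)
    have vq: "v s powr q = W * v s"
      using spow_mult_self[of "q - 1" "v s"] by (simp add: W_def)
    have y1: "((\<lambda>s. y s powr p') has_real_derivative (p' * g) * y') (at s)"
      using DERIV_chain2[OF DERIV_abs_powr[OF p'(1), of "y s"] Dy[OF s]]
      by (simp add: g_def W_def a_def y'_def p'(2))
    have v1: "((\<lambda>s. v s powr q) has_real_derivative (q * W) * g) (at s)"
      using DERIV_chain2[OF DERIV_abs_powr[OF q1, of "v s"] Dv[OF s]]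
      by (simp add: g_def W_def)
    have s1: "((\<lambda>s. s powr (- (q * \<gamma>))) has_real_derivative - (q * \<gamma>) * a) (at s)"
    proof -
      have "- (q * \<gamma>) - 1 = - 1 - q * \<gamma>" by simp
      then show ?thesis using has_real_derivative_powr[OF s, of "- (q * \<gamma>)"] unfolding a_def by metis
    qed
    have "(E has_real_derivative
        (1 * (y s powr p') + (p' * g) * y' * s) - (g * y s + y' * v s)
        + ((- (q * \<gamma>) * a) * v s powr q + (q * W) * g * s powr (- (q * \<gamma>)))) (at s)"
      unfolding E_def[abs_def] using Dv[OF s] Dy[OF s]
      by (intro DERIV_add DERIV_diff DERIV_mult y1 v1 s1 DERIV_ident)
         (simp_all add: g_def W_def a_def y'_def)
    also have "(1 * (y s powr p') + (p' * g) * y' * s) - (g * y s + y' * v s)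
        + ((- (q * \<gamma>) * a) * v s powr q + (q * W) * g * s powr (- (q * \<gamma>)))
       = (q - p' * (q * \<gamma>)) * (g * W * a * s)"
      unfolding sa yp vq y'_def by (simp add: algebra_simps)
    finally show ?thesis by (simp add: p'(3))
  qed
  obtain e where e: "E s = e" if "s > 0" for s
  proof -
    have "E constant_on {0<..}"
      by (rule has_field_derivative_0_imp_constant_on[OF DE]) (auto simp: convex_connected)
    then show ?thesis using that by (auto simp: constant_on_def)
  qed
  \<comment> \<open>If e were not 0, the terms containing v would be negligible near 0, and s |y|^p'
    would stay above a positive constant c. Then |y|^p' \<ge> c / s, which is not integrable at
    0.\<close>
  have "e = 0"
  proof (rule ccontr)
    assume "e \<noteq> 0"
    define w where "w s = s powr (- \<gamma>) * v s" for s
    have bnd: "\<bar>e\<bar> \<le> 2 * (s * y s powr p') + (w s powr p + w s powr q)" if s: "s > 0" for s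
    proof -
      \<comment> \<open>This is s^(1/p) v', the natural partner of w: the product of w with its
        signed power of order p - 1 is v y.\<close>
      define b where "b = spow (1 / p) s * spow (1 / (p - 1)) (y s)"
      have bp: "b powr p = s * y s powr p'"
        using p s by (simp add: b_def powr_mult p'_def)
      have A: "s powr (- \<gamma>) * (s powr (1 / p)) powr (p - 1) = s powr ((p - 1) / p - \<gamma>)"
        by (simp add: powr_powr flip: powr_add)
      have "w s * spow (p - 1) b = s powr (- \<gamma> + (p - 1) / p) * v s * y s"
        using p s by (simp add: b_def spow_mult spow_spow w_def spow_pos A)
      also have "- \<gamma> + (p - 1) / p = 0" using p by (simp add: \<gamma>_def field_simps)
      finally have wb: "w s * spow (p - 1) b = v s * y s" using s by simp
      have wq: "w s powr q = s powr (- (q * \<gamma>)) * v s powr q"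
        by (simp add: w_def powr_mult powr_powr mult.commute)
      have "\<bar>v s * y s\<bar> \<le> w s powr p + s * y s powr p'"
        using mult_spow_le[OF p, of "w s" b] unfolding wb bp .
      moreover have "\<bar>e\<bar> \<le> s * y s powr p' + \<bar>v s * y s\<bar> + w s powr q"
      proof -
        have "s * y s powr p' \<ge> 0" "w s powr q \<ge> 0" using s by auto
        then show ?thesis unfolding e[OF s, symmetric] E_def wq[symmetric] by linarith
      qed
      ultimately show ?thesis by linarith
    qed
    have "((\<lambda>s. w s powr p + w s powr q) \<longlongrightarrow> 0 powr p + 0 powr q) (at_right 0)"
      using lim p q unfolding w_def[abs_def]
      by (intro tendsto_add isCont_tendsto_compose[OF isCont_abs_powr]) auto
    then have "((\<lambda>s. w s powr p + w s powr q) \<longlongrightarrow> 0) (at_right 0)" by simp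
    then have "eventually (\<lambda>s. w s powr p + w s powr q < \<bar>e\<bar> / 2) (at_right 0)"
      using \<open>e \<noteq> 0\<close> by (intro order_tendstoD) auto
    then obtain d where d: "d > 0" "\<And>s. 0 < s \<Longrightarrow> s < d \<Longrightarrow> w s powr p + w s powr q < \<bar>e\<bar> / 2"
      by (auto simp: eventually_at_right_field)
    define c where "c = \<bar>e\<bar> / 4"
    have c: "c > 0" using \<open>e \<noteq> 0\<close> by (simp add: c_def)
    define d' where "d' = d / 2"
    have lower: "c / s \<le> y s powr p'" if "0 < s" "s \<le> d'" for s
    proof -
      have "\<bar>e\<bar> / 2 \<le> 2 * (s * y s powr p')"
        using bnd[of s] d(2)[of s] d(1) that by (auto simp: d'_def)
      then show ?thesis using that by (simp add: c_def field_simps)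
    qed
    define I where "I = (LINT s|lborel. indicator {0<..} s * y s powr p')"
    have I0: "I \<ge> 0" by (auto simp: I_def)
    have up: "c * (ln d' - ln a) \<le> I" if a: "0 < a" "a < d'" for a
    proof -
      have "(LBINT s. indicator {a..d'} s *\<^sub>R (c / s)) = c * ln d' - c * ln a"
        using a by (intro integral_FTC_atLeastAtMost)
          (auto intro!: continuous_intros derivative_eq_intros simp flip: has_real_derivative_iff_has_vector_derivative)
      moreover have "(LBINT s. indicator {a..d'} s *\<^sub>R (c / s)) \<le> I"
        unfolding I_def
      proof (rule integral_mono)
        show "integrable lborel (\<lambda>s. indicator {a..d'} s *\<^sub>R (c / s))"
          unfolding set_integrable_def[symmetric]
          using a by (intro borel_integrable_atLeastAtMost') (auto intro!: continuous_intros)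
        show "integrable lborel (\<lambda>s. indicator {0<..} s * y s powr p')"
          using int by (simp add: p'_def)
      qed (use a lower in \<open>auto simp: indicator_def\<close>)
      ultimately show ?thesis by (simp add: algebra_simps)
    qed
    \<comment> \<open>Chosen so that the logarithmic lower bound equals I + 1.\<close>
    define a where "a = d' * exp (- ((I + 1) / c))"
    have "0 < a" "a < d'" using d(1) I0 c by (auto simp: a_def d'_def)
    moreover have "ln d' - ln a = (I + 1) / c"
    proof -
      have "d' > 0" using d(1) by (simp add: d'_def)
      then show ?thesis unfolding a_def by (subst ln_mult) auto
    qed
    ultimately show False using up[of a] c by simp
  qed
  then have E0: "v s * y s = s * y s powr p' + s powr (- (q * \<gamma>)) * v s powr q" if "s > 0" for s
    using e[OF that] by (simp add: E_def)
  have vy_pos: "v s * y s > 0" if "s > 0" "v s \<noteq> 0" for s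
    unfolding E0[OF that(1)] using that by (intro add_nonneg_pos mult_pos_pos mult_nonneg_nonneg) auto
  have vy_nonneg: "v s * y s \<ge> 0" if "s > 0" for s
    unfolding E0[OF that(1)] using that by auto
  have mono_v: "(v s)\<^sup>2 \<le> (v t)\<^sup>2" if "0 < s" "s \<le> t" for s t
  proof (rule DERIV_nonneg_imp_nondecreasing[OF that(2)])
    fix x assume x: "s \<le> x" "x \<le> t"
    then have "x > 0" using that by simp
    have "((\<lambda>x. (v x)\<^sup>2) has_real_derivative 2 * v x * spow (1 / (p - 1)) (y x)) (at x)"
      using Dv[OF \<open>x > 0\<close>] by (auto intro!: derivative_eq_intros)
    moreover have "0 \<le> 2 * v x * spow (1 / (p - 1)) (y x)"
      using vy_nonneg[OF \<open>x > 0\<close>] by (auto simp: spow_def sgn_if zero_le_mult_iff)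
    ultimately show "\<exists>y. ((\<lambda>x. (v x)\<^sup>2) has_real_derivative y) (at x) \<and> 0 \<le> y" by blast
  qed
  have mono_y: "(y t)\<^sup>2 \<le> (y s)\<^sup>2" if "0 < s" "s \<le> t" for s t
  proof (rule DERIV_nonpos_imp_nonincreasing[OF that(2)])
    fix x assume x: "s \<le> x" "x \<le> t"
    then have "x > 0" using that by simp
    have "((\<lambda>x. (y x)\<^sup>2) has_real_derivative 2 * y x * (- (q * \<gamma> * spow (q - 1) (v x) * x powr (- 1 - q * \<gamma>)))) (at x)"
      using Dy[OF \<open>x > 0\<close>] by (auto intro!: derivative_eq_intros)
    moreover have "0 \<le> q * \<gamma> * (y x * spow (q - 1) (v x)) * x powr (- 1 - q * \<gamma>)"
    proof (rule mult_nonneg_nonneg[OF mult_nonneg_nonneg])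
      show "0 \<le> q * \<gamma>" "0 \<le> x powr (- 1 - q * \<gamma>)" using \<gamma>_pos p q by auto
      show "0 \<le> y x * spow (q - 1) (v x)"
        using vy_nonneg[OF \<open>x > 0\<close>]
        by (cases "v x" "0 :: real" rule: linorder_cases) (auto simp: spow_def zero_le_mult_iff intro!: mult_nonpos_nonneg)
    qed
    ultimately show "\<exists>z. ((\<lambda>x. (y x)\<^sup>2) has_real_derivative z) (at x) \<and> z \<le> 0"
      by (intro exI conjI) (auto simp: algebra_simps)
  qed
  \<comment> \<open>At a zero of v the vanishing energy gives y = 0 as well. Monotonicity of v^2
    spreads the zero to the left; monotonicity of y^2 gives y = 0 to the right, where v y > 0 would
    follow from v \<noteq> 0. This takes the place of a uniqueness theorem for the degenerate
    system.\<close>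
  have nz: "v s \<noteq> 0" if s: "s > 0" for s
  proof
    assume v0: "v s = 0"
    then have "y s = 0" using E0[OF s] s by simp
    have "v t = 0" if "t > 0" for t
    proof (cases "t \<le> s")
      case True
      then show ?thesis using mono_v[OF that True] v0 by simp
    next
      case False
      then have "y t = 0" using mono_y[OF s, of t] \<open>y s = 0\<close> by simp
      then show ?thesis using vy_pos[OF that] by auto
    qed
    then show False using nontriv by auto
  qed
  define \<epsilon> where "\<epsilon> = sgn (v 1)"
  have \<epsilon>: "\<epsilon> \<in> {1,-1}" "\<epsilon> * \<epsilon> = 1" using nz[of 1] by (auto simp: \<epsilon>_def sgn_if)
  define u where "u s = \<epsilon> * v s" for s
  define z where "z s = \<epsilon> * y s" for s
  have contv: "continuous_on {0<..} v"
    using Dv by (auto intro!: DERIV_continuous_on intro: has_field_derivative_at_within)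
  have u_pos: "u s > 0" if s: "s > 0" for s
  proof (rule ccontr)
    assume "\<not> u s > 0"
    then have us: "u s < 0" using nz[OF s] \<epsilon> by (auto simp: u_def)
    have "u 1 > 0" using nz[of 1] by (auto simp: u_def \<epsilon>_def sgn_if)
    have con: "continuous_on {0<..} u" unfolding u_def by (intro continuous_intros contv)
    have "connected (u ` {0<..})"
      by (rule connected_continuous_image[OF con]) (auto simp: convex_connected)
    then have "0 \<in> u ` {0<..}"
      using us \<open>u 1 > 0\<close> s unfolding connected_iff_interval
      by (meson greaterThan_iff imageI less_imp_le zero_less_one)
    then show False using nz \<epsilon> by (auto simp: u_def)
  qed
  have uz: "u s * z s = v s * y s" for s using \<epsilon>(2) by (simp add: u_def z_def mult_ac)
  have z_pos: "z s > 0" if s: "s > 0" for s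
    using vy_pos[OF s nz[OF s]] u_pos[OF s] unfolding uz[symmetric] by (simp add: zero_less_mult_iff)
  have \<epsilon>p: "spow a (\<epsilon> * x) = \<epsilon> * spow a x" "(\<epsilon> * x) powr a = x powr a" for a x
    using \<epsilon>(1) by (auto simp: uminus_powr_eq)
  have Du: "(u has_real_derivative z s powr (1 / (p - 1))) (at s)" if s: "s > 0" for s
    using DERIV_cmult[OF Dv[OF s], of \<epsilon>] spow_pos[OF z_pos[OF s], of "1 / (p - 1)"]
    unfolding z_def \<epsilon>p u_def[abs_def] by simp
  have Dz: "(z has_real_derivative - (q * \<gamma> * u s powr (q - 1) * wt s)) (at s)" if s: "s > 0" for s
  proof -
    have "u s powr (q - 1) = \<epsilon> * spow (q - 1) (v s)"
      using spow_pos[OF u_pos[OF s], of "q - 1"] unfolding u_def \<epsilon>p by simp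
    then have eq: "\<epsilon> * - (q * \<gamma> * spow (q - 1) (v s) * wt s)
        = - (q * \<gamma> * u s powr (q - 1) * wt s)" by simp
    show ?thesis unfolding z_def[abs_def] by (rule DERIV_cong[OF DERIV_cmult[OF Dy[OF s]] eq])
  qed
  have F0: "u s * z s = s * z s powr p' + s powr (- (q * \<gamma>)) * u s powr q" if "s > 0" for s
    using E0[OF that] unfolding uz unfolding u_def z_def \<epsilon>p .
  \<comment> \<open>A second first integral on the zero energy level; the two together determine \<open>u\<close>.\<close>
  define R where "R s = q * ln (u s) - q * ln s - p' * ln (z s)" for s
  have DR: "(R has_real_derivative 0) (at s)" if s: "s > 0" for s
  proof -
    note pos = s u_pos[OF s] z_pos[OF s]
    define g where "g = z s powr (1 / (p - 1))"
    define W where "W = u s powr (q - 1)"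
    define a where "a = wt s"
    have sa: "s powr (- (q * \<gamma>)) = s * a"
      using s powr_mult_base[of s "- 1 - q * \<gamma>"] by (simp add: a_def)
    have yp: "z s powr p' = z s * g"
      using powr_mult_base[of "z s" "1 / (p - 1)"] pos p'1 by (simp add: g_def add.commute)
    have vq: "u s powr q = u s * W"
      using powr_mult_base[of "u s" "q - 1"] pos by (simp add: W_def)
    have "(R has_real_derivative q * (g / u s) - q * (1 / s) - p' * (- (q * \<gamma> * W * a) / z s)) (at s)"
      unfolding R_def[abs_def] using pos Du[OF s] Dz[OF s]
      by (auto intro!: derivative_eq_intros simp: g_def W_def a_def mult_ac)
    also have "q * (g / u s) - q * (1 / s) - p' * (- (q * \<gamma> * W * a) / z s)
      = q * (g / u s) - q * (1 / s) + (p' * (q * \<gamma>)) * W * a / z s" by (simp add: algebra_simps)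
    also have "\<dots> = q * (s * (z s * g) + s * a * (u s * W) - u s * z s) / (s * u s * z s)"
      unfolding p'(3) using pos by (simp add: field_simps)
    also have "\<dots> = 0" using F0[OF s] unfolding yp vq sa by simp
    finally show ?thesis .
  qed
  obtain r where r: "R s = r" if "s > 0" for s
  proof -
    have "R constant_on {0<..}"
      by (rule has_field_derivative_0_imp_constant_on[OF DR]) (auto simp: convex_connected)
    then show ?thesis using that by (auto simp: constant_on_def)
  qed
  \<comment> \<open>The constant ratio (u / s)^q / z^p'. For the profile \<tau>^(-\<gamma>) V(\<tau>
    s) it equals \<tau>^k, which determines \<tau>.\<close>
  define L where "L = exp r"
  define \<tau> where "\<tau> = L powr (1 / k)"
  have L: "L > 0" and \<tau>: "\<tau> > 0" by (auto simp: L_def \<tau>_def)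
  \<comment> \<open>With x = u / s and g = u', the zero energy level gives x = g (1 + L s^k) and the
    second integral gives x^(k+1) = L^(1/p) g. Eliminating g leaves x^k (1 + L s^k) = L^(1/p), an
    explicit formula for u.\<close>
  have main: "u s = \<tau> powr (- \<gamma>) * V (\<tau> * s)" if s: "s > 0" for s
  proof -
    note pos = s u_pos[OF s] z_pos[OF s]
    define g where "g = z s powr (1 / (p - 1))"
    have gp: "g > 0" using pos by (simp add: g_def)
    have zp: "z s powr p' = g powr p" "z s = g powr (p - 1)" using p pos by (auto simp: g_def powr_powr p'_def)
    have "u s powr q = L * (s powr q * z s powr p')"
    proof -
      have "q * ln (u s) = r + q * ln s + p' * ln (z s)" using r[OF s] by (simp add: R_def)
      then show ?thesis using pos by (simp add: powr_def L_def exp_add)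
    qed
    then have uq: "u s powr q = L * (s powr q * g powr p)" unfolding zp(1) .
    then have "(u s / s) powr q = L * g powr p" using pos by (simp add: powr_divide)
    then have "((u s / s) powr q) powr (1 / p) = (L * g powr p) powr (1 / p)" by simp
    then have g1: "(u s / s) powr (k + 1) = L powr (1 / p) * g"
      using p gp by (simp add: powr_mult powr_powr q_div_p)
    have "u s * g powr (p - 1) = s * g powr p + s powr (- (q * \<gamma>)) * (L * (s powr q * g powr p))"
      using F0[OF s] unfolding uq zp(1) unfolding zp(2) .
    moreover have "g powr p = g powr (p - 1) * g" using powr_mult_self_eq_spow[of g p] gp by (simp add: spow_pos)
    ultimately have "g powr (p - 1) * u s = g powr (p - 1) * (g * (s + L * (s powr (- (q * \<gamma>)) * s powr q)))"
      by (simp add: algebra_simps)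
    then have "u s = g * (s + L * (s powr (- (q * \<gamma>)) * s powr q))" using gp by simp
    also have "s powr (- (q * \<gamma>)) * s powr q = s * s powr k"
    proof -
      have "- (q * \<gamma>) + q = 1 + k" using q_minus_q_\<gamma> by simp
      then show ?thesis using s by (simp add: powr_mult_base flip: powr_add)
    qed
    finally have u1: "u s / s = g * (1 + L * s powr k)" using s by (simp add: field_simps)
    define x where "x = u s / s"
    have x: "x > 0" using pos by (simp add: x_def)
    have "x powr k * x = x powr (k + 1)" using x by (simp add: powr_add)
    then have "x powr k * (g * (1 + L * s powr k)) = L powr (1 / p) * g" using g1 u1 by (simp add: x_def)
    then have "g * (x powr k * (1 + L * s powr k)) = g * L powr (1 / p)" by (simp add: mult_ac)
    then have "x powr k * (1 + L * s powr k) = L powr (1 / p)" using gp by simp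
    moreover have P: "1 + L * s powr k > 0" using L by (simp add: add_pos_nonneg)
    ultimately have xk: "x powr k = L powr (1 / p) / (1 + L * s powr k)" by (simp add: field_simps)
    have "x = (x powr k) powr (1 / k)" using x k_pos by (simp add: powr_powr)
    also have "\<dots> = (L powr (1 / p)) powr (1 / k) * (1 + L * s powr k) powr (- 1 / k)"
      unfolding xk by (simp add: powr_divide powr_minus_divide)
    also have "(L powr (1 / p)) powr (1 / k) = \<tau> powr (- \<gamma>) * \<tau>"
    proof -
      have "\<tau> powr (- \<gamma>) * \<tau> = \<tau> powr (- \<gamma> + 1)" using \<tau> by (simp only: powr_add powr_one)
      also have "- \<gamma> + 1 = 1 / p" by (simp add: \<gamma>_def)
      finally show ?thesis by (simp add: \<tau>_def powr_powr mult.commute)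
    qed
    also have "L * s powr k = (\<tau> * s) powr k" using L k_pos by (simp add: powr_mult \<tau>_def powr_powr)
    finally show ?thesis using \<tau> s by (simp add: x_def V_def field_simps)
  qed
  have "v s = \<epsilon> * (\<tau> powr (- \<gamma>) * V (\<tau> * s))" if "s > 0" for s
    using main[OF that] \<epsilon>(1) by (auto simp: u_def)
  then show ?thesis using \<tau> \<epsilon>(1) by blast
qed

end

section \<open>Functions of finite energy\<close>

text \<open>Convexity of |z|^p for a / (1 - t) and b / t with weights 1 - t and t. As t tends to 0
  the factor of |a|^p tends to 1, so a sharp constant survives a limit; this does the work of
  Minkowski's inequality.\<close>

lemma powr_add_le:
  fixes a b :: real
  assumes "p > 1" "0 < t" "t < 1"
  shows "(a + b) powr p \<le> (1 - t) powr (1 - p) * a powr p + t powr (1 - p) * b powr p"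
proof -
  define \<theta> where "\<theta> = \<bar>a + b\<bar>"
  have e: "r * (c / r) powr p = r powr (1 - p) * c powr p" if "r > 0" for r c :: real
    using that by (simp add: powr_divide powr_diff)
  have "\<theta> powr p + p * \<theta> powr (p - 1) * (c / r - \<theta>) \<le> (c / r) powr p" for c r
    by (rule powr_tangent) (use assms in \<open>auto simp: \<theta>_def\<close>)
  then have *: "r * (\<theta> powr p + p * \<theta> powr (p - 1) * (\<bar>c\<bar> / r - \<theta>)) \<le> r powr (1 - p) * c powr p" if "r > 0" for r c
    using mult_left_mono[of _ _ r] that e[OF that, of "\<bar>c\<bar>"] by (metis abs_powr_real less_imp_le)
  have "(1 - t) * (\<theta> powr p + p * \<theta> powr (p - 1) * (\<bar>a\<bar> / (1 - t) - \<theta>))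
      + t * (\<theta> powr p + p * \<theta> powr (p - 1) * (\<bar>b\<bar> / t - \<theta>))
      = \<theta> powr p + p * \<theta> powr (p - 1) * (\<bar>a\<bar> + \<bar>b\<bar> - \<theta>)"
    using assms by (simp add: field_simps)
  moreover have "0 \<le> p * \<theta> powr (p - 1) * (\<bar>a\<bar> + \<bar>b\<bar> - \<theta>)"
    using assms by (auto simp: \<theta>_def)
  ultimately have "\<theta> powr p \<le> (1 - t) powr (1 - p) * a powr p + t powr (1 - p) * b powr p"
    using *[of "1 - t" a] *[of t b] assms by linarith
  then show ?thesis by (simp add: \<theta>_def)
qed

text \<open>For s < 0 the interval is empty and the value is 0, in accordance with the extension of
  profiles by 0.\<close>

definition prim :: "(real \<Rightarrow> real) \<Rightarrow> real \<Rightarrow> real" where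
  "prim g s = (LINT t:{0..s}|lborel. g t)"

text \<open>Hoelder's inequality against the indicator function of the interval, which equals each
  of its positive powers.\<close>

lemma set_integrable_of_powr:
  fixes g :: "real \<Rightarrow> real"
  assumes p: "p > 1" and [measurable]: "g \<in> borel_measurable borel" and I: "integrable lborel (\<lambda>s. g s powr p)"
    and ab: "a \<le> b"
  shows "set_integrable lborel {a..b} g"
    and "\<bar>LINT t:{a..b}|lborel. g t\<bar> \<le> (b - a) powr (1 - 1 / p) * (LINT s|lborel. g s powr p) powr (1 / p)"
proof -
  define p' where "p' = p / (p - 1)"
  have p': "p' > 1" "1 / p + 1 / p' = 1" "1 / p' = 1 - 1 / p" using p by (auto simp: p'_def field_simps)
  have i1: "integrable lborel (\<lambda>s. indicator {a..b} s powr p' :: real)"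
  proof -
    have "integrable lborel (indicator {a..b} :: real \<Rightarrow> real)"
      using ab by (auto simp: integrable_indicator_iff)
    moreover have "(\<lambda>s. indicator {a..b} s powr p' :: real) = indicator {a..b}"
      by (auto simp: indicator_def)
    ultimately show ?thesis by simp
  qed
  have i2: "(LINT s|lborel. (indicator {a..b} s powr p' :: real)) = b - a"
  proof -
    have "(\<lambda>s. indicator {a..b} s powr p' :: real) = indicator {a..b}"
      by (auto simp: indicator_def)
    then show ?thesis using ab by simp
  qed
  note H = Holder_inequality_integral[of g lborel "indicator {a..b}" p p', OF _ _ p p'(1,2) I i1]
  show "set_integrable lborel {a..b} g"
    using H(1) by (simp add: set_integrable_def mult.commute)
  have "\<bar>LINT t:{a..b}|lborel. g t\<bar> \<le> (LINT s|lborel. \<bar>g s * indicator {a..b} s\<bar>)"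
    unfolding set_lebesgue_integral_def by (subst mult.commute) (simp add: integral_abs_bound)
  also have "\<dots> \<le> (LINT s|lborel. g s powr p) powr (1 / p) * (LINT s|lborel. (indicator {a..b} s powr p' :: real)) powr (1 / p')"
    using H(2) by simp
  finally show "\<bar>LINT t:{a..b}|lborel. g t\<bar> \<le> (b - a) powr (1 - 1 / p) * (LINT s|lborel. g s powr p) powr (1 / p)"
    unfolding i2 p'(3) by (simp add: mult.commute)
qed

section \<open>Limits of test profiles in the energy norm\<close>

context bliss begin

text \<open>The completion seen on the half line: g is an L^p limit of derivatives of test profiles,
  and the function belonging to it is \<open>prim g\<close>. Convergence of the profiles themselves
  is a consequence, quantified by \<open>prim_err\<close>.\<close>

definition energy_limit :: "(nat \<Rightarrow> real \<Rightarrow> real) \<Rightarrow> (nat \<Rightarrow> real \<Rightarrow> real) \<Rightarrow> (real \<Rightarrow> real) \<Rightarrow> bool" where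
  "energy_limit \<psi> \<psi>' g \<longleftrightarrow> g \<in> borel_measurable borel \<and> (\<forall>j. cc1 (\<psi> j) (\<psi>' j)) \<and>
     (\<lambda>j. \<integral>\<^sup>+ s. ennreal ((\<psi>' j s - g s) powr p) \<partial>lborel) \<longlonglongrightarrow> 0"

lemma cc1_measurable: "cc1 \<psi> \<psi>' \<Longrightarrow> \<psi> \<in> borel_measurable borel" "cc1 \<psi> \<psi>' \<Longrightarrow> \<psi>' \<in> borel_measurable borel"
  using cc1_cont[of \<psi> \<psi>' UNIV] borel_measurable_continuous_onI by auto

lemma cc1_nonpos: "cc1 \<psi> \<psi>' \<Longrightarrow> s \<le> 0 \<Longrightarrow> \<psi> s = 0" "cc1 \<psi> \<psi>' \<Longrightarrow> s \<le> 0 \<Longrightarrow> \<psi>' s = 0"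
  by (auto simp: cc1_def)

lemma cc1_prim:
  assumes cc: "cc1 \<psi> \<psi>'" shows "prim \<psi>' s = \<psi> s"
proof (cases "s \<ge> 0")
  case True
  have "(LINT t|lborel. indicator {0..s} t *\<^sub>R \<psi>' t) = \<psi> s - \<psi> 0"
    using cc True by (intro integral_FTC_atLeastAtMost cc1_cont[OF cc])
      (auto simp: cc1_def has_vector_derivative_at_within simp flip: has_real_derivative_iff_has_vector_derivative
        intro: has_field_derivative_at_within)
  then show ?thesis using cc1_nonpos[OF cc] by (simp add: prim_def set_lebesgue_integral_def)
next
  case False
  then show ?thesis using cc1_nonpos[OF cc, of s] by (simp add: prim_def set_lebesgue_integral_def)
qed

context
  fixes \<psi> \<psi>' g
  assumes lim: "energy_limit \<psi> \<psi>' g"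
begin

lemma energy_limit_cc1: "cc1 (\<psi> j) (\<psi>' j)" using lim by (simp add: energy_limit_def)
lemma energy_limit_measurable [measurable]: "g \<in> borel_measurable borel" "\<psi> j \<in> borel_measurable borel" "\<psi>' j \<in> borel_measurable borel"
  using lim cc1_measurable[OF energy_limit_cc1] by (auto simp: energy_limit_def)

lemma energy_limit_integrable: "integrable lborel (\<lambda>s. g s powr p)"
proof -
  have "eventually (\<lambda>j. (\<integral>\<^sup>+ s. ennreal ((\<psi>' j s - g s) powr p) \<partial>lborel) < 1) sequentially"
    using lim by (auto simp: energy_limit_def intro: order_tendstoD)
  then obtain j where j: "(\<integral>\<^sup>+ s. ennreal ((\<psi>' j s - g s) powr p) \<partial>lborel) < 1"
    by (auto dest: eventually_happens)
  have "integrable lborel (\<lambda>s. (\<psi>' j s - g s) powr p)"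
    by (rule integrableI_nonneg) (use j in \<open>auto intro: less_trans\<close>)
  then have I: "integrable lborel (\<lambda>s. (1 - 1 / 2) powr (1 - p) * \<psi>' j s powr p + (1 / 2) powr (1 - p) * (\<psi>' j s - g s) powr p)"
    using cc1_integrable_energy[OF energy_limit_cc1] by auto
  show ?thesis
  proof (rule Bochner_Integration.integrable_bound[OF I])
    show "AE s in lborel. norm (g s powr p) \<le> norm ((1 - 1 / 2) powr (1 - p) * \<psi>' j s powr p + (1 / 2) powr (1 - p) * (\<psi>' j s - g s) powr p)"
    proof (rule AE_I2)
      fix s
      have "(\<psi>' j s + (g s - \<psi>' j s)) powr p \<le> (1 - 1 / 2) powr (1 - p) * \<psi>' j s powr p + (1 / 2) powr (1 - p) * (g s - \<psi>' j s) powr p"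
        using p by (intro powr_add_le) auto
      moreover have "(g s - \<psi>' j s) powr p = (\<psi>' j s - g s) powr p"
        using uminus_powr_eq[of "\<psi>' j s - g s" p] by simp
      ultimately show "norm (g s powr p) \<le> norm ((1 - 1 / 2) powr (1 - p) * \<psi>' j s powr p + (1 / 2) powr (1 - p) * (\<psi>' j s - g s) powr p)"
        by simp
    qed
  qed measurable
qed

definition err :: "nat \<Rightarrow> real" where "err j = (LINT s|lborel. (\<psi>' j s - g s) powr p)"

lemma energy_limit_integrable_diff: "integrable lborel (\<lambda>s. (\<psi>' j s - g s) powr p)"
proof -
  have I: "integrable lborel (\<lambda>s. (1 - 1 / 2) powr (1 - p) * \<psi>' j s powr p + (1 / 2) powr (1 - p) * (- g s) powr p)"
    using cc1_integrable_energy[OF energy_limit_cc1] energy_limit_integrable by (auto simp: uminus_powr_eq)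
  show ?thesis
  proof (rule Bochner_Integration.integrable_bound[OF I])
    show "AE s in lborel. norm ((\<psi>' j s - g s) powr p) \<le> norm ((1 - 1 / 2) powr (1 - p) * \<psi>' j s powr p + (1 / 2) powr (1 - p) * (- g s) powr p)"
      using powr_add_le[OF p, of "1/2" "\<psi>' j _" "- g _"] by (intro AE_I2) auto
  qed measurable
qed

lemma err_nonneg: "err j \<ge> 0" by (auto simp: err_def)

lemma err_limit: "err \<longlonglongrightarrow> 0"
proof -
  have "(\<integral>\<^sup>+ s. ennreal ((\<psi>' j s - g s) powr p) \<partial>lborel) = ennreal (err j)" for j
    unfolding err_def by (rule nn_integral_eq_integral[OF energy_limit_integrable_diff]) auto
  then have "(\<lambda>j. ennreal (err j)) \<longlonglongrightarrow> ennreal 0" using lim by (simp add: energy_limit_def)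
  then show ?thesis using err_nonneg by (subst (asm) tendsto_ennreal_iff) auto
qed

lemma err_root_limit: "(\<lambda>j. err j powr (1 / p)) \<longlonglongrightarrow> 0"
  using isCont_tendsto_compose[OF isCont_abs_powr[of "1 / p" 0] err_limit] p by simp

lemma prim_diff:
  assumes "s \<ge> 0" shows "\<psi> j s - prim g s = (LINT t:{0..s}|lborel. (\<psi>' j t - g t))"
  unfolding cc1_prim[OF energy_limit_cc1, symmetric] prim_def
  using set_integrable_of_powr(1)[OF p energy_limit_measurable(1) energy_limit_integrable assms]
    set_integrable_of_powr(1)[OF p energy_limit_measurable(3) cc1_integrable_energy[OF energy_limit_cc1] assms]
  by (simp add: set_integral_diff)

text \<open>Hoelder's inequality on the interval from 0 to s; the power \<gamma> = 1 - 1 / p is that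
  of its length.\<close>

lemma prim_err: assumes "s \<ge> 0" shows "\<bar>\<psi> j s - prim g s\<bar> \<le> s powr \<gamma> * err j powr (1 / p)"
  using set_integrable_of_powr(2)[OF p _ energy_limit_integrable_diff assms]
  unfolding prim_diff[OF assms] err_def by (simp add: \<gamma>_def)

lemma prim_nonpos: "s \<le> 0 \<Longrightarrow> prim g s = 0"
proof -
  assume "s \<le> 0"
  then consider "s = 0" | "s < 0" by linarith
  then show ?thesis
  proof cases
    case 1
    have "\<bar>LINT t:{0..0}|lborel. g t\<bar> \<le> 0"
      using set_integrable_of_powr(2)[OF p energy_limit_measurable(1) energy_limit_integrable, of 0 0] by simp
    then show ?thesis using 1 by (simp add: prim_def)
  qed (simp add: prim_def set_lebesgue_integral_def)
qed

lemma prim_limit: "(\<lambda>j. \<psi> j s) \<longlonglongrightarrow> prim g s"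
proof (cases "s \<ge> 0")
  case True
  have l: "(\<lambda>j. s powr \<gamma> * err j powr (1 / p)) \<longlonglongrightarrow> 0"
    using tendsto_mult[OF tendsto_const err_root_limit, of "s powr \<gamma>"] by simp
  have "(\<lambda>j. \<psi> j s - prim g s) \<longlonglongrightarrow> 0"
    by (rule Lim_null_comparison[OF _ l]) (use prim_err[OF True] in \<open>auto intro!: always_eventually\<close>)
  then show ?thesis by (simp add: LIM_zero_iff)
next
  case False
  then show ?thesis using cc1_nonpos(1)[OF energy_limit_cc1] prim_nonpos[of s] by simp
qed

lemma prim_measurable [measurable]: "prim g \<in> borel_measurable borel"
  by (rule borel_measurable_LIMSEQ_real[OF prim_limit]) simp

lemma prim_Icc:
  assumes "0 \<le> a" "a \<le> b" shows "prim g b - prim g a = (LINT t:{a..b}|lborel. g t)"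
proof -
  note si = set_integrable_of_powr(1)[OF p energy_limit_measurable(1) energy_limit_integrable]
  have "(LINT t:{0..b}|lborel. g t) = (LINT t:{0..a} \<union> {a..b}|lborel. g t)"
    using assms by (simp add: ivl_disj_un_two_touch)
  also have "\<dots> = (LINT t:{0..a}|lborel. g t) + (LINT t:{a..b}|lborel. g t)"
  proof (rule set_integral_Un_AE)
    show "AE x in lborel. \<not> (x \<in> {0..a} \<and> x \<in> {a..b})"
      using AE_lborel_singleton[of a] by eventually_elim auto
  qed (use assms si in auto)
  finally show ?thesis by (simp add: prim_def)
qed

lemma prim_continuous: "continuous_on {0<..} (prim g)"
proof (rule continuous_at_imp_continuous_on, rule ballI)
  fix s :: real assume "s \<in> {0<..}"
  then have s: "s > 0" by simp
  define N where "N = (LINT t|lborel. g t powr p) powr (1 / p)"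
  have bd: "\<bar>prim g b - prim g a\<bar> \<le> (b - a) powr \<gamma> * N" if "0 \<le> a" "a \<le> b" for a b
    using set_integrable_of_powr(2)[OF p energy_limit_measurable(1) energy_limit_integrable that(2)]
    unfolding prim_Icc[OF that] by (simp add: N_def \<gamma>_def)
  have bd': "\<bar>prim g t - prim g s\<bar> \<le> (t - s) powr \<gamma> * N" if "t > 0" for t
  proof (cases "t \<le> s")
    case True
    have "(s - t) powr \<gamma> = (t - s) powr \<gamma>" using uminus_powr_eq[of "s - t" \<gamma>] by simp
    then show ?thesis using bd[of t s] True that by (simp add: abs_minus_commute)
  qed (use bd[of s t] s in auto)
  have "isCont (\<lambda>t. (t - s) powr \<gamma> * N) s"
    using \<gamma>_pos by (intro continuous_intros isCont_o2[OF _ isCont_abs_powr]) auto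
  then have "((\<lambda>t. (t - s) powr \<gamma> * N) \<longlongrightarrow> 0) (at s)" using \<gamma>_pos by (simp add: isCont_def)
  moreover have "eventually (\<lambda>t. norm (prim g t - prim g s) \<le> (t - s) powr \<gamma> * N) (at s)"
  proof -
    have "eventually (\<lambda>t. t \<in> {0<..}) (at s)" using s by (intro eventually_at_in_open') auto
    then show ?thesis by eventually_elim (use bd' in auto)
  qed
  ultimately have "((\<lambda>t. prim g t - prim g s) \<longlongrightarrow> 0) (at s)"
    by (rule Lim_null_comparison[rotated])
  then show "isCont (prim g) s" by (simp add: isCont_def LIM_zero_iff)
qed

text \<open>Each test profile vanishes near 0, so there s^(-\<gamma>) |prim g| is bounded by the
  error of that test profile, and the error can be made arbitrarily small.\<close>

lemma prim_scaled_limit: "((\<lambda>s. s powr (- \<gamma>) * prim g s) \<longlongrightarrow> 0) (at_right 0)"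
proof (rule tendstoI)
  fix \<epsilon> :: real assume \<epsilon>: "\<epsilon> > 0"
  have "eventually (\<lambda>j. err j powr (1 / p) < \<epsilon>) sequentially"
    using err_root_limit \<epsilon> by (rule order_tendstoD)
  then obtain j where j: "err j powr (1 / p) < \<epsilon>" by (auto dest: eventually_happens)
  obtain a b where ab: "0 < a" "\<And>s. s \<notin> {a..b} \<Longrightarrow> \<psi> j s = 0"
    using energy_limit_cc1[of j] by (auto simp: cc1_def)
  have "dist (s powr (- \<gamma>) * prim g s) 0 < \<epsilon>" if "0 < s" "s < a" for s
  proof -
    have "\<psi> j s = 0" using ab(2) that by auto
    then have "\<bar>prim g s\<bar> \<le> s powr \<gamma> * err j powr (1 / p)" using prim_err[of s j] that by simp
    then have "s powr (- \<gamma>) * \<bar>prim g s\<bar> \<le> s powr (- \<gamma>) * (s powr \<gamma> * err j powr (1 / p))"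
      by (intro mult_left_mono) auto
    also have "\<dots> = err j powr (1 / p)" using that by (simp flip: powr_add mult.assoc)
    finally show ?thesis using j by (simp add: abs_mult)
  qed
  then show "eventually (\<lambda>s. dist (s powr (- \<gamma>) * prim g s) 0 < \<epsilon>) (at_right 0)"
    using ab(1) by (auto simp: eventually_at_right_field)
qed

text \<open>The inequality for test profiles is solved for the potential, because Fatou's lemma
  bounds that side. The energies of the test profiles are compared with the limit energy by
  \<open>powr_add_le\<close> at a fixed t; only after the limit in j does t tend to 0, which
  restores the sharp constant.\<close>

lemma bliss_limit:
  shows "integrable lborel (\<lambda>s. wt s * prim g s powr q)"
    and "A0 * ((LINT s|lborel. wt s * prim g s powr q) / B0) powr (p / q) \<le> (LINT s|lborel. g s powr p)"
proof -
  define A where "A = (LINT s|lborel. g s powr p)"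
  have A: "A \<ge> 0" by (auto simp: A_def)
  define Aj where "Aj j = (LINT s|lborel. \<psi>' j s powr p)" for j
  define Bj where "Bj j = (LINT s|lborel. wt s * \<psi> j s powr q)" for j
  have Bj: "Bj j \<ge> 0" for j by (auto simp: Bj_def)
  have A0: "A0 > 0" unfolding A0_eq using B0_pos \<gamma>_pos p q by simp
  have BjA: "Bj j \<le> B0 * (Aj j / A0) powr (q / p)" for j
  proof -
    have "(Bj j / B0) powr (p / q) \<le> Aj j / A0"
      using bliss_cc1[OF energy_limit_cc1, of j] A0 by (simp add: Bj_def Aj_def field_simps)
    then have "((Bj j / B0) powr (p / q)) powr (q / p) \<le> (Aj j / A0) powr (q / p)"
      using p q by (intro powr_mono2) auto
    then have "Bj j / B0 \<le> (Aj j / A0) powr (q / p)" using p q Bj[of j] B0_pos by (simp add: powr_powr)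
    then show ?thesis using B0_pos by (simp add: field_simps)
  qed
  define T where "T t = B0 * ((1 - t) powr (1 - p) * A / A0) powr (q / p)" for t
  have nnB: "(\<integral>\<^sup>+ s. ennreal (wt s * prim g s powr q) \<partial>lborel) \<le> ennreal (T t)" if t: "0 < t" "t < 1" for t
  proof -
    have AjE: "Aj j \<le> (1 - t) powr (1 - p) * A + t powr (1 - p) * err j" for j
    proof -
      have "Aj j \<le> (LINT s|lborel. (1 - t) powr (1 - p) * g s powr p + t powr (1 - p) * (\<psi>' j s - g s) powr p)"
        unfolding Aj_def
      proof (rule integral_mono)
        show "\<psi>' j s powr p \<le> (1 - t) powr (1 - p) * g s powr p + t powr (1 - p) * (\<psi>' j s - g s) powr p" for s
          using powr_add_le[OF p t, of "g s" "\<psi>' j s - g s"] by simp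
      qed (use cc1_integrable_energy[OF energy_limit_cc1] energy_limit_integrable energy_limit_integrable_diff in auto)
      also have "\<dots> = (1 - t) powr (1 - p) * A + t powr (1 - p) * err j"
        unfolding A_def err_def using energy_limit_integrable energy_limit_integrable_diff by simp
      finally show ?thesis .
    qed
    define U where "U j = B0 * (((1 - t) powr (1 - p) * A + t powr (1 - p) * err j) / A0) powr (q / p)" for j
    have BU: "Bj j \<le> U j" for j
    proof -
      have "Aj j \<ge> 0" by (auto simp: Aj_def)
      then have "(Aj j / A0) powr (q / p) \<le> (((1 - t) powr (1 - p) * A + t powr (1 - p) * err j) / A0) powr (q / p)"
        using p q A0 AjE[of j] by (intro powr_mono2 divide_right_mono) auto
      then show ?thesis using BjA[of j] B0_pos unfolding U_def
        by (meson mult_left_mono less_imp_le order.trans)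
    qed
    have "U \<longlonglongrightarrow> B0 * (((1 - t) powr (1 - p) * A + t powr (1 - p) * 0) / A0) powr (q / p)"
      unfolding U_def using p q A0
      by (intro tendsto_mult tendsto_const isCont_tendsto_compose[OF isCont_abs_powr] tendsto_divide tendsto_add err_limit) auto
    then have U: "U \<longlonglongrightarrow> T t" by (simp add: T_def)
    have "(\<integral>\<^sup>+ s. ennreal (wt s * prim g s powr q) \<partial>lborel)
       = (\<integral>\<^sup>+ s. liminf (\<lambda>j. ennreal (wt s * \<psi> j s powr q)) \<partial>lborel)"
    proof (rule nn_integral_cong)
      fix s
      have "(\<lambda>j. ennreal (wt s * \<psi> j s powr q)) \<longlonglongrightarrow> ennreal (wt s * prim g s powr q)"
        using p q by (intro tendsto_ennrealI tendsto_mult tendsto_const isCont_tendsto_compose[OF isCont_abs_powr] prim_limit) auto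
      then show "ennreal (wt s * prim g s powr q) = liminf (\<lambda>j. ennreal (wt s * \<psi> j s powr q))"
        by (rule lim_imp_Liminf[OF sequentially_bot, symmetric])
    qed
    also have "\<dots> \<le> liminf (\<lambda>j. \<integral>\<^sup>+ s. ennreal (wt s * \<psi> j s powr q) \<partial>lborel)"
      by (rule nn_integral_liminf) measurable
    also have "\<dots> = liminf (\<lambda>j. ennreal (Bj j))"
      unfolding Bj_def using cc1_integrable_potential[OF energy_limit_cc1]
      by (subst nn_integral_eq_integral) auto
    also have "\<dots> \<le> liminf (\<lambda>j. ennreal (U j))"
      by (rule Liminf_mono) (use BU in \<open>auto intro!: always_eventually ennreal_leI\<close>)
    also have "\<dots> = ennreal (T t)"
      by (rule lim_imp_Liminf) (auto intro: tendsto_ennrealI U)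
    finally show ?thesis .
  qed
  have "(\<integral>\<^sup>+ s. ennreal (wt s * prim g s powr q) \<partial>lborel) < \<infinity>"
    using le_less_trans[OF nnB[of "1/2"]] by simp
  then show I: "integrable lborel (\<lambda>s. wt s * prim g s powr q)"
    by (intro integrableI_nonneg) auto
  define B where "B = (LINT s|lborel. wt s * prim g s powr q)"
  have B: "B \<ge> 0" by (auto simp: B_def)
  have BT: "B \<le> T t" if "0 < t" "t < 1" for t
  proof -
    have "T t \<ge> 0" using B0_pos by (simp add: T_def)
    then show ?thesis
      using nnB[OF that] unfolding B_def by (subst (asm) nn_integral_eq_integral[OF I]) auto
  qed
  have "(T \<longlongrightarrow> B0 * ((1 - 0) powr (1 - p) * A / A0) powr (q / p)) (at_right 0)"
    unfolding T_def[abs_def] using p q A0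
    by (intro tendsto_mult tendsto_const isCont_tendsto_compose[OF isCont_abs_powr] tendsto_divide tendsto_powr
        tendsto_diff tendsto_ident_at) auto
  then have "B \<le> B0 * ((1 - 0) powr (1 - p) * A / A0) powr (q / p)"
  proof (rule tendsto_lowerbound)
    show "eventually (\<lambda>t. B \<le> T t) (at_right 0)"
      using BT by (auto simp: eventually_at_right_field intro!: exI[of _ 1])
  qed simp
  then have "B / B0 \<le> (A / A0) powr (q / p)" using B0_pos by (simp add: field_simps)
  then have "(B / B0) powr (p / q) \<le> ((A / A0) powr (q / p)) powr (p / q)"
    using p q B B0_pos by (intro powr_mono2) auto
  also have "\<dots> = A / A0" using p q A A0 by (simp add: powr_powr)
  finally show "A0 * (B / B0) powr (p / q) \<le> A" using A0 by (simp add: field_simps)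
qed

end

end

section \<open>The lemma of du Bois-Reymond\<close>

lemma mollifier_exists:
  fixes a b :: real
  assumes "0 < a" "a < b"
  obtains \<eta> :: "real \<Rightarrow> real" where "continuous_on UNIV \<eta>" "\<And>s. s \<notin> {a..b} \<Longrightarrow> \<eta> s = 0" "(LINT s|lborel. \<eta> s) = (1::real)" "integrable lborel \<eta>"
proof -
  define \<tau> where "\<tau> s = max 0 ((s - a) * (b - s))" for s
  have ct: "continuous_on S \<tau>" for S unfolding \<tau>_def[abs_def] by (intro continuous_intros)
  have z: "\<tau> s = 0" if "s \<notin> {a..b}" for s
    using that assms by (auto simp: \<tau>_def max_def mult_le_0_iff not_le zero_le_mult_iff)
  have ind: "indicator {a..b} s *\<^sub>R \<tau> s = \<tau> s" for s using z[of s] by (cases "s \<in> {a..b}") auto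
  have I: "integrable lborel \<tau>"
    using borel_integrable_atLeastAtMost'[OF ct, of a b] by (simp only: set_integrable_def ind)
  have "(LINT s|lborel. \<tau> s) \<noteq> 0"
  proof
    assume "(LINT s|lborel. \<tau> s) = 0"
    then have "AE s in lborel. \<tau> s = 0"
      by (subst (asm) integral_nonneg_eq_0_iff_AE[OF I]) (auto simp: \<tau>_def)
    then have "AE s in lborel. s \<notin> {a<..<b}"
      by eventually_elim (auto simp: \<tau>_def max_def mult_le_0_iff split: if_splits)
    then have "{s \<in> space lborel. \<not> s \<notin> {a<..<b}} \<in> null_sets lborel"
      by (subst AE_iff_null[symmetric]) auto
    moreover have "{s \<in> space lborel. \<not> s \<notin> {a<..<b}} = {a<..<b}" by auto
    ultimately have "{a<..<b} \<in> null_sets lborel" by simp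
    then show False using assms by (auto simp: null_sets_def)
  qed
  then show ?thesis
    using ct z I by (intro that[of "\<lambda>s. \<tau> s / (LINT s|lborel. \<tau> s)"]) (auto intro!: continuous_intros)
qed

context bliss begin

declare energy_limit_measurable [measurable del] prim_measurable [measurable del]

text \<open>The vanishing mean makes the primitive return to 0 to the right of the support, so it is
  a test profile.\<close>

lemma cc1_of_mean_zero:
  assumes cont: "continuous_on UNIV \<eta>" and ab: "0 < a" "a < b" and z: "\<And>s. s \<notin> {a..b} \<Longrightarrow> \<eta> s = 0"
    and mean: "(LINT s|lborel. \<eta> s) = 0"
  shows "cc1 (prim \<eta>) \<eta>"
proof -
  have contS: "continuous_on S \<eta>" for S using cont continuous_on_subset by blast
  have prim_eq: "prim \<eta> s = integral {0..s} \<eta>" for s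
    unfolding prim_def using borel_integrable_atLeastAtMost'[OF contS]
    by (rule set_borel_integral_eq_integral(2))
  have low: "prim \<eta> s = 0" if "s < a" for s
    unfolding prim_def set_lebesgue_integral_def
    using that z by (intro integral_eq_zero_AE AE_I2) (auto simp: indicator_def)
  have high: "prim \<eta> s = 0" if "s > b" for s
  proof -
    have "indicator {0..s} t *\<^sub>R \<eta> t = \<eta> t" for t using z[of t] ab that by (cases "t \<in> {a..b}") auto
    then show ?thesis using mean unfolding prim_def set_lebesgue_integral_def by presburger
  qed
  have D: "(prim \<eta> has_real_derivative \<eta> s) (at s)" for s
  proof (cases "s > 0")
    case True
    have "((\<lambda>x. integral {0..x} \<eta>) has_vector_derivative \<eta> s) (at s within {0..s + 1})"
      using True by (intro integral_has_vector_derivative contS) auto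
    then have "((\<lambda>x. integral {0..x} \<eta>) has_vector_derivative \<eta> s) (at s within {0<..<s + 1})"
      by (rule has_vector_derivative_within_subset) auto
    moreover have "s \<in> {0<..<s + 1}" using True by simp
    ultimately show ?thesis
      unfolding has_real_derivative_iff_has_vector_derivative prim_eq
      using has_vector_derivative_within_open[OF _ open_greaterThanLessThan] by blast
  next
    case False
    have "((\<lambda>_. 0) has_real_derivative 0) (at s)" by simp
    then have "(prim \<eta> has_real_derivative 0) (at s)"
      by (rule has_field_derivative_transform_within_open[of _ _ _ "{..<a}"]) (use False ab low in auto)
    moreover have "\<eta> s = 0" using False ab z by auto
    ultimately show ?thesis by simp
  qed
  have "0 < a / 2 \<and> a / 2 < b + 1 \<and> (\<forall>s. s \<notin> {a / 2..b + 1} \<longrightarrow> prim \<eta> s = 0 \<and> \<eta> s = 0)"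
    using ab low high z by (auto simp: not_le)
  then show ?thesis unfolding cc1_def using D cont by blast
qed

text \<open>A continuous \<eta> of compact support becomes the derivative of a test profile when its
  integral times a fixed \<eta>0 of integral 1 is subtracted. Hence the integral of H \<eta> is m
  times that of \<eta>, with m the integral of H \<eta>0. Continuous approximations of indicators
  carry this over to intervals, where H - m therefore has integral 0.\<close>

lemma du_Bois_Reymond:
  assumes [measurable]: "H \<in> borel_measurable borel"
    and int: "\<And>a b. 0 < a \<Longrightarrow> a < b \<Longrightarrow> set_integrable lborel {a..b} H"
    and orth: "\<And>\<psi> \<psi>'. cc1 \<psi> \<psi>' \<Longrightarrow> (LINT s|lborel. H s * \<psi>' s) = 0"
  obtains m where "AE s in lborel. 0 < s \<longrightarrow> H s = m"
proof -
  have intH: "integrable lborel (\<lambda>s. H s * \<eta> s)"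
    if cont: "continuous_on UNIV \<eta>" and ab: "0 < a" "a < b" and z: "\<And>s. s \<notin> {a..b} \<Longrightarrow> \<eta> s = 0" for \<eta> :: "real \<Rightarrow> real" and a b
  proof -
    have "compact (\<eta> ` {a..b})"
      by (rule compact_continuous_image[OF continuous_on_subset[OF cont]]) auto
    then have "bounded (\<eta> ` {a..b})" by (rule compact_imp_bounded)
    then obtain C where C: "\<And>s. s \<in> {a..b} \<Longrightarrow> \<bar>\<eta> s\<bar> \<le> C"
      unfolding bounded_real by blast
    have [measurable]: "\<eta> \<in> borel_measurable borel" by (rule borel_measurable_continuous_onI[OF cont])
    have "integrable lborel (\<lambda>s. C * (indicator {a..b} s *\<^sub>R H s))"
      using int[OF ab] by (simp add: set_integrable_def)
    then show ?thesis
    proof (rule Bochner_Integration.integrable_bound)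
      show "AE s in lborel. norm (H s * \<eta> s) \<le> norm (C * (indicator {a..b} s *\<^sub>R H s))"
      proof (rule AE_I2)
        fix s
        show "norm (H s * \<eta> s) \<le> norm (C * (indicator {a..b} s *\<^sub>R H s))"
        proof (cases "s \<in> {a..b}")
          case True
          have "\<bar>\<eta> s\<bar> \<le> \<bar>C\<bar>" using C[OF True] by linarith
          then have "\<bar>H s\<bar> * \<bar>\<eta> s\<bar> \<le> \<bar>H s\<bar> * \<bar>C\<bar>" by (rule mult_left_mono) simp
          then show ?thesis using True by (simp add: abs_mult mult.commute)
        qed (simp add: z)
      qed
    qed measurable
  qed
  obtain \<eta>0 :: "real \<Rightarrow> real" where \<eta>0: "continuous_on UNIV \<eta>0" "\<And>s. s \<notin> {1..2} \<Longrightarrow> \<eta>0 s = 0" "(LINT s|lborel. \<eta>0 s) = (1::real)" "integrable lborel \<eta>0"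
    using mollifier_exists[of 1 2] by auto
  define m where "m = (LINT s|lborel. H s * \<eta>0 s)"
  have key: "(LINT s|lborel. H s * \<eta> s) = (LINT s|lborel. \<eta> s) * m"
    if cont: "continuous_on UNIV \<eta>" and ab: "0 < a" "a < b" and z: "\<And>s. s \<notin> {a..b} \<Longrightarrow> \<eta> s = 0" for \<eta> a b
  proof -
    have ind: "(\<lambda>s. indicator {a..b} s *\<^sub>R \<eta> s) = \<eta>"
    proof (rule ext)
      fix s show "indicator {a..b} s *\<^sub>R \<eta> s = \<eta> s" using z[of s] by (cases "s \<in> {a..b}") auto
    qed
    have "set_integrable lborel {a..b} \<eta>"
      by (rule borel_integrable_atLeastAtMost'[OF continuous_on_subset[OF cont]]) simp
    then have I: "integrable lborel \<eta>" by (simp only: set_integrable_def ind)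
    define c where "c = (LINT s|lborel. \<eta> s)"
    have "cc1 (prim (\<lambda>s. \<eta> s - c * \<eta>0 s)) (\<lambda>s. \<eta> s - c * \<eta>0 s)"
    proof (rule cc1_of_mean_zero)
      show "continuous_on UNIV (\<lambda>s. \<eta> s - c * \<eta>0 s)" by (intro continuous_intros cont \<eta>0)
      show "0 < min a 1" "min a 1 < max b 2" using ab by auto
      show "(LINT s|lborel. \<eta> s - c * \<eta>0 s) = 0" using I \<eta>0 by (simp add: c_def)
      show "\<eta> s - c * \<eta>0 s = 0" if "s \<notin> {min a 1..max b 2}" for s
      proof -
        have "s \<notin> {a..b}" "s \<notin> {1..2}" using that by auto
        then show ?thesis using z[of s] \<eta>0(2)[of s] by simp
      qed
    qed
    then have "(LINT s|lborel. H s * (\<eta> s - c * \<eta>0 s)) = 0" by (rule orth)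
    moreover have "(LINT s|lborel. H s * (\<eta> s - c * \<eta>0 s)) = (LINT s|lborel. H s * \<eta> s) - c * m"
    proof -
      have "(LINT s|lborel. H s * (\<eta> s - c * \<eta>0 s)) = (LINT s|lborel. H s * \<eta> s - c * (H s * \<eta>0 s))"
        by (rule Bochner_Integration.integral_cong) (auto simp: algebra_simps)
      also have "\<dots> = (LINT s|lborel. H s * \<eta> s) - c * m"
        using intH[OF cont ab z] intH[of \<eta>0 1 2, OF \<eta>0(1) _ _ \<eta>0(2)] by (simp add: m_def)
      finally show ?thesis .
    qed
    ultimately show ?thesis by (simp add: c_def)
  qed
  have zero: "(LINT s:{a..b}|lborel. H s - m) = 0" if ab: "0 < a" "a < b" for a b
  proof -
    \<comment> \<open>A continuous function equal to 1 on {a..b}. Its slopes are at least 2 / a,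
      which keeps its support inside {a / 2..b + a} for every j, away from 0.\<close>
    define \<omega> where "\<omega> j s = max 0 (1 - (real j + 2 / a) * max 0 (max (a - s) (s - b)))" for j :: nat and s
    have cont: "continuous_on UNIV (\<omega> j)" for j unfolding \<omega>_def[abs_def] by (intro continuous_intros)
    have [measurable]: "\<omega> j \<in> borel_measurable borel" for j by (rule borel_measurable_continuous_onI[OF cont])
    have z: "\<omega> j s = 0" if s: "s \<notin> {a / 2..b + a}" for j s
    proof -
      have "a / 2 \<le> max 0 (max (a - s) (s - b))" using s ab by auto
      then have "(2 / a) * (a / 2) \<le> (real j + 2 / a) * max 0 (max (a - s) (s - b))"
        using ab by (intro mult_mono) auto
      then show ?thesis using ab by (simp add: \<omega>_def)
    qed
    have b01: "0 \<le> \<omega> j s" "\<omega> j s \<le> 1" for j s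
      using ab by (auto simp: \<omega>_def)
    have lim: "(\<lambda>j. \<omega> j s) \<longlonglongrightarrow> indicator {a..b} s" for s
    proof (cases "s \<in> {a..b}")
      case True
      then have "max 0 (max (a - s) (s - b)) = 0" by auto
      then show ?thesis using True by (simp add: \<omega>_def)
    next
      case False
      define d where "d = max 0 (max (a - s) (s - b))"
      have d: "d > 0" using False by (auto simp: d_def)
      obtain N :: nat where N: "1 / d < real N" using reals_Archimedean2 by blast
      have "\<omega> j s = 0" if "j \<ge> N" for j
      proof -
        have "1 / d * d \<le> (real j + 2 / a) * d" using N that d ab by (intro mult_right_mono) (auto intro: add_increasing2)
        then have "1 - (real j + 2 / a) * d \<le> 0" using d by simp
        then show ?thesis unfolding \<omega>_def d_def[symmetric] by simp
      qed
      then have "eventually (\<lambda>j. \<omega> j s = 0) sequentially" by (auto simp: eventually_sequentially)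
      then have "(\<lambda>j. \<omega> j s) \<longlonglongrightarrow> 0" by (rule tendsto_eventually)
      then show ?thesis using False by simp
    qed
    have ab2: "0 < a / 2" "a / 2 < b + a" using ab by auto
    have dom: "integrable lborel (\<lambda>s. \<bar>indicator {a / 2..b + a} s *\<^sub>R H s\<bar>)"
      using int[OF ab2] by (simp add: set_integrable_def)
    have a1: "(\<lambda>j. LINT s|lborel. H s * \<omega> j s) \<longlonglongrightarrow> (LINT s|lborel. H s * indicator {a..b} s)"
    proof (rule integral_dominated_convergence[where w = "\<lambda>s. \<bar>indicator {a / 2..b + a} s *\<^sub>R H s\<bar>", OF _ _ dom])
      show "AE s in lborel. (\<lambda>j. H s * \<omega> j s) \<longlonglongrightarrow> H s * indicator {a..b} s"
        by (intro AE_I2 tendsto_mult tendsto_const lim)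
      show "AE s in lborel. norm (H s * \<omega> j s) \<le> \<bar>indicator {a / 2..b + a} s *\<^sub>R H s\<bar>" for j
      proof (rule AE_I2)
        fix s
        show "norm (H s * \<omega> j s) \<le> \<bar>indicator {a / 2..b + a} s *\<^sub>R H s\<bar>"
          using z[of s j] b01[of j s] by (cases "s \<in> {a / 2..b + a}") (auto simp: abs_mult mult_left_le)
      qed
    qed measurable
    have l: "(\<lambda>j. LINT s|lborel. \<omega> j s) \<longlonglongrightarrow> (LINT s|lborel. indicator {a..b} s)"
    proof (rule integral_dominated_convergence[where w = "indicator {a / 2..b + a}"])
      show "AE s in lborel. norm (\<omega> j s) \<le> (indicator {a / 2..b + a} s :: real)" for j
      proof (rule AE_I2)
        fix s show "norm (\<omega> j s) \<le> (indicator {a / 2..b + a} s :: real)"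
          using z[of s j] b01[of j s] by (cases "s \<in> {a / 2..b + a}") auto
      qed
    qed (use ab2 lim in auto)
    have a2: "(\<lambda>j. (LINT s|lborel. \<omega> j s) * m) \<longlonglongrightarrow> (b - a) * m"
    proof -
      have "(LINT s|lborel. indicator {a..b} s) = b - a" using ab by simp
      then show ?thesis using tendsto_mult[OF l tendsto_const, of m] by (simp only:)
    qed
    have a3: "(LINT s|lborel. H s * \<omega> j s) = (LINT s|lborel. \<omega> j s) * m" for j
      by (rule key[OF cont ab2 z])
    have "(LINT s|lborel. H s * indicator {a..b} s) = (b - a) * m"
      by (rule LIMSEQ_unique[OF a1 a2[folded a3]])
    moreover have "(LINT s:{a..b}|lborel. H s - m) = (LINT s:{a..b}|lborel. H s) - (LINT s:{a..b}|lborel. m)"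
      using int[OF ab] borel_integrable_atLeastAtMost'[OF continuous_on_const] by (rule set_integral_diff(2))
    moreover have "(LINT s:{a..b}|lborel. m) = (b - a) * m" using ab by (simp add: set_lebesgue_integral_def)
    ultimately show ?thesis using ab by (simp add: set_lebesgue_integral_def mult.commute)
  qed
  have "AE s in lborel. 0 < s \<longrightarrow> H s - m = 0"
  proof (rule AE_eq_0_of_integral_Icc_eq_0[OF _ _ zero])
    fix a b :: real assume ab: "0 < a" "a < b"
    show "set_integrable lborel {a..b} (\<lambda>s. H s - m)"
      using int[OF ab] borel_integrable_atLeastAtMost'[OF continuous_on_const] by (rule set_integral_diff(1))
  qed auto
  then show ?thesis by (intro that[of m]) auto
qed

section \<open>The weak equation of the extremal\<close>

lemma cc1_by_parts:
  assumes cc: "cc1 \<psi> \<psi>'" and D: "\<And>s. s > 0 \<Longrightarrow> (K has_real_derivative R s) (at s)" and cont: "continuous_on {0<..} R"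
  shows "integrable lborel (\<lambda>s. K s * \<psi>' s)" "integrable lborel (\<lambda>s. R s * \<psi> s)"
    "(LINT s|lborel. K s * \<psi>' s) = - (LINT s|lborel. R s * \<psi> s)"
proof -
  have contK: "continuous_on S K" if "S \<subseteq> {0<..}" for S
    using D that by (intro continuous_at_imp_continuous_on) (auto intro: DERIV_isCont)
  have contR: "continuous_on S R" if "S \<subseteq> {0<..}" for S by (rule continuous_on_subset[OF cont that])
  show I1: "integrable lborel (\<lambda>s. K s * \<psi>' s)"
    by (rule cc1_integrable[OF cc]) (auto intro!: continuous_intros contK cc1_cont[OF cc])
  show I2: "integrable lborel (\<lambda>s. R s * \<psi> s)"
    by (rule cc1_integrable[OF cc]) (auto intro!: continuous_intros contR cc1_cont[OF cc])
  obtain a0 b0 where ab0: "0 < a0" "a0 < b0" "\<And>s. s \<notin> {a0..b0} \<Longrightarrow> \<psi> s = 0 \<and> \<psi>' s = 0"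
    using cc by (auto simp: cc1_def)
  define a where "a = a0 / 2"
  define b where "b = b0 + 1"
  have ab: "0 < a" "a < b" "\<psi> a = 0" "\<psi> b = 0" "\<And>s. s \<notin> {a..b} \<Longrightarrow> \<psi> s = 0 \<and> \<psi>' s = 0"
    using ab0 by (auto simp: a_def b_def)
  define f where "f s = R s * \<psi> s + \<psi>' s * K s" for s
  have "(LBINT s. indicator {a..b} s *\<^sub>R f s) = K b * \<psi> b - K a * \<psi> a"
  proof (rule integral_FTC_atLeastAtMost)
    show "continuous_on {a..b} f"
      unfolding f_def[abs_def] using ab by (intro continuous_intros contK contR cc1_cont[OF cc]) auto
    show "((\<lambda>s. K s * \<psi> s) has_vector_derivative f s) (at s within {a..b})" if "a \<le> s" "s \<le> b" for s
    proof -
      have "s > 0" "(\<psi> has_real_derivative \<psi>' s) (at s)" using that ab cc by (auto simp: cc1_def)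
      from DERIV_mult[OF D[OF this(1)] this(2)]
      have "((\<lambda>s. K s * \<psi> s) has_real_derivative f s) (at s)" by (simp add: f_def)
      then show ?thesis
        by (metis has_real_derivative_iff_has_vector_derivative has_vector_derivative_at_within)
    qed
  qed (use ab in simp)
  moreover have "(\<lambda>s. indicator {a..b} s *\<^sub>R f s) = f"
  proof (rule ext)
    fix s show "indicator {a..b} s *\<^sub>R f s = f s"
      using ab(5)[of s] by (cases "s \<in> {a..b}") (auto simp: f_def)
  qed
  ultimately have "(LBINT s. f s) = K b * \<psi> b - K a * \<psi> a" by (simp only:)
  then have "(LBINT s. f s) = 0" using ab by simp
  moreover have "(LBINT s. f s) = (LINT s|lborel. K s * \<psi>' s) + (LINT s|lborel. R s * \<psi> s)"
    unfolding f_def using I1 I2 by (simp add: mult.commute)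
  ultimately show "(LINT s|lborel. K s * \<psi>' s) = - (LINT s|lborel. R s * \<psi> s)" by simp
qed

lemma extremal_weak_cc1:
  assumes cc: "cc1 \<psi> \<psi>'"
  shows "integrable lborel (\<lambda>s. G s powr (p - 1) * \<psi>' s)"
    "integrable lborel (\<lambda>s. wt s * V s powr (q - 1) * \<psi> s)"
    "(LINT s|lborel. G s powr (p - 1) * \<psi>' s) = q * \<gamma> * (LINT s|lborel. wt s * V s powr (q - 1) * \<psi> s)"
proof -
  have "continuous_on {0<..} (J a c)" for a c
    using isCont_J by (intro continuous_at_imp_continuous_on) auto
  then have "continuous_on {0<..} (\<lambda>s. - (q * \<gamma> * (wt s * V s powr (q - 1))))"
    unfolding V_powr by (intro continuous_intros)
  note bp = cc1_by_parts[OF cc DERIV_G_powr this]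
  have eq: "(\<lambda>s. - (q * \<gamma> * (wt s * V s powr (q - 1))) * \<psi> s)
      = (\<lambda>s. - (q * \<gamma>) * (wt s * V s powr (q - 1) * \<psi> s))"
    by (rule ext) simp
  have nz: "- (q * \<gamma>) \<noteq> 0" using \<gamma>_pos p q by simp
  have "integrable lborel (\<lambda>s. - (q * \<gamma>) * (wt s * V s powr (q - 1) * \<psi> s))"
    using bp(2) unfolding eq .
  with nz show "integrable lborel (\<lambda>s. wt s * V s powr (q - 1) * \<psi> s)"
    by (simp only: integrable_mult_left_iff integrable_mult_right_iff simp_thms)
  show "integrable lborel (\<lambda>s. G s powr (p - 1) * \<psi>' s)" by (rule bp(1))
  show "(LINT s|lborel. G s powr (p - 1) * \<psi>' s) = q * \<gamma> * (LINT s|lborel. wt s * V s powr (q - 1) * \<psi> s)"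
    using bp(3) unfolding eq by simp
qed

text \<open>Extension from test profiles by density. The left side converges by Hoelder's
  inequality, the right side by the pointwise error s^\<gamma> e j, against which the weight is
  integrable.\<close>

lemma extremal_weak:
  assumes lim: "energy_limit \<psi> \<psi>' g"
  shows "integrable lborel (\<lambda>s. G s powr (p - 1) * g s)"
    "integrable lborel (\<lambda>s. wt s * V s powr (q - 1) * prim g s)"
    "(LINT s|lborel. G s powr (p - 1) * g s) = q * \<gamma> * (LINT s|lborel. wt s * V s powr (q - 1) * prim g s)"
proof -
  note [measurable] = energy_limit_measurable[OF lim] prim_measurable[OF lim]
  define p' where "p' = p / (p - 1)"
  have p': "p' > 1" "1 / p' + 1 / p = 1" "(p - 1) * p' = p" using p by (auto simp: p'_def field_simps)
  have IG: "integrable lborel (\<lambda>s. (G s powr (p - 1)) powr p')"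
    using integrable_G_powr by (simp add: powr_powr p'(3))
  define e where "e j = err \<psi>' g j powr (1 / p)" for j
  have e: "e \<longlonglongrightarrow> 0" unfolding e_def by (rule err_root_limit[OF lim])
  define C1 where "C1 = (LINT s|lborel. (G s powr (p - 1)) powr p') powr (1 / p')"
  show I1: "integrable lborel (\<lambda>s. G s powr (p - 1) * g s)"
    by (rule Holder_inequality_integral(1)[OF _ _ p'(1) p p'(2) IG energy_limit_integrable[OF lim]]) measurable
  have cc: "cc1 (\<psi> j) (\<psi>' j)" for j by (rule energy_limit_cc1[OF lim])
  have l1: "(\<lambda>j. LINT s|lborel. G s powr (p - 1) * \<psi>' j s) \<longlonglongrightarrow> (LINT s|lborel. G s powr (p - 1) * g s)"
  proof -
    have bd: "norm ((LINT s|lborel. G s powr (p - 1) * \<psi>' j s) - (LINT s|lborel. G s powr (p - 1) * g s)) \<le> C1 * e j" for j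
    proof -
      have "(LINT s|lborel. G s powr (p - 1) * \<psi>' j s) - (LINT s|lborel. G s powr (p - 1) * g s)
        = (LINT s|lborel. G s powr (p - 1) * (\<psi>' j s - g s))"
        using extremal_weak_cc1(1)[OF cc] I1 by (simp add: right_diff_distrib)
      also have "\<bar>\<dots>\<bar> \<le> (LINT s|lborel. \<bar>G s powr (p - 1) * (\<psi>' j s - g s)\<bar>)" by (rule integral_abs_bound)
      also have "\<dots> \<le> C1 * e j"
        using Holder_inequality_integral(2)[OF _ _ p'(1) p p'(2) IG energy_limit_integrable_diff[OF lim], of j]
        by (simp add: C1_def e_def err_def[OF lim])
      finally show ?thesis by simp
    qed
    have l: "(\<lambda>j. C1 * e j) \<longlonglongrightarrow> 0" using tendsto_mult[OF tendsto_const e, of C1] by simp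
    have "(\<lambda>j. (LINT s|lborel. G s powr (p - 1) * \<psi>' j s) - (LINT s|lborel. G s powr (p - 1) * g s)) \<longlonglongrightarrow> 0"
      by (rule Lim_null_comparison[OF _ l]) (use bd in \<open>auto intro!: always_eventually\<close>)
    then show ?thesis by (simp add: LIM_zero_iff)
  qed
  define W where "W s = wt s * V s powr (q - 1)" for s
  have W0: "W s \<ge> 0" "s \<le> 0 \<Longrightarrow> W s = 0" for s by (auto simp: W_def V_def)
  have [measurable]: "W \<in> borel_measurable borel" unfolding W_def[abs_def] by measurable
  have Wg: "s powr \<gamma> * W s = s powr (\<gamma> - 1 - q * \<gamma>) * V s powr (q - 1)" for s
  proof -
    have e: "\<gamma> + (- 1 - q * \<gamma>) = \<gamma> - 1 - q * \<gamma>" by simp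
    show ?thesis unfolding W_def mult.assoc[symmetric] powr_add[symmetric] e ..
  qed
  have IW: "integrable lborel (\<lambda>s. s powr \<gamma> * W s)" unfolding Wg by (rule integrable_V_test)
  have diff: "\<bar>W s * (\<psi> j s - prim g s)\<bar> \<le> e j * (s powr \<gamma> * W s)" for j s
  proof (cases "s \<ge> 0")
    case True
    have "W s * \<bar>\<psi> j s - prim g s\<bar> \<le> W s * (s powr \<gamma> * e j)"
      unfolding e_def by (intro mult_left_mono prim_err[OF lim True] W0)
    then show ?thesis using W0(1)[of s] by (simp add: abs_mult mult_ac)
  qed (use W0(2)[of s] in simp)
  have I2d: "integrable lborel (\<lambda>s. W s * (\<psi> j s - prim g s))" for j
    by (rule Bochner_Integration.integrable_bound[of _ "\<lambda>s. e j * (s powr \<gamma> * W s)"])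
       (use IW diff in \<open>auto intro!: AE_I2 order.trans[OF diff]\<close>)
  have I2j: "integrable lborel (\<lambda>s. W s * \<psi> j s)" for j
    using extremal_weak_cc1(2)[OF cc] by (simp add: W_def)
  \<comment> \<open>Integrability for \<open>prim g\<close> is obtained from that for one test
    profile and for the difference, which the pointwise error controls.\<close>
  have "integrable lborel (\<lambda>s. W s * \<psi> 0 s - W s * (\<psi> 0 s - prim g s))"
    by (intro Bochner_Integration.integrable_diff I2d I2j)
  then have I2: "integrable lborel (\<lambda>s. W s * prim g s)" by (simp add: right_diff_distrib)
  then show "integrable lborel (\<lambda>s. wt s * V s powr (q - 1) * prim g s)" by (simp add: W_def)
  define C2 where "C2 = (LINT s|lborel. s powr \<gamma> * W s)"
  have l2: "(\<lambda>j. LINT s|lborel. W s * \<psi> j s) \<longlonglongrightarrow> (LINT s|lborel. W s * prim g s)"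
  proof -
    have bd: "norm ((LINT s|lborel. W s * \<psi> j s) - (LINT s|lborel. W s * prim g s)) \<le> e j * C2" for j
    proof -
      have "(LINT s|lborel. W s * \<psi> j s) - (LINT s|lborel. W s * prim g s) = (LINT s|lborel. W s * (\<psi> j s - prim g s))"
        using I2j I2 by (simp add: right_diff_distrib)
      also have "\<bar>\<dots>\<bar> \<le> (LINT s|lborel. \<bar>W s * (\<psi> j s - prim g s)\<bar>)" by (rule integral_abs_bound)
      also have "\<dots> \<le> (LINT s|lborel. e j * (s powr \<gamma> * W s))"
        using I2d IW diff by (intro integral_mono) auto
      also have "\<dots> = e j * C2" by (simp add: C2_def)
      finally show ?thesis by simp
    qed
    have l: "(\<lambda>j. e j * C2) \<longlonglongrightarrow> 0" using tendsto_mult[OF e tendsto_const, of C2] by simp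
    have "(\<lambda>j. (LINT s|lborel. W s * \<psi> j s) - (LINT s|lborel. W s * prim g s)) \<longlonglongrightarrow> 0"
      by (rule Lim_null_comparison[OF _ l]) (use bd in \<open>auto intro!: always_eventually\<close>)
    then show ?thesis by (simp add: LIM_zero_iff)
  qed
  have "(LINT s|lborel. G s powr (p - 1) * \<psi>' j s) = q * \<gamma> * (LINT s|lborel. W s * \<psi> j s)" for j
    using extremal_weak_cc1(3)[OF cc] by (simp add: W_def)
  then have "(\<lambda>j. LINT s|lborel. G s powr (p - 1) * \<psi>' j s) \<longlonglongrightarrow> q * \<gamma> * (LINT s|lborel. W s * prim g s)"
    by (simp only:) (intro tendsto_mult tendsto_const l2)
  from LIMSEQ_unique[OF l1 this]
  show "(LINT s|lborel. G s powr (p - 1) * g s) = q * \<gamma> * (LINT s|lborel. wt s * V s powr (q - 1) * prim g s)"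
    by (simp add: W_def)
qed

end

section \<open>Radial integrals\<close>

text \<open>The measures may be infinite near 0 or at infinity, so they cannot be compared on
  half-lines directly. Restricted to the intervals \<open>I j\<close> they are finite and agree, and
  continuity from below removes the restriction.\<close>

lemma measure_eqI_Ioc_pos:
  fixes M N :: "real measure"
  assumes sets: "sets M = sets borel" "sets N = sets borel"
    and null: "emeasure M {..0} = 0" "emeasure N {..0} = 0"
    and eq: "\<And>a b. 0 < a \<Longrightarrow> a < b \<Longrightarrow> emeasure M {a<..b} = emeasure N {a<..b}"
    and fin: "\<And>a b. 0 < a \<Longrightarrow> a < b \<Longrightarrow> emeasure M {a<..b} < \<infinity>"
  shows "M = N"
proof (rule measure_eqI)
  have [measurable_cong]: "sets M = sets borel" "sets N = sets borel" by fact+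
  define I where "I j = {1 / (real j + 2)<..real j + 2}" for j :: nat
  have I_pos: "0 < 1 / (real j + 2)" "1 / (real j + 2) < real j + 2" for j
  proof -
    have "1 / (real j + 2) \<le> 1 / 2" by (simp add: field_simps)
    then show "1 / (real j + 2) < real j + 2" by linarith
  qed simp
  have tr: "density M (indicator (I j)) = density N (indicator (I j))" for j
  proof (rule measure_eqI_lessThan)
    fix x
    have d: "emeasure (density K (indicator (I j))) {x<..} = emeasure K ({x<..} \<inter> I j)"
      if K: "sets K = sets borel" for K :: "real measure"
    proof -
      have [measurable_cong]: "sets K = sets borel" by fact
      have [measurable]: "I j \<in> sets borel" by (simp add: I_def)
      have "emeasure (density K (indicator (I j))) {x<..} = (\<integral>\<^sup>+ y. indicator (I j) y * indicator {x<..} y \<partial>K)"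
        by (rule emeasure_density) measurable
      also have "\<dots> = (\<integral>\<^sup>+ y. indicator ({x<..} \<inter> I j) y \<partial>K)"
        by (intro nn_integral_cong) (auto simp: indicator_def)
      also have "\<dots> = emeasure K ({x<..} \<inter> I j)"
        using K by (intro nn_integral_indicator) (auto simp: I_def)
      finally show ?thesis .
    qed
    have "emeasure M ({x<..} \<inter> I j) = emeasure N ({x<..} \<inter> I j) \<and> emeasure M ({x<..} \<inter> I j) < \<infinity>"
    proof (cases "x < real j + 2")
      case True
      then have "{x<..} \<inter> I j = {max x (1 / (real j + 2))<..real j + 2}" by (auto simp: I_def)
      then show ?thesis
        using eq[of "max x (1 / (real j + 2))" "real j + 2"] fin[of "max x (1 / (real j + 2))" "real j + 2"] True I_pos[of j]
        by (simp add: less_max_iff_disj)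
    next
      case False
      then have e: "{x<..} \<inter> I j = {}" by (auto simp: I_def)
      show ?thesis unfolding e by simp
    qed
    then show "emeasure (density M (indicator (I j))) {x<..} = emeasure (density N (indicator (I j))) {x<..}"
      "emeasure (density M (indicator (I j))) {x<..} < \<infinity>"
      unfolding d[OF sets(1)] d[OF sets(2)] by blast+
  qed (simp_all add: sets)
  show "sets M = sets N" using sets by simp
  fix A assume "A \<in> sets M"
  then have A[measurable]: "A \<in> sets borel" using sets by simp
  have Ipos: "(\<Union>j. I j) = {0<..}"
  proof (intro equalityI subsetI)
    fix s assume "s \<in> (\<Union>j. I j)"
    then obtain j where "1 / (real j + 2) < s" unfolding I_def UN_iff greaterThanAtMost_iff by blast
    with I_pos(1)[of j] have "0 < s" by (rule less_trans)
    then show "s \<in> {0<..}" by simp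
  next
    fix s :: real assume "s \<in> {0<..}"
    then have s: "s > 0" by simp
    obtain j :: nat where j: "max s (1 / s) < real j" using reals_Archimedean2 by blast
    then have "1 / s < real j + 2" "s < real j" by auto
    then have "s \<in> I j" using s by (auto simp: I_def field_simps)
    then show "s \<in> (\<Union>j. I j)" by blast
  qed
  have inc: "incseq (\<lambda>j. A \<inter> I j)"
  proof (rule incseq_SucI)
    fix j
    have "1 / (real (Suc j) + 2) \<le> 1 / (real j + 2)" by (intro divide_left_mono) auto
    then show "A \<inter> I j \<subseteq> A \<inter> I (Suc j)" by (auto simp: I_def)
  qed
  have lim: "emeasure K A = (SUP j. emeasure (density K (indicator (I j))) A)"
    if K: "sets K = sets borel" and z: "emeasure K {..0} = 0" for K :: "real measure"
  proof -
    have [measurable_cong]: "sets K = sets borel" by fact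
    have [measurable]: "I j \<in> sets borel" for j by (simp add: I_def)
    have dK: "emeasure (density K (indicator (I j))) A = emeasure K (A \<inter> I j)" for j
    proof -
      have "emeasure (density K (indicator (I j))) A = (\<integral>\<^sup>+ y. indicator (I j) y * indicator A y \<partial>K)"
        by (rule emeasure_density) (use K A in auto)
      also have "\<dots> = (\<integral>\<^sup>+ y. indicator (A \<inter> I j) y \<partial>K)"
        by (intro nn_integral_cong) (auto simp: indicator_def)
      also have "\<dots> = emeasure K (A \<inter> I j)"
        using K A by (intro nn_integral_indicator) auto
      finally show ?thesis .
    qed
    have "emeasure K A = emeasure K (A \<inter> {0<..})"
    proof (rule emeasure_eq_AE)
      have "AE x in K. x \<notin> {..0}" using z K by (intro AE_not_in) (auto simp: null_sets_def)
      then show "AE x in K. (x \<in> A) = (x \<in> A \<inter> {0<..})" by eventually_elim auto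
    qed (use K A in auto)
    also have "A \<inter> {0<..} = (\<Union>j. A \<inter> I j)" using Ipos by auto
    also have "emeasure K \<dots> = (SUP j. emeasure K (A \<inter> I j))"
      by (rule SUP_emeasure_incseq[symmetric, OF _ inc]) (simp add: image_subset_iff K)
    finally show ?thesis unfolding dK .
  qed
  show "emeasure M A = emeasure N A"
    using lim[OF sets(1) null(1)] lim[OF sets(2) null(2)] unfolding tr by simp
qed

definition radius_power :: "real \<Rightarrow> real ^ 'n::finite \<Rightarrow> real" where
  "radius_power \<kappa> x = norm x powr (- \<kappa>)"

lemma borel_measurable_radius_power [measurable]: "radius_power \<kappa> \<in> borel_measurable borel"
  unfolding radius_power_def[abs_def] by measurable

text \<open>Polar coordinates without a surface measure: the preimage of an interval is an annulus
  of known volume, and the density is recognised by the fundamental theorem of calculus. The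
  constant n times the volume of the unit ball is the area of the unit sphere.\<close>

lemma distr_radius_power:
  fixes \<kappa> :: real
  assumes \<kappa>: "\<kappa> \<noteq> 0"
  defines "n \<equiv> real CARD('n)"
  defines "c \<equiv> n * unit_ball_vol n / \<bar>\<kappa>\<bar>"
  shows "distr lborel borel (radius_power \<kappa> :: real ^ 'n::finite \<Rightarrow> real)
    = density lborel (\<lambda>s. ennreal (indicator {0<..} s * (c * s powr (- (n / \<kappa>) - 1))))"
    (is "?M = ?N")
proof (rule measure_eqI_Ioc_pos)
  have n: "n > 0" by (simp add: n_def)
  have c: "c > 0" using n \<kappa> by (simp add: c_def)
  let ?\<sigma> = "radius_power \<kappa> :: real ^ 'n \<Rightarrow> real"
  let ?e = "- (n / \<kappa>)"
  have ball: "emeasure lborel (ball (0 :: real ^ 'n) (t powr (- 1 / \<kappa>))) = ennreal (unit_ball_vol n * t powr ?e)"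
             "emeasure lborel (cball (0 :: real ^ 'n) (t powr (- 1 / \<kappa>))) = ennreal (unit_ball_vol n * t powr ?e)"
    if "t > 0" for t
  proof -
    have "(t powr (- 1 / \<kappa>)) ^ DIM(real ^ 'n) = t powr ?e"
      using that by (simp add: powr_powr n_def flip: powr_realpow)
    then show "emeasure lborel (ball (0 :: real ^ 'n) (t powr (- 1 / \<kappa>))) = ennreal (unit_ball_vol n * t powr ?e)"
      "emeasure lborel (cball (0 :: real ^ 'n) (t powr (- 1 / \<kappa>))) = ennreal (unit_ball_vol n * t powr ?e)"
      using emeasure_ball[of "t powr (- 1 / \<kappa>)" "0 :: real ^ 'n"] emeasure_cball[of "t powr (- 1 / \<kappa>)" "0 :: real ^ 'n"]
      by (simp_all add: n_def)
  qed
  have inv: "(t powr (- 1 / \<kappa>)) powr (- \<kappa>) = t" if "t > 0" for t using that \<kappa> by (simp add: powr_powr)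
  have M: "emeasure ?M {a<..b} = ennreal (unit_ball_vol n * \<bar>a powr ?e - b powr ?e\<bar>)" if ab: "0 < a" "a < b" for a b
  proof -
    define a' where "a' = a powr (- 1 / \<kappa>)"
    define b' where "b' = b powr (- 1 / \<kappa>)"
    have ab': "a' > 0" "b' > 0" "a' powr (- \<kappa>) = a" "b' powr (- \<kappa>) = b" using ab inv by (auto simp: a'_def b'_def)
    have M1: "emeasure ?M {a<..b} = emeasure lborel (?\<sigma> -` {a<..b})"
      by (subst emeasure_distr) auto
    show ?thesis
    proof (cases "\<kappa> > 0")
      case True
      have mono: "s powr (- \<kappa>) < t powr (- \<kappa>) \<longleftrightarrow> t < s" if "s > 0" "t > 0" for s t
        using that True powr_less_mono2_neg[of "- \<kappa>" t s] powr_less_mono2_neg[of "- \<kappa>" s t]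
        by (cases s t rule: linorder_cases) auto
      \<comment> \<open>For \<kappa> > 0 the map decreases with the radius, so the half-open
        interval becomes a difference of open balls; for \<kappa> < 0 it becomes one of closed
        balls. As 0 powr a = 0, the origin is mapped to 0 for either sign and lies in no such
        preimage.\<close>
      have "x \<in> ?\<sigma> -` {a<..b} \<longleftrightarrow> x \<in> ball 0 a' - ball 0 b'" for x :: "real ^ 'n"
      proof (cases "x = 0")
        case False
        then show ?thesis using mono[of a' "norm x"] mono[of b' "norm x"] ab' by (auto simp: radius_power_def not_less)
      qed (use ab ab' in \<open>auto simp: radius_power_def\<close>)
      then have e: "?\<sigma> -` {a<..b} = ball 0 a' - ball 0 b'" by blast
      have lt: "b' < a'" unfolding mono[OF ab'(1,2), symmetric] using ab' ab by simp
      have "emeasure lborel (ball 0 a' - ball 0 b' :: (real ^ 'n) set) = emeasure lborel (ball (0 :: real ^ 'n) a') - emeasure lborel (ball (0 :: real ^ 'n) b')"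
        using lt ball(1)[of b] ab by (intro emeasure_Diff) (auto simp: b'_def)
      then have "emeasure ?M {a<..b} = ennreal (unit_ball_vol n * a powr ?e) - ennreal (unit_ball_vol n * b powr ?e)"
        unfolding M1 e using ball(1)[of a] ball(1)[of b] ab by (simp add: a'_def b'_def)
      moreover have "b powr ?e < a powr ?e"
        using ab n True by (intro powr_less_mono2_neg) auto
      ultimately show ?thesis by (subst (asm) ennreal_minus) (auto simp: n_def right_diff_distrib)
    next
      case False
      then have k: "\<kappa> < 0" using \<kappa> by simp
      have mono: "s powr (- \<kappa>) < t powr (- \<kappa>) \<longleftrightarrow> s < t" if "s > 0" "t > 0" for s t
        using that k powr_less_mono2[of "- \<kappa>" t s] powr_less_mono2[of "- \<kappa>" s t]
        by (cases s t rule: linorder_cases) auto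
      have "x \<in> ?\<sigma> -` {a<..b} \<longleftrightarrow> x \<in> cball 0 b' - cball 0 a'" for x :: "real ^ 'n"
      proof (cases "x = 0")
        case False
        then show ?thesis using mono[of a' "norm x"] mono[of b' "norm x"] ab'
          by (auto simp: radius_power_def not_less)
      qed (use ab ab' in \<open>auto simp: radius_power_def\<close>)
      then have e: "?\<sigma> -` {a<..b} = cball 0 b' - cball 0 a'" by blast
      have lt: "a' < b'" unfolding mono[OF ab'(1,2), symmetric] using ab' ab by simp
      have "emeasure lborel (cball 0 b' - cball 0 a' :: (real ^ 'n) set) = emeasure lborel (cball (0 :: real ^ 'n) b') - emeasure lborel (cball (0 :: real ^ 'n) a')"
        using lt ball(2)[of a] ab by (intro emeasure_Diff) (auto simp: a'_def)
      then have "emeasure ?M {a<..b} = ennreal (unit_ball_vol n * b powr ?e) - ennreal (unit_ball_vol n * a powr ?e)"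
        unfolding M1 e using ball(2)[of a] ball(2)[of b] ab by (simp add: a'_def b'_def)
      moreover have "a powr ?e < b powr ?e"
        using ab n k by (intro powr_less_mono2) (auto simp: field_simps)
      ultimately show ?thesis by (subst (asm) ennreal_minus) (auto simp: n_def right_diff_distrib)
    qed
  qed
  have N: "emeasure ?N {a<..b} = ennreal (unit_ball_vol n * \<bar>a powr ?e - b powr ?e\<bar>)" if ab: "0 < a" "a < b" for a b
  proof -
    have "emeasure ?N {a<..b} = (\<integral>\<^sup>+ s. ennreal (indicator {0<..} s * (c * s powr (?e - 1))) * indicator {a<..b} s \<partial>lborel)"
      by (rule emeasure_density) auto
    also have "\<dots> = (\<integral>\<^sup>+ s. ennreal (c * s powr (?e - 1)) * indicator {a..b} s \<partial>lborel)"
      using AE_lborel_singleton[of a] by (intro nn_integral_cong_AE, eventually_elim) (use ab in \<open>auto simp: indicator_def\<close>)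
    also have "\<dots> = ennreal (c * b powr ?e / ?e - c * a powr ?e / ?e)"
      using ab \<kappa> n c
      by (intro nn_integral_FTC_Icc) (auto intro!: derivative_eq_intros)
    also have "c * b powr ?e / ?e - c * a powr ?e / ?e = unit_ball_vol n * (sgn \<kappa> * (a powr ?e - b powr ?e))"
      using \<kappa> n by (simp add: c_def field_simps sgn_if abs_if)
    also have "sgn \<kappa> * (a powr ?e - b powr ?e) = \<bar>a powr ?e - b powr ?e\<bar>"
    proof (cases "\<kappa> > 0")
      case True
      then have "b powr ?e < a powr ?e" using ab n by (intro powr_less_mono2_neg) auto
      then show ?thesis using True by simp
    next
      case False
      then have "\<kappa> < 0" using \<kappa> by simp
      moreover from this have "a powr ?e < b powr ?e" using ab n by (intro powr_less_mono2) (auto simp: field_simps)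
      ultimately show ?thesis by simp
    qed
    finally show ?thesis .
  qed
  show "emeasure ?M {a<..b} = emeasure ?N {a<..b}" "emeasure ?M {a<..b} < \<infinity>" if "0 < a" "a < b" for a b
    using M[OF that] N[OF that] by simp_all
  have "?\<sigma> -` {..0} \<subseteq> {0}" by (auto simp: radius_power_def)
  then have "emeasure lborel (?\<sigma> -` {..0}) \<le> emeasure lborel {0 :: real ^ 'n}" by (rule emeasure_mono) simp
  then show "emeasure ?M {..0} = 0"
    by (subst emeasure_distr) auto
  have "emeasure ?N {..0} = (\<integral>\<^sup>+ s. ennreal (indicator {0<..} s * (c * s powr (?e - 1))) * indicator {..0} s \<partial>lborel)"
    by (rule emeasure_density) auto
  also have "\<dots> = (\<integral>\<^sup>+ (s::real). 0 \<partial>lborel)"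
    by (rule nn_integral_cong) (simp add: indicator_def)
  finally show "emeasure ?N {..0} = 0" by simp
qed simp_all

section \<open>Radial functions and their profiles\<close>

lemma GDERIV_unique:
  assumes "GDERIV f x :> D" "GDERIV f x :> D'" shows "D = D'"
proof -
  have "(\<lambda>h. h \<bullet> D) = (\<lambda>h. h \<bullet> D')"
    using assms unfolding gderiv_def by (rule has_derivative_unique)
  then have "(D - D') \<bullet> D = (D - D') \<bullet> D'" by (rule fun_cong)
  then have "(D - D') \<bullet> (D - D') = 0" by (simp add: inner_diff_right)
  then show ?thesis by simp
qed

lemma gradient_eqI: "GDERIV f x :> D \<Longrightarrow> gradient f x = D"
  unfolding gradient_def by (rule the_equality) (auto intro: GDERIV_unique)

lemma GDERIV_transform_open:
  assumes "GDERIV f x :> D" "open S" "x \<in> S" "\<And>y. y \<in> S \<Longrightarrow> f y = g y"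
  shows "GDERIV g x :> D"
  using assms unfolding gderiv_def by (rule has_derivative_transform_within_open)

definition radius_power_grad :: "real \<Rightarrow> real ^ 'n::finite \<Rightarrow> real ^ 'n" where
  "radius_power_grad \<kappa> x = (- \<kappa> * norm x powr (- \<kappa> - 1)) *\<^sub>R sgn x"

lemma borel_measurable_radius_power_grad [measurable]: "radius_power_grad \<kappa> \<in> borel_measurable borel"
  unfolding radius_power_grad_def[abs_def] sgn_div_norm by measurable

lemma GDERIV_radius_power:
  assumes "x \<noteq> 0" shows "GDERIV (radius_power \<kappa>) x :> radius_power_grad \<kappa> x"
  unfolding radius_power_def[abs_def] radius_power_grad_def
  by (rule GDERIV_DERIV_compose[OF GDERIV_norm[OF assms] has_real_derivative_powr]) (use assms in simp)

lemma norm_radius_power_grad: "norm (radius_power_grad \<kappa> x) = \<bar>\<kappa>\<bar> * norm x powr (- \<kappa> - 1)"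
  by (cases "x = 0") (simp_all add: radius_power_grad_def norm_sgn abs_mult)

lemma radius_power_pos: "x \<noteq> 0 \<Longrightarrow> radius_power \<kappa> x > 0"
  by (simp add: radius_power_def)

lemma norm_eq_radius_power: "\<kappa> \<noteq> 0 \<Longrightarrow> norm x powr a = radius_power \<kappa> x powr (- a / \<kappa>)"
  by (simp add: radius_power_def powr_powr)

lemma powr_between:
  fixes e :: real
  assumes "0 < a" "a \<le> s" "s \<le> b"
  shows "min (a powr e) (b powr e) \<le> s powr e" "s powr e \<le> max (a powr e) (b powr e)"
proof -
  have "a powr e \<le> s powr e \<and> s powr e \<le> b powr e \<or> b powr e \<le> s powr e \<and> s powr e \<le> a powr e"
    using assms by (cases "e \<ge> 0") (auto intro: powr_mono2 powr_mono2')
  then show "min (a powr e) (b powr e) \<le> s powr e" "s powr e \<le> max (a powr e) (b powr e)" by auto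
qed

lemma continuous_on_radius_power: "continuous_on (- {0}) (radius_power \<kappa>)"
  unfolding radius_power_def[abs_def] by (intro continuous_intros) auto

lemma continuous_on_radius_power_grad: "continuous_on (- {0}) (radius_power_grad \<kappa>)"
  unfolding radius_power_grad_def[abs_def] sgn_div_norm by (intro continuous_intros) auto

context bliss begin

text \<open>The support of the profile avoids 0 and infinity, so that of f is an annulus for either
  sign of \<kappa>. At the origin \<open>radius_power\<close> is 0, where the profile vanishes as
  required.\<close>

lemma C1_c_radial_of_cc1:
  fixes \<kappa> :: real
  assumes \<kappa>: "\<kappa> \<noteq> 0" and cc: "cc1 \<psi> \<psi>'"
  defines "f \<equiv> \<lambda>x :: real ^ 'n::finite. \<psi> (radius_power \<kappa> x)"
  shows "f \<in> C1_c_radial" "gradient f x = \<psi>' (radius_power \<kappa> x) *\<^sub>R radius_power_grad \<kappa> x"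
proof -
  obtain a b where ab: "0 < a" "a < b" "\<And>s. s \<notin> {a..b} \<Longrightarrow> \<psi> s = 0 \<and> \<psi>' s = 0"
    using cc by (auto simp: cc1_def)
  define r1 where "r1 = min (a powr (- 1 / \<kappa>)) (b powr (- 1 / \<kappa>))"
  define r2 where "r2 = max (a powr (- 1 / \<kappa>)) (b powr (- 1 / \<kappa>))"
  have r1: "r1 > 0" using ab by (auto simp: r1_def)
  have loc: "r1 \<le> norm x \<and> norm x \<le> r2" if "radius_power \<kappa> x \<in> {a..b}" for x :: "real ^ 'n"
    using powr_between[OF ab(1), of "radius_power \<kappa> x" b "- 1 / \<kappa>"] norm_eq_radius_power[OF \<kappa>, of x 1] that
    by (auto simp: r1_def r2_def)
  have f0: "f x = 0" "\<psi>' (radius_power \<kappa> x) = 0" if "norm x < r1 \<or> r2 < norm x" for x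
  proof -
    have "radius_power \<kappa> x \<notin> {a..b}" using loc[of x] that by linarith
    then show "f x = 0" "\<psi>' (radius_power \<kappa> x) = 0" using ab(3) by (auto simp: f_def)
  qed
  define g where "g x = \<psi>' (radius_power \<kappa> x) *\<^sub>R radius_power_grad \<kappa> x" for x :: "real ^ 'n"
  have D: "GDERIV f x :> g x" for x
  proof (cases "x = 0")
    case True
    have "GDERIV f x :> 0"
      by (rule GDERIV_transform_open[OF GDERIV_const, of "ball 0 r1"]) (use True r1 f0 in auto)
    then show ?thesis using True by (simp add: g_def radius_power_grad_def)
  next
    case False
    have "(\<psi> has_real_derivative \<psi>' (radius_power \<kappa> x)) (at (radius_power \<kappa> x))" using cc by (simp add: cc1_def)
    from GDERIV_DERIV_compose[OF GDERIV_radius_power[OF False] this] show ?thesis by (simp add: f_def g_def)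
  qed
  then have grad: "gradient f x = g x" for x by (rule gradient_eqI)
  then show "gradient f x = \<psi>' (radius_power \<kappa> x) *\<^sub>R radius_power_grad \<kappa> x" by (simp add: g_def)
  have "closure {x. f x \<noteq> 0} \<subseteq> cball 0 r2 - ball 0 r1"
  proof (rule closure_minimal)
    show "{x. f x \<noteq> 0} \<subseteq> cball 0 r2 - ball 0 r1" using f0 by (force simp: not_less)
  qed (auto intro: closed_Diff)
  moreover from this have "bounded (closure {x. f x \<noteq> 0})"
    by (rule bounded_subset[rotated]) (auto intro: bounded_diff bounded_subset[OF bounded_cball])
  ultimately have "compact (closure {x. f x \<noteq> 0})" "0 \<notin> closure {x. f x \<noteq> 0}"
    using r1 by (auto simp: compact_eq_bounded_closed)
  moreover have "radial f" by (simp add: radial_def f_def radius_power_def)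
  moreover have "continuous_on UNIV g"
  proof -
    have "continuous_on (ball 0 r1) g"
      by (subst continuous_on_cong[OF refl, of _ _ "\<lambda>_. 0"]) (use f0 in \<open>auto simp: g_def\<close>)
    moreover have "continuous_on (- {0}) g"
      unfolding g_def[abs_def]
      by (intro continuous_on_scaleR continuous_on_radius_power_grad
          continuous_on_compose2[OF cc1_cont(2)[OF cc, of UNIV] continuous_on_radius_power]) auto
    ultimately have "continuous_on (ball 0 r1 \<union> - {0}) g" by (rule continuous_on_open_Un[rotated 2]) auto
    moreover have "ball 0 r1 \<union> - {0} = (UNIV :: (real ^ 'n) set)" using r1 by auto
    ultimately show ?thesis by simp
  qed
  moreover have "continuous_on UNIV (gradient f)" using \<open>continuous_on UNIV g\<close> grad by (simp add: continuous_on_cong[of UNIV UNIV "gradient f" g])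
  ultimately show "f \<in> C1_c_radial" using D by (auto simp: C1_c_radial_def)
qed

text \<open>The profile is the restriction of f to a ray, reparametrised by the radius as a function
  of s. Differentiating f as profile after \<open>radius_power\<close> then shows that its gradient
  is radial.\<close>

lemma cc1_of_C1_c_radial:
  fixes \<kappa> :: real and f :: "real ^ 'n::finite \<Rightarrow> real"
  assumes \<kappa>: "\<kappa> \<noteq> 0" and f: "f \<in> C1_c_radial"
  obtains \<psi> \<psi>' where "cc1 \<psi> \<psi>'" "\<And>x. x \<noteq> 0 \<Longrightarrow> f x = \<psi> (radius_power \<kappa> x)"
    "\<And>x. x \<noteq> 0 \<Longrightarrow> gradient f x = \<psi>' (radius_power \<kappa> x) *\<^sub>R radius_power_grad \<kappa> x"
proof -
  have rad: "norm x = norm y \<Longrightarrow> f x = f y" for x y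
    using f unfolding C1_c_radial_def radial_def by blast
  have grad: "GDERIV f x :> gradient f x" for x
  proof -
    obtain D where D: "GDERIV f x :> D" using f unfolding C1_c_radial_def by blast
    show ?thesis unfolding gradient_eqI[OF D] by (rule D)
  qed
  have contg: "continuous_on UNIV (gradient f)" using f unfolding C1_c_radial_def by blast
  have "open (- closure {x. f x \<noteq> 0})" "0 \<in> - closure {x. f x \<noteq> 0}" using f unfolding C1_c_radial_def by blast+
  then obtain r1 where r1: "r1 > 0" "ball 0 r1 \<subseteq> - closure {x. f x \<noteq> 0}" by (meson openE)
  have "bounded (closure {x. f x \<noteq> 0})" using f unfolding C1_c_radial_def by (blast intro: compact_imp_bounded)
  then obtain R where R: "\<And>x. x \<in> closure {x. f x \<noteq> 0} \<Longrightarrow> norm x \<le> R" by (auto simp: bounded_iff)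
  \<comment> \<open>The factor 2 guarantees r1 < r2, so that the interval {a..b} below is
    nondegenerate.\<close>
  define r2 where "r2 = max R (2 * r1)"
  have sub: "x \<in> closure {x. f x \<noteq> 0}" if "f x \<noteq> 0" for x using that closure_subset by fastforce
  have supp: "r1 \<le> norm x \<and> norm x \<le> r2" if "f x \<noteq> 0" for x
    using sub[OF that] R[OF sub[OF that]] r1(2) by (auto simp: r2_def subset_iff not_less)
  have r12: "r1 < r2" using r1 by (auto simp: r2_def)
  obtain e :: "real ^ 'n" where e: "norm e = 1" using vector_choose_size[of 1] by auto
  define \<rho> where "\<rho> s = s powr (- 1 / \<kappa>)" for s
  define \<psi> where "\<psi> s = (if s > 0 then f (\<rho> s *\<^sub>R e) else 0)" for s
  define \<psi>' where "\<psi>' s = (if s > 0 then (gradient f (\<rho> s *\<^sub>R e) \<bullet> e) * (- 1 / \<kappa> * s powr (- 1 / \<kappa> - 1)) else 0)" for s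
  define a where "a = min (r1 powr (- \<kappa>)) (r2 powr (- \<kappa>))"
  define b where "b = max (r1 powr (- \<kappa>)) (r2 powr (- \<kappa>))"
  have "r1 powr (- \<kappa>) \<noteq> r2 powr (- \<kappa>)"
  proof
    assume "r1 powr (- \<kappa>) = r2 powr (- \<kappa>)"
    then have "(r1 powr (- \<kappa>)) powr (- 1 / \<kappa>) = (r2 powr (- \<kappa>)) powr (- 1 / \<kappa>)" by simp
    then show False using r1(1) r12 \<kappa> by (simp add: powr_powr)
  qed
  then have ab: "0 < a" "a < b" using r1(1) r12 by (auto simp: a_def b_def)
  have \<psi>0: "\<psi> s = 0" if "s \<notin> {a..b}" for s
  proof (rule ccontr)
    assume n: "\<psi> s \<noteq> 0"
    then have s: "s > 0" and "f (\<rho> s *\<^sub>R e) \<noteq> 0" by (auto simp: \<psi>_def split: if_splits)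
    then have "r1 \<le> \<rho> s" "\<rho> s \<le> r2" using supp[of "\<rho> s *\<^sub>R e"] e by (auto simp: \<rho>_def)
    moreover have "\<rho> s powr (- \<kappa>) = s" using s \<kappa> by (simp add: \<rho>_def powr_powr)
    ultimately have "s \<in> {a..b}" using powr_between[OF r1(1), of "\<rho> s" r2 "- \<kappa>"] by (auto simp: a_def b_def)
    then show False using that by simp
  qed
  have D1: "(\<psi> has_real_derivative \<psi>' s) (at s)" if s: "s > 0" for s
  proof -
    have "(\<rho> has_real_derivative (- 1 / \<kappa> * s powr (- 1 / \<kappa> - 1))) (at s)"
      unfolding \<rho>_def[abs_def] by (rule has_real_derivative_powr[OF s])
    then have d: "((\<lambda>s. \<rho> s *\<^sub>R e) has_derivative (\<lambda>h. (h * (- 1 / \<kappa> * s powr (- 1 / \<kappa> - 1))) *\<^sub>R e)) (at s)"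
      unfolding has_field_derivative_def by (auto intro!: derivative_eq_intros simp: mult.commute)
    have "((\<lambda>s. f (\<rho> s *\<^sub>R e)) has_derivative (\<lambda>h. ((h * (- 1 / \<kappa> * s powr (- 1 / \<kappa> - 1))) *\<^sub>R e) \<bullet> gradient f (\<rho> s *\<^sub>R e))) (at s)"
      by (rule has_derivative_compose[OF d grad[unfolded gderiv_def]])
    then have "((\<lambda>s. f (\<rho> s *\<^sub>R e)) has_derivative (*) (\<psi>' s)) (at s)"
      by (rule has_derivative_eq_rhs) (use s in \<open>auto simp: \<psi>'_def inner_commute fun_eq_iff\<close>)
    then have "((\<lambda>s. f (\<rho> s *\<^sub>R e)) has_real_derivative \<psi>' s) (at s)"
      by (simp only: has_field_derivative_def)
    then show ?thesis
      by (rule has_field_derivative_transform_within_open[of _ _ _ "{0<..}"]) (use s in \<open>auto simp: \<psi>_def\<close>)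
  qed
  have D0: "(\<psi> has_real_derivative 0) (at s)" if s: "s \<notin> {a..b}" for s
  proof -
    have "open (- {a..b})" by (intro open_Compl) auto
    then show ?thesis
      by (rule has_field_derivative_transform_within_open[of "\<lambda>_. 0"  _ _ "- {a..b}", rotated]) (use s \<psi>0 in auto)
  qed
  have \<psi>'0: "\<psi>' s = 0" if "s \<notin> {a..b}" for s
    using DERIV_unique[OF D1[of s] D0[OF that]] by (cases "s > 0") (auto simp: \<psi>'_def)
  have D: "(\<psi> has_real_derivative \<psi>' s) (at s)" for s
  proof (cases "s > 0")
    case False
    then have "s \<notin> {a..b}" using ab by auto
    then show ?thesis using D0 \<psi>'0 by simp
  qed (rule D1)
  have cont': "continuous_on UNIV \<psi>'"
  proof -
    have "continuous_on {..<a} \<psi>'"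
      by (subst continuous_on_cong[OF refl, of _ _ "\<lambda>_. 0"]) (use \<psi>'0 in auto)
    moreover have "continuous_on {0<..} \<psi>'"
    proof -
      have "continuous_on {0<..} (\<lambda>s. (gradient f (\<rho> s *\<^sub>R e) \<bullet> e) * (- 1 / \<kappa> * s powr (- 1 / \<kappa> - 1)))"
        unfolding \<rho>_def using \<kappa> by (intro continuous_intros continuous_on_compose2[OF contg]) auto
      then show ?thesis by (subst continuous_on_cong[OF refl, of _ \<psi>']) (auto simp: \<psi>'_def)
    qed
    ultimately have "continuous_on ({..<a} \<union> {0<..}) \<psi>'" by (rule continuous_on_open_Un[rotated 2]) auto
    moreover have "{..<a} \<union> {0<..} = UNIV" using ab by auto
    ultimately show ?thesis by simp
  qed
  have cc: "cc1 \<psi> \<psi>'" unfolding cc1_def using D cont' ab \<psi>0 \<psi>'0 by blast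
  have fx: "f x = \<psi> (radius_power \<kappa> x)" if x: "x \<noteq> 0" for x
  proof -
    have "\<rho> (radius_power \<kappa> x) = norm x" using norm_eq_radius_power[OF \<kappa>, of x 1] by (simp add: \<rho>_def)
    then have "norm x = norm (\<rho> (radius_power \<kappa> x) *\<^sub>R e)" using e by simp
    then show ?thesis using rad radius_power_pos[OF x, of \<kappa>] by (simp add: \<psi>_def)
  qed
  moreover have "gradient f x = \<psi>' (radius_power \<kappa> x) *\<^sub>R radius_power_grad \<kappa> x" if x: "x \<noteq> 0" for x
  proof (rule gradient_eqI)
    have "GDERIV (\<lambda>x. \<psi> (radius_power \<kappa> x)) x :> \<psi>' (radius_power \<kappa> x) *\<^sub>R radius_power_grad \<kappa> x"
      by (rule GDERIV_DERIV_compose[OF GDERIV_radius_power[OF x] D])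
    then show "GDERIV f x :> \<psi>' (radius_power \<kappa> x) *\<^sub>R radius_power_grad \<kappa> x"
      by (rule GDERIV_transform_open[of _ _ _ "- {0}"]) (use x fx in auto)
  qed
  ultimately show ?thesis using that cc by blast
qed

end

text \<open>The weight |x|^a is itself a power of \<open>radius_power\<close>, so it joins the
  density of the image measure; the exponent of s in K collects the two.\<close>

lemma radial_integrals:
  fixes \<kappa> a :: real and F :: "real \<Rightarrow> real"
  assumes \<kappa>: "\<kappa> \<noteq> 0" and [measurable]: "F \<in> borel_measurable borel"
  defines "n \<equiv> real CARD('n)"
  defines "c \<equiv> n * unit_ball_vol n / \<bar>\<kappa>\<bar>"
  defines "K \<equiv> \<lambda>s. indicator {0<..} s * (c * (s powr (- (a + n) / \<kappa> - 1) * F s))"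
  shows "(\<And>s. F s \<ge> 0) \<Longrightarrow> integral\<^sup>N lborel (\<lambda>x :: real ^ 'n::finite. ennreal (norm x powr a * F (radius_power \<kappa> x))) = (\<integral>\<^sup>+ s. ennreal (K s) \<partial>lborel)"
    and "integrable lborel (\<lambda>x :: real ^ 'n. norm x powr a * F (radius_power \<kappa> x)) \<longleftrightarrow> integrable lborel K"
    and "(integral\<^sup>L lborel (\<lambda>x :: real ^ 'n. norm x powr a * F (radius_power \<kappa> x))) = (LINT s|lborel. K s)"
proof -
  define w where "w s = indicator {0<..} s * (c * s powr (- (n / \<kappa>) - 1))" for s :: real
  have c: "c \<ge> 0" by (simp add: c_def n_def)
  have w0: "w s \<ge> 0" for s using c by (simp add: w_def)
  have [measurable]: "w \<in> borel_measurable borel" unfolding w_def[abs_def] by measurable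
  define F' where "F' s = s powr (- a / \<kappa>) * F s" for s
  have [measurable]: "F' \<in> borel_measurable borel" unfolding F'_def[abs_def] by measurable
  have d: "distr lborel borel (radius_power \<kappa> :: real ^ 'n \<Rightarrow> real) = density lborel (\<lambda>s. ennreal (w s))"
    unfolding w_def c_def n_def by (rule distr_radius_power[OF \<kappa>])
  have F: "norm x powr a * F (radius_power \<kappa> x) = F' (radius_power \<kappa> x)" for x :: "real ^ 'n"
    unfolding norm_eq_radius_power[OF \<kappa>] F'_def ..
  have K: "w s * F' s = K s" for s
  proof -
    have e: "- (n / \<kappa>) - 1 + (- a / \<kappa>) = - (a + n) / \<kappa> - 1" by (simp add: add_divide_distrib diff_divide_distrib)
    have "s powr (- (a + n) / \<kappa> - 1) = s powr (- (n / \<kappa>) - 1) * s powr (- a / \<kappa>)"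
      unfolding powr_add[symmetric] e ..
    then show ?thesis by (simp only: w_def F'_def K_def mult_ac)
  qed
  show "integral\<^sup>N lborel (\<lambda>x :: real ^ 'n. ennreal (norm x powr a * F (radius_power \<kappa> x))) = (\<integral>\<^sup>+ s. ennreal (K s) \<partial>lborel)"
    if pos: "\<And>s. F s \<ge> 0"
  proof -
    have "integral\<^sup>N lborel (\<lambda>x :: real ^ 'n. ennreal (norm x powr a * F (radius_power \<kappa> x))) = (\<integral>\<^sup>+ s. ennreal (F' s) \<partial>density lborel (\<lambda>s. ennreal (w s)))"
      unfolding d[symmetric] F by (subst nn_integral_distr) auto
    also have "\<dots> = (\<integral>\<^sup>+ s. ennreal (w s) * ennreal (F' s) \<partial>lborel)"
      by (rule nn_integral_density) measurable
    also have "\<dots> = (\<integral>\<^sup>+ s. ennreal (K s) \<partial>lborel)"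
      using pos w0 by (intro nn_integral_cong) (simp add: K[symmetric] F'_def ennreal_mult)
    finally show ?thesis .
  qed
  have "integrable lborel (\<lambda>x :: real ^ 'n. norm x powr a * F (radius_power \<kappa> x)) \<longleftrightarrow> integrable (density lborel (\<lambda>s. ennreal (w s))) F'"
    unfolding d[symmetric] F by (subst integrable_distr_eq) auto
  also have "\<dots> \<longleftrightarrow> integrable lborel K"
    using w0 by (subst integrable_density) (auto simp: K)
  finally show "integrable lborel (\<lambda>x :: real ^ 'n. norm x powr a * F (radius_power \<kappa> x)) \<longleftrightarrow> integrable lborel K" .
  have "(integral\<^sup>L lborel (\<lambda>x :: real ^ 'n. norm x powr a * F (radius_power \<kappa> x))) = (LINT s|density lborel (\<lambda>s. ennreal (w s)). F' s)"
    unfolding d[symmetric] F by (subst integral_distr) auto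
  also have "\<dots> = (LINT s|lborel. K s)"
    using w0 by (subst integral_density) (auto simp: K)
  finally show "(integral\<^sup>L lborel (\<lambda>x :: real ^ 'n. norm x powr a * F (radius_power \<kappa> x))) = (LINT s|lborel. K s)" .
qed

text \<open>The density of the image measure is positive exactly on the open half line.\<close>

lemma AE_distr_radius_power:
  fixes \<kappa> :: real and P :: "real \<Rightarrow> bool"
  assumes \<kappa>: "\<kappa> \<noteq> 0"
  shows "(AE s in distr lborel borel (radius_power \<kappa> :: real ^ 'n::finite \<Rightarrow> real). P s) \<longleftrightarrow> (AE s in lborel. 0 < s \<longrightarrow> P s)"
proof -
  define w where "w s = indicator {0<..} s * (real CARD('n) * unit_ball_vol (real CARD('n)) / \<bar>\<kappa>\<bar> * s powr (- (real CARD('n) / \<kappa>) - 1))" for s :: real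
  have [measurable]: "w \<in> borel_measurable borel" unfolding w_def[abs_def] by measurable
  have d: "distr lborel borel (radius_power \<kappa> :: real ^ 'n \<Rightarrow> real) = density lborel (\<lambda>s. ennreal (w s))"
    unfolding w_def by (rule distr_radius_power[OF \<kappa>])
  have "0 < w s \<longleftrightarrow> 0 < s" for s
    using \<kappa> by (auto simp: w_def indicator_def)
  then have "(AE s in density lborel (\<lambda>s. ennreal (w s)). P s) \<longleftrightarrow> (AE s in lborel. 0 < s \<longrightarrow> P s)"
    by (subst AE_density) auto
  then show ?thesis unfolding d .
qed

lemma AE_radius_powerI:
  fixes \<kappa> :: real and P :: "real \<Rightarrow> bool"
  assumes \<kappa>: "\<kappa> \<noteq> 0" and P: "AE s in lborel. 0 < s \<longrightarrow> P s"
  shows "almost_everywhere lborel (\<lambda>x :: real ^ 'n::finite. P (radius_power \<kappa> x))"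
proof (rule AE_distrD[where f = "radius_power \<kappa>" and P = P and M' = borel])
  show "AE s in distr lborel borel (radius_power \<kappa> :: real ^ 'n::finite \<Rightarrow> real). P s"
    using P unfolding AE_distr_radius_power[OF \<kappa>] .
qed simp

lemma AE_radius_powerD:
  fixes \<kappa> :: real and P :: "real \<Rightarrow> bool"
  assumes \<kappa>: "\<kappa> \<noteq> 0" and P: "almost_everywhere lborel (\<lambda>x :: real ^ 'n::finite. P (radius_power \<kappa> x))"
    and [measurable]: "Measurable.pred borel P"
  shows "AE s in lborel. 0 < s \<longrightarrow> P s"
proof -
  have "AE s in distr lborel borel (radius_power \<kappa> :: real ^ 'n \<Rightarrow> real). P s"
    using P by (subst AE_distr_iff) auto
  then show ?thesis unfolding AE_distr_radius_power[OF \<kappa>] .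
qed

section \<open>The space of radial functions of finite energy\<close>

lemma nn_integral_tendsto_0_AE_subseq:
  fixes h :: "nat \<Rightarrow> 'a \<Rightarrow> real"
  assumes [measurable]: "\<And>k. h k \<in> borel_measurable M" and pos: "\<And>k x. h k x \<ge> 0"
    and lim: "(\<lambda>k. \<integral>\<^sup>+ x. ennreal (h k x) \<partial>M) \<longlonglongrightarrow> 0"
  obtains r :: "nat \<Rightarrow> nat" where "strict_mono r" "AE x in M. (\<lambda>k. h (r k) x) \<longlonglongrightarrow> 0"
proof -
  have "eventually (\<lambda>k. (\<integral>\<^sup>+ x. ennreal (h k x) \<partial>M) < 1) sequentially"
    using lim by (rule order_tendstoD) simp
  \<comment> \<open>Finitely many of the integrals may be infinite; the shift by N leaves an L^1
    sequence, to which the subsequence theorem applies.\<close>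
  then obtain N where N: "\<And>k. k \<ge> N \<Longrightarrow> (\<integral>\<^sup>+ x. ennreal (h k x) \<partial>M) < 1" by (auto simp: eventually_sequentially)
  have I: "integrable M (h (k + N))" for k
    using N[of "k + N"] pos by (intro integrableI_nonneg) (auto intro: less_trans)
  have "(\<lambda>k. ennreal (\<integral>x. norm (h (k + N) x) \<partial>M)) \<longlonglongrightarrow> ennreal 0"
    using LIMSEQ_ignore_initial_segment[OF lim, of N] pos
    by (subst nn_integral_eq_integral[symmetric]) (auto intro!: I)
  then have "(\<lambda>k. \<integral>x. norm (h (k + N) x) \<partial>M) \<longlonglongrightarrow> 0"
    by (subst (asm) tendsto_ennreal_iff) auto
  from tendsto_L1_AE_subseq[OF I this] obtain r :: "nat \<Rightarrow> nat" where
    r: "strict_mono r" "AE x in M. (\<lambda>n. h (r n + N) x) \<longlonglongrightarrow> 0" by auto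
  show ?thesis
    by (rule that[of "\<lambda>n. r n + N"]) (use r in \<open>auto simp: strict_mono_def\<close>)
qed

lemma powr_tendsto_0D:
  fixes f :: "nat \<Rightarrow> real"
  assumes "p > 0" "(\<lambda>k. f k powr p) \<longlonglongrightarrow> 0" shows "f \<longlonglongrightarrow> 0"
proof -
  have "(\<lambda>k. (f k powr p) powr (1 / p)) \<longlonglongrightarrow> 0 powr (1 / p)"
    by (rule isCont_tendsto_compose[OF isCont_abs_powr assms(2)]) (use assms in simp)
  then have "(\<lambda>k. \<bar>f k\<bar>) \<longlonglongrightarrow> 0" using assms(1) by (simp add: powr_powr)
  then show ?thesis by (rule tendsto_rabs_zero_cancel)
qed

text \<open>A C^1 bump, to be composed with ln s / (k + 1) where k is the index of the
  approximation. The derivative in s of this logarithmic cut-off is at most 4 / ((k + 1) s), an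
  error that a Hardy term can absorb.\<close>

definition cutoff :: "real \<Rightarrow> real" where "cutoff t = (max 0 (1 - t\<^sup>2))\<^sup>2"
definition cutoff' :: "real \<Rightarrow> real" where "cutoff' t = - 4 * t * max 0 (1 - t\<^sup>2)"

lemma DERIV_cutoff: "(cutoff has_real_derivative cutoff' t) (at t)"
proof -
  have sq: "((\<lambda>x. (max 0 x)\<^sup>2) has_real_derivative 2 * max 0 x) (at x)" for x :: real
  proof -
    have fe: "(\<lambda>x::real. (max 0 x)\<^sup>2) = (\<lambda>x. (x\<^sup>2 + x * \<bar>x\<bar>) / 2)"
      by (rule ext) (auto simp: max_def power2_eq_square abs_if)
    have "((\<lambda>x::real. x * \<bar>x\<bar>) has_real_derivative 2 * \<bar>x\<bar>) (at x)"
    proof -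
      consider "x = 0" | "x > 0" | "x < 0" by linarith
      then show ?thesis
      proof cases
        case 1
        have "(\<lambda>h. ((0 + h) * \<bar>0 + h\<bar> - 0 * \<bar>0\<bar>) / h) \<midarrow>0\<rightarrow> (0::real)"
        proof (rule Lim_null_comparison[of _ "\<lambda>h. \<bar>h\<bar>"])
          show "(\<lambda>h::real. \<bar>h\<bar>) \<midarrow>0\<rightarrow> 0" using tendsto_rabs[OF tendsto_ident_at, of 0 UNIV] by simp
        qed simp
        then show ?thesis using 1 by (simp add: DERIV_def)
      next
        case 2
        have "((\<lambda>x::real. x * x) has_real_derivative 2 * \<bar>x\<bar>) (at x)"
          using 2 by (auto intro!: derivative_eq_intros)
        then show ?thesis
          by (rule has_field_derivative_transform_within_open[of _ _ _ "{0<..}"]) (use 2 in auto)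
      next
        case 3
        have "((\<lambda>x::real. - (x * x)) has_real_derivative 2 * \<bar>x\<bar>) (at x)"
          using 3 by (auto intro!: derivative_eq_intros)
        then show ?thesis
          by (rule has_field_derivative_transform_within_open[of _ _ _ "{..<0}"]) (use 3 in auto)
      qed
    qed
    then have "((\<lambda>x. (x\<^sup>2 + x * \<bar>x\<bar>) / 2) has_real_derivative (2 * x + 2 * \<bar>x\<bar>) / 2) (at x)"
      by (intro DERIV_cdivide DERIV_add) (auto intro!: derivative_eq_intros)
    moreover have "(2 * x + 2 * \<bar>x\<bar>) / 2 = 2 * max 0 x" by auto
    ultimately show ?thesis unfolding fe by (simp only:)
  qed
  have "((\<lambda>t. 1 - t\<^sup>2) has_real_derivative - 2 * t) (at t)" by (auto intro!: derivative_eq_intros)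
  from DERIV_chain2[OF sq this] show ?thesis
    by (simp add: cutoff_def[abs_def] cutoff'_def mult_ac)
qed

lemma cutoff_bounds: "0 \<le> cutoff t" "cutoff t \<le> 1" "\<bar>cutoff' t\<bar> \<le> 4" "\<bar>t\<bar> \<ge> 1 \<Longrightarrow> cutoff t = 0" "\<bar>t\<bar> \<ge> 1 \<Longrightarrow> cutoff' t = 0"
proof -
  have m: "0 \<le> max 0 (1 - t\<^sup>2)" "max 0 (1 - t\<^sup>2) \<le> 1" by auto
  show "0 \<le> cutoff t" by (simp add: cutoff_def)
  show "cutoff t \<le> 1" unfolding cutoff_def using m by (rule power_le_one)
  have z: "max 0 (1 - t\<^sup>2) = 0" if "\<bar>t\<bar> \<ge> 1"
  proof -
    have "1 \<le> t\<^sup>2" using that one_le_power[of "\<bar>t\<bar>" 2] by simp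
    then show ?thesis by simp
  qed
  then show "\<bar>t\<bar> \<ge> 1 \<Longrightarrow> cutoff t = 0" "\<bar>t\<bar> \<ge> 1 \<Longrightarrow> cutoff' t = 0" by (simp_all add: cutoff_def cutoff'_def)
  show "\<bar>cutoff' t\<bar> \<le> 4"
  proof (cases "\<bar>t\<bar> \<ge> 1")
    case False
    have "\<bar>t\<bar> * \<bar>max 0 (1 - t\<^sup>2)\<bar> \<le> 1 * 1" using False m by (intro mult_mono) auto
    then show ?thesis by (simp add: cutoff'_def abs_mult)
  qed (simp add: z cutoff'_def)
qed

lemma cutoff_measurable [measurable]: "cutoff \<in> borel_measurable borel" "cutoff' \<in> borel_measurable borel"
  unfolding cutoff_def[abs_def] cutoff'_def[abs_def] by measurable

text \<open>The condition \<kappa> \<noteq> 0 expresses \<alpha> \<noteq> p - n; its sign decides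
  whether s = 0 corresponds to infinity or to the origin.\<close>

locale radial_bliss = bliss p q for p q :: real +
  fixes dim :: "'n::finite itself" and \<alpha> \<kappa> :: real
  assumes \<kappa>0: "\<kappa> \<noteq> 0" and dim_eq: "real CARD('n) - p + \<alpha> = \<kappa> * (p - 1)"
begin

text \<open>The area of the unit sphere divided by |\<kappa>|, the constant of the change of
  variables.\<close>

definition \<omega> :: real where "\<omega> = real CARD('n) * unit_ball_vol (real CARD('n)) / \<bar>\<kappa>\<bar>"
abbreviation \<sigma> :: "real ^ 'n \<Rightarrow> real" where "\<sigma> \<equiv> radius_power \<kappa>"
abbreviation \<sigma>' :: "real ^ 'n \<Rightarrow> real ^ 'n" where "\<sigma>' \<equiv> radius_power_grad \<kappa>"

lemma \<omega>_pos: "\<omega> > 0" using \<kappa>0 by (simp add: \<omega>_def)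

text \<open>The powers of s that remain in the energy, in the Hardy norm and in the potential after
  the change of variables. The exponent 0 in the energy is the purpose of the choice of
  \<kappa>.\<close>

lemma exponents:
  "- ((\<alpha> - (\<kappa> + 1) * p) + real CARD('n)) / \<kappa> - 1 = 0"
  "- ((\<alpha> - p) + real CARD('n)) / \<kappa> - 1 = - p"
  "- ((- real CARD('n) + q * ((real CARD('n) - p + \<alpha>) / p)) + real CARD('n)) / \<kappa> - 1 = - 1 - q * \<gamma>"
proof -
  have n: "real CARD('n) = \<kappa> * (p - 1) + p - \<alpha>" using dim_eq by simp
  show "- ((\<alpha> - (\<kappa> + 1) * p) + real CARD('n)) / \<kappa> - 1 = 0"
    unfolding n using \<kappa>0 by (simp add: field_simps)
  show "- ((\<alpha> - p) + real CARD('n)) / \<kappa> - 1 = - p"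
    unfolding n using \<kappa>0 by (simp add: field_simps)
  show "- ((- real CARD('n) + q * ((real CARD('n) - p + \<alpha>) / p)) + real CARD('n)) / \<kappa> - 1 = - 1 - q * \<gamma>"
    unfolding dim_eq using \<kappa>0 p by (simp add: field_simps \<gamma>_def)
qed

lemma grad_weight: "norm x powr \<alpha> * norm (\<sigma>' x) powr p = \<bar>\<kappa>\<bar> powr p * norm x powr (\<alpha> - (\<kappa> + 1) * p)"
proof -
  have e: "\<alpha> + (- \<kappa> - 1) * p = \<alpha> - (\<kappa> + 1) * p" by (simp add: algebra_simps)
  have "norm x powr \<alpha> * norm (\<sigma>' x) powr p = \<bar>\<kappa>\<bar> powr p * (norm x powr \<alpha> * norm x powr ((- \<kappa> - 1) * p))"
    unfolding norm_radius_power_grad powr_mult powr_powr by (simp only: mult_ac)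
  then show ?thesis unfolding powr_add[symmetric] e .
qed

lemma energy_integrals:
  assumes [measurable]: "F \<in> borel_measurable borel" and z: "\<And>s. s \<le> 0 \<Longrightarrow> F s = 0"
  shows "(\<And>s. F s \<ge> 0) \<Longrightarrow> integral\<^sup>N lborel (\<lambda>x :: real ^ 'n. ennreal (norm x powr \<alpha> * norm (\<sigma>' x) powr p * F (\<sigma> x)))
       = ennreal (\<omega> * \<bar>\<kappa>\<bar> powr p) * (\<integral>\<^sup>+ s. ennreal (F s) \<partial>lborel)"
    and "integrable lborel (\<lambda>x :: real ^ 'n. norm x powr \<alpha> * norm (\<sigma>' x) powr p * F (\<sigma> x)) \<longleftrightarrow> integrable lborel F"
    and "integral\<^sup>L lborel (\<lambda>x :: real ^ 'n. norm x powr \<alpha> * norm (\<sigma>' x) powr p * F (\<sigma> x)) = \<omega> * \<bar>\<kappa>\<bar> powr p * (LINT s|lborel. F s)"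
proof -
  define c where "c = \<omega> * \<bar>\<kappa>\<bar> powr p"
  have c: "c > 0" using \<omega>_pos \<kappa>0 by (simp add: c_def)
  have L: "norm x powr \<alpha> * norm (\<sigma>' x) powr p * F (\<sigma> x) = norm x powr (\<alpha> - (\<kappa> + 1) * p) * (\<bar>\<kappa>\<bar> powr p * F (\<sigma> x))" for x
    unfolding grad_weight by (simp only: mult_ac)
  have R: "indicator {0<..} s * (\<omega> * (s powr 0 * (\<bar>\<kappa>\<bar> powr p * F s))) = c * F s" for s
    using z[of s] by (auto simp: indicator_def c_def)
  note R' = radial_integrals[where \<kappa> = \<kappa> and a = "\<alpha> - (\<kappa> + 1) * p" and F = "\<lambda>s. \<bar>\<kappa>\<bar> powr p * F s" and ?'n = 'n,
      OF \<kappa>0, folded L \<omega>_def, unfolded exponents(1) R]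
  show "integrable lborel (\<lambda>x :: real ^ 'n. norm x powr \<alpha> * norm (\<sigma>' x) powr p * F (\<sigma> x)) \<longleftrightarrow> integrable lborel F"
    using R'(2) c by simp
  show "integral\<^sup>L lborel (\<lambda>x :: real ^ 'n. norm x powr \<alpha> * norm (\<sigma>' x) powr p * F (\<sigma> x)) = \<omega> * \<bar>\<kappa>\<bar> powr p * (LINT s|lborel. F s)"
    using R'(3) by (simp add: c_def)
  show "(\<And>s. F s \<ge> 0) \<Longrightarrow> integral\<^sup>N lborel (\<lambda>x :: real ^ 'n. ennreal (norm x powr \<alpha> * norm (\<sigma>' x) powr p * F (\<sigma> x)))
       = ennreal (\<omega> * \<bar>\<kappa>\<bar> powr p) * (\<integral>\<^sup>+ s. ennreal (F s) \<partial>lborel)"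
  proof -
    assume pos: "\<And>s. F s \<ge> 0"
    have "integral\<^sup>N lborel (\<lambda>x :: real ^ 'n. ennreal (norm x powr \<alpha> * norm (\<sigma>' x) powr p * F (\<sigma> x)))
        = (\<integral>\<^sup>+ s. ennreal (c * F s) \<partial>lborel)"
      by (rule R'(1)) (use pos in auto)
    also have "\<dots> = ennreal c * (\<integral>\<^sup>+ s. ennreal (F s) \<partial>lborel)"
      using pos c by (subst nn_integral_cmult[symmetric]) (auto simp: ennreal_mult)
    finally show ?thesis unfolding c_def .
  qed
qed

lemma hardy_integral:
  assumes [measurable]: "F \<in> borel_measurable borel" and z: "\<And>s. s \<le> 0 \<Longrightarrow> F s = 0" and pos: "\<And>s. F s \<ge> 0"
  shows "integral\<^sup>N lborel (\<lambda>x :: real ^ 'n. ennreal (norm x powr (\<alpha> - p) * F (\<sigma> x)))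
       = ennreal \<omega> * (\<integral>\<^sup>+ s. ennreal (s powr (- p) * F s) \<partial>lborel)"
proof -
  have R: "indicator {0<..} s * (\<omega> * (s powr (- p) * F s)) = \<omega> * (s powr (- p) * F s)" for s
    using z[of s] by (auto simp: indicator_def)
  show ?thesis
    using radial_integrals(1)[where \<kappa> = \<kappa> and a = "\<alpha> - p" and F = F and ?'n = 'n, OF \<kappa>0 _ pos, folded \<omega>_def, unfolded exponents(2) R]
      \<omega>_pos pos by (simp add: ennreal_mult nn_integral_cmult)
qed

lemma potential_integrals:
  assumes [measurable]: "F \<in> borel_measurable borel" and z: "\<And>s. s \<le> 0 \<Longrightarrow> F s = 0"
  shows "integrable lborel (\<lambda>x :: real ^ 'n. rhs_weight p \<alpha> q x * F (\<sigma> x)) \<longleftrightarrow> integrable lborel (\<lambda>s. wt s * F s)"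
    and "integral\<^sup>L lborel (\<lambda>x :: real ^ 'n. rhs_weight p \<alpha> q x * F (\<sigma> x)) = \<omega> * (LINT s|lborel. wt s * F s)"
proof -
  have R: "indicator {0<..} s * (\<omega> * (wt s * F s)) = \<omega> * (wt s * F s)" for s
    using z[of s] by (auto simp: indicator_def)
  note R' = radial_integrals[where \<kappa> = \<kappa> and a = "- real CARD('n) + q * ((real CARD('n) - p + \<alpha>) / p)" and F = F and ?'n = 'n,
      OF \<kappa>0, folded \<omega>_def, unfolded exponents(3) R, folded rhs_weight_def]
  show "integrable lborel (\<lambda>x :: real ^ 'n. rhs_weight p \<alpha> q x * F (\<sigma> x)) \<longleftrightarrow> integrable lborel (\<lambda>s. wt s * F s)"
    using R'(2) \<omega>_pos by simp
  show "integral\<^sup>L lborel (\<lambda>x :: real ^ 'n. rhs_weight p \<alpha> q x * F (\<sigma> x)) = \<omega> * (LINT s|lborel. wt s * F s)"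
    using R'(3) by simp
qed

section \<open>Elements of the space and their profiles\<close>

lemma AE_nonzero: "AE x in lborel. x \<noteq> (0 :: real ^ 'n)"
  using AE_lborel_singleton[of "0 :: real ^ 'n"] by simp

text \<open>The approximating gradients are multiples of \<sigma>' by functions of \<sigma>, and
  almost everywhere convergence of a subsequence passes this form on to the limit. The change of
  variables then turns the convergence of gradients into an \<open>energy_limit\<close>, and a
  subsequence for the Hardy norm identifies u with the primitive.\<close>

lemma D_structure:
  fixes u :: "real ^ 'n \<Rightarrow> real" and D :: "real ^ 'n \<Rightarrow> real ^ 'n"
  assumes u: "has_D_gradient p \<alpha> u D"
  obtains \<psi> \<psi>' g where "energy_limit \<psi> \<psi>' g" "\<And>s. s \<le> 0 \<Longrightarrow> g s = 0"
    "AE x in lborel. u x = prim g (\<sigma> x)" "AE x in lborel. D x = g (\<sigma> x) *\<^sub>R \<sigma>' x"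
proof -
  have [measurable]: "u \<in> borel_measurable borel" "D \<in> borel_measurable borel"
    using u by (auto simp: has_D_gradient_def)
  obtain f where f: "\<And>k. f k \<in> C1_c_radial"
    and lim1: "(\<lambda>k. \<integral>\<^sup>+ x. ennreal (norm x powr (\<alpha> - p) * \<bar>f k x - u x\<bar> powr p) \<partial>lborel) \<longlonglongrightarrow> 0"
    and lim2: "(\<lambda>k. \<integral>\<^sup>+ x. ennreal (norm x powr \<alpha> * norm (gradient (f k) x - D x) powr p) \<partial>lborel) \<longlonglongrightarrow> 0"
    using u by (auto simp: has_D_gradient_def)
  have "\<exists>\<psi> \<psi>'. cc1 \<psi> \<psi>' \<and> (\<forall>x. x \<noteq> 0 \<longrightarrow> f k x = \<psi> (\<sigma> x)) \<and> (\<forall>x. x \<noteq> 0 \<longrightarrow> gradient (f k) x = \<psi>' (\<sigma> x) *\<^sub>R \<sigma>' x)" for k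
    by (rule cc1_of_C1_c_radial[OF \<kappa>0 f[of k]]) blast
  then obtain \<psi> \<psi>' where cc: "\<And>k. cc1 (\<psi> k) (\<psi>' k)" and fk: "\<And>k x. x \<noteq> 0 \<Longrightarrow> f k x = \<psi> k (\<sigma> x)"
    and gk: "\<And>k x. x \<noteq> 0 \<Longrightarrow> gradient (f k) x = \<psi>' k (\<sigma> x) *\<^sub>R \<sigma>' x"
    by metis
  have [measurable]: "\<psi> k \<in> borel_measurable borel" "\<psi>' k \<in> borel_measurable borel" for k
    using cc1_measurable[OF cc] by auto
  define h1 where "h1 k x = norm x powr (\<alpha> - p) * \<bar>\<psi> k (\<sigma> x) - u x\<bar> powr p" for k x
  define h2 where "h2 k x = norm x powr \<alpha> * norm (\<psi>' k (\<sigma> x) *\<^sub>R \<sigma>' x - D x) powr p" for k x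
  have l1: "(\<lambda>k. \<integral>\<^sup>+ x. ennreal (h1 k x) \<partial>lborel) \<longlonglongrightarrow> 0"
  proof -
    have "(\<integral>\<^sup>+ x. ennreal (norm x powr (\<alpha> - p) * \<bar>f k x - u x\<bar> powr p) \<partial>lborel) = (\<integral>\<^sup>+ x. ennreal (h1 k x) \<partial>lborel)" for k
      using AE_nonzero by (intro nn_integral_cong_AE, eventually_elim) (simp add: h1_def fk)
    then show ?thesis using lim1 by simp
  qed
  have l2: "(\<lambda>k. \<integral>\<^sup>+ x. ennreal (h2 k x) \<partial>lborel) \<longlonglongrightarrow> 0"
  proof -
    have "(\<integral>\<^sup>+ x. ennreal (norm x powr \<alpha> * norm (gradient (f k) x - D x) powr p) \<partial>lborel) = (\<integral>\<^sup>+ x. ennreal (h2 k x) \<partial>lborel)" for k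
      using AE_nonzero by (intro nn_integral_cong_AE, eventually_elim) (simp add: h2_def gk)
    then show ?thesis using lim2 by simp
  qed
  obtain r where r: "strict_mono r" "AE x in lborel. (\<lambda>k. h2 (r k) x) \<longlonglongrightarrow> 0"
    by (rule nn_integral_tendsto_0_AE_subseq[OF _ _ l2]) (auto simp: h2_def)
  \<comment> \<open>A pointwise limit of functions of s, hence Borel. Where the sequence diverges
    the value is arbitrary, which concerns only a null set; for s \<le> 0 all terms are 0.\<close>
  define g where "g s = lim (\<lambda>k. \<psi>' (r k) s)" for s
  have [measurable]: "g \<in> borel_measurable borel"
    unfolding g_def[abs_def] by (rule borel_measurable_lim_metric) measurable
  have g0: "g s = 0" if "s \<le> 0" for s
    using cc1_nonpos(2)[OF cc that] by (simp add: g_def)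
  have Dg: "AE x in lborel. D x = g (\<sigma> x) *\<^sub>R \<sigma>' x"
    using r(2) AE_nonzero
  proof eventually_elim
    case (elim x)
    define d where "d = \<sigma>' x"
    have d: "d \<bullet> d \<noteq> 0" using elim(2) \<kappa>0 norm_radius_power_grad[of \<kappa> x] by (auto simp: d_def)
    have "(\<lambda>k. norm x powr (- \<alpha>) * h2 (r k) x) \<longlonglongrightarrow> norm x powr (- \<alpha>) * 0"
      by (intro tendsto_mult tendsto_const elim(1))
    moreover have "norm x powr (- \<alpha>) * h2 (r k) x = norm (\<psi>' (r k) (\<sigma> x) *\<^sub>R d - D x) powr p" for k
      using elim(2) by (simp add: h2_def d_def flip: mult.assoc powr_add)
    ultimately have "(\<lambda>k. norm (\<psi>' (r k) (\<sigma> x) *\<^sub>R d - D x) powr p) \<longlonglongrightarrow> 0" by simp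
    then have "(\<lambda>k. norm (\<psi>' (r k) (\<sigma> x) *\<^sub>R d - D x)) \<longlonglongrightarrow> 0"
      by (rule powr_tendsto_0D[rotated]) (use p in simp)
    then have conv: "(\<lambda>k. \<psi>' (r k) (\<sigma> x) *\<^sub>R d) \<longlonglongrightarrow> D x"
      by (simp add: tendsto_norm_zero_iff LIM_zero_iff)
    \<comment> \<open>The scalar product with d \<noteq> 0 extracts the coefficient, so the scalar
      sequence converges too and its limit is g.\<close>
    then have "(\<lambda>k. (\<psi>' (r k) (\<sigma> x) *\<^sub>R d) \<bullet> d / (d \<bullet> d)) \<longlonglongrightarrow> D x \<bullet> d / (d \<bullet> d)"
      using d by (intro tendsto_intros) auto
    then have c1: "(\<lambda>k. \<psi>' (r k) (\<sigma> x)) \<longlonglongrightarrow> D x \<bullet> d / (d \<bullet> d)" using d by simp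
    then have "g (\<sigma> x) = D x \<bullet> d / (d \<bullet> d)" unfolding g_def by (rule limI)
    with c1 have "(\<lambda>k. \<psi>' (r k) (\<sigma> x) *\<^sub>R d) \<longlonglongrightarrow> g (\<sigma> x) *\<^sub>R d" by (intro tendsto_intros) auto
    from LIMSEQ_unique[OF conv this] show ?case by (simp add: d_def)
  qed
  have el: "energy_limit \<psi> \<psi>' g"
    unfolding energy_limit_def
  proof (intro conjI allI cc)
    define c where "c = \<omega> * \<bar>\<kappa>\<bar> powr p"
    have c: "c > 0" using \<omega>_pos \<kappa>0 by (simp add: c_def)
    have "(\<integral>\<^sup>+ x. ennreal (h2 k x) \<partial>lborel) = ennreal c * (\<integral>\<^sup>+ s. ennreal ((\<psi>' k s - g s) powr p) \<partial>lborel)" for k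
    proof -
      have "(\<integral>\<^sup>+ x. ennreal (h2 k x) \<partial>lborel) = (\<integral>\<^sup>+ x. ennreal (norm x powr \<alpha> * norm (\<sigma>' x) powr p * (\<psi>' k (\<sigma> x) - g (\<sigma> x)) powr p) \<partial>lborel)"
        using Dg
      proof (intro nn_integral_cong_AE, eventually_elim)
        case (elim x)
        then have "h2 k x = norm x powr \<alpha> * norm ((\<psi>' k (\<sigma> x) - g (\<sigma> x)) *\<^sub>R \<sigma>' x) powr p"
          by (simp add: h2_def scaleR_diff_left)
        then show ?case by (simp add: powr_mult mult_ac)
      qed
      also have "\<dots> = ennreal c * (\<integral>\<^sup>+ s. ennreal ((\<psi>' k s - g s) powr p) \<partial>lborel)"
        unfolding c_def by (rule energy_integrals(1)) (auto simp: g0 cc1_nonpos(2)[OF cc])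
      finally show ?thesis .
    qed
    then have "(\<integral>\<^sup>+ s. ennreal ((\<psi>' k s - g s) powr p) \<partial>lborel) = ennreal (1 / c) * (\<integral>\<^sup>+ x. ennreal (h2 k x) \<partial>lborel)" for k
      using c by (simp flip: ennreal_mult' mult.assoc)
    moreover have "(\<lambda>k. ennreal (1 / c) * (\<integral>\<^sup>+ x. ennreal (h2 k x) \<partial>lborel)) \<longlonglongrightarrow> ennreal (1 / c) * 0"
      by (rule ennreal_tendsto_cmult[OF _ l2]) simp
    ultimately show "(\<lambda>j. \<integral>\<^sup>+ s. ennreal ((\<psi>' j s - g s) powr p) \<partial>lborel) \<longlonglongrightarrow> 0" by simp
  qed measurable
  obtain r' where r': "strict_mono r'" "AE x in lborel. (\<lambda>k. h1 (r' k) x) \<longlonglongrightarrow> 0"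
    by (rule nn_integral_tendsto_0_AE_subseq[OF _ _ l1]) (auto simp: h1_def)
  have "AE x in lborel. u x = prim g (\<sigma> x)"
    using r'(2) AE_nonzero
  proof eventually_elim
    case (elim x)
    have "(\<lambda>k. norm x powr (- (\<alpha> - p)) * h1 (r' k) x) \<longlonglongrightarrow> norm x powr (- (\<alpha> - p)) * 0"
      by (intro tendsto_mult tendsto_const elim(1))
    moreover have "norm x powr (- (\<alpha> - p)) * h1 (r' k) x = (\<psi> (r' k) (\<sigma> x) - u x) powr p" for k
      using elim(2) by (simp add: h1_def flip: mult.assoc powr_add)
    ultimately have "(\<lambda>k. (\<psi> (r' k) (\<sigma> x) - u x) powr p) \<longlonglongrightarrow> 0" by simp
    then have "(\<lambda>k. \<psi> (r' k) (\<sigma> x) - u x) \<longlonglongrightarrow> 0"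
      by (rule powr_tendsto_0D[rotated]) (use p in simp)
    then have "(\<lambda>k. \<psi> (r' k) (\<sigma> x)) \<longlonglongrightarrow> u x" by (simp add: LIM_zero_iff)
    moreover have "(\<lambda>k. \<psi> (r' k) (\<sigma> x)) \<longlonglongrightarrow> prim g (\<sigma> x)"
      using LIMSEQ_subseq_LIMSEQ[OF prim_limit[OF el, of "\<sigma> x"] r'(1)] by (simp add: o_def)
    ultimately show ?case by (rule LIMSEQ_unique)
  qed
  then show ?thesis using that el g0 Dg by blast
qed

text \<open>The profile is multiplied by logarithmic cut-offs. The derivative of the cut-off
  contributes v / s times a bounded factor tending to 0, and the Hardy integrability of v provides a
  dominating function, so both norms converge by dominated convergence.\<close>

lemma D_intro:
  assumes [measurable]: "v \<in> borel_measurable borel" "g \<in> borel_measurable borel"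
    and D: "\<And>s. s > 0 \<Longrightarrow> (v has_real_derivative g s) (at s)" and contg: "continuous_on {0<..} g"
    and z: "\<And>s. s \<le> 0 \<Longrightarrow> v s = 0" "\<And>s. s \<le> 0 \<Longrightarrow> g s = 0"
    and I1: "integrable lborel (\<lambda>s. g s powr p)" and I2: "integrable lborel (\<lambda>s. s powr (- p) * v s powr p)"
  shows "has_D_gradient p \<alpha> (\<lambda>x. v (\<sigma> x)) (\<lambda>x. g (\<sigma> x) *\<^sub>R \<sigma>' x)"
proof -
  define t where "t k s = ln s / (real k + 1)" for k :: nat and s :: real
  define \<psi> where "\<psi> k s = (if s > 0 then v s * cutoff (t k s) else 0)" for k s
  define \<psi>' where "\<psi>' k s = (if s > 0 then g s * cutoff (t k s) + v s / s * (cutoff' (t k s) / (real k + 1)) else 0)" for k s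
  have [measurable]: "t k \<in> borel_measurable borel" for k unfolding t_def[abs_def] by measurable
  have [measurable]: "\<psi> k \<in> borel_measurable borel" "\<psi>' k \<in> borel_measurable borel" for k
    unfolding \<psi>_def[abs_def] \<psi>'_def[abs_def] by measurable
  have cont': "continuous_on S cutoff'" for S unfolding cutoff'_def[abs_def] by (intro continuous_intros)
  have contc: "continuous_on S cutoff" for S unfolding cutoff_def[abs_def] by (intro continuous_intros)
  have cc: "cc1 (\<psi> k) (\<psi>' k)" for k
  proof -
    define a where "a = exp (- (real k + 1))"
    define b where "b = exp (real k + 1)"
    have ab: "0 < a" "a < b" by (auto simp: a_def b_def)
    have z0: "\<psi> k s = 0" "\<psi>' k s = 0" if "s \<notin> {a..b}" for s
    proof -
      have "\<bar>t k s\<bar> \<ge> 1" if "s > 0"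
      proof -
        have "ln a = - (real k + 1)" "ln b = real k + 1" by (simp_all add: a_def b_def)
        moreover have "s < a \<or> b < s" using \<open>s \<notin> {a..b}\<close> by auto
        then have "ln s < ln a \<or> ln b < ln s" using \<open>s > 0\<close> ab by auto
        ultimately have "real k + 1 \<le> \<bar>ln s\<bar>" by linarith
        then have "1 \<le> \<bar>ln s\<bar> / (real k + 1)" by (simp add: le_divide_eq)
        then show ?thesis by (simp add: t_def abs_divide)
      qed
      then show "\<psi> k s = 0" "\<psi>' k s = 0" by (auto simp: \<psi>_def \<psi>'_def cutoff_bounds)
    qed
    have Dp: "(\<psi> k has_real_derivative \<psi>' k s) (at s)" if s: "s > 0" for s
    proof -
      have "(t k has_real_derivative (1 / s) / (real k + 1)) (at s)"
        unfolding t_def[abs_def] using s by (intro DERIV_cdivide) (auto intro!: derivative_eq_intros)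
      from DERIV_mult[OF D[OF s] DERIV_chain2[OF DERIV_cutoff this]]
      have "((\<lambda>s. v s * cutoff (t k s)) has_real_derivative \<psi>' k s) (at s)"
        using s by (simp add: \<psi>'_def mult_ac)
      then show ?thesis
        by (rule has_field_derivative_transform_within_open[of _ _ _ "{0<..}"]) (use s in \<open>auto simp: \<psi>_def\<close>)
    qed
    have "(\<psi> k has_real_derivative \<psi>' k s) (at s)" for s
    proof (cases "s > 0")
      case False
      have "((\<lambda>_. 0) has_real_derivative 0) (at s)" by simp
      then have "(\<psi> k has_real_derivative 0) (at s)"
        by (rule has_field_derivative_transform_within_open[of _ _ _ "{..<a}"]) (use False ab z0 in auto)
      then show ?thesis using False by (simp add: \<psi>'_def)
    qed (rule Dp)
    moreover have "continuous_on UNIV (\<psi>' k)"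
    proof -
      have "continuous_on {..<a} (\<psi>' k)"
        by (subst continuous_on_cong[OF refl, of _ _ "\<lambda>_. 0"]) (use z0 in auto)
      moreover have "continuous_on {0<..} (\<psi>' k)"
      proof -
        have cv: "continuous_on {0<..} v"
          using D by (intro continuous_at_imp_continuous_on) (auto intro: DERIV_isCont)
        have ct: "continuous_on {0<..} (t k)" unfolding t_def[abs_def] by (intro continuous_intros) auto
        have "continuous_on {0<..} (\<lambda>s. g s * cutoff (t k s) + v s / s * (cutoff' (t k s) / (real k + 1)))"
          by (intro continuous_intros contg cv continuous_on_compose2[OF contc[of UNIV] ct] continuous_on_compose2[OF cont'[of UNIV] ct]) auto
        then show ?thesis by (subst continuous_on_cong[OF refl, of _ "\<psi>' k"]) (auto simp: \<psi>'_def)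
      qed
      ultimately have "continuous_on ({..<a} \<union> {0<..}) (\<psi>' k)" by (rule continuous_on_open_Un[rotated 2]) auto
      moreover have "{..<a} \<union> {0<..} = UNIV" using ab by auto
      ultimately show ?thesis by simp
    qed
    ultimately show ?thesis unfolding cc1_def using ab z0 by blast
  qed
  have limt: "(\<lambda>k. t k s) \<longlonglongrightarrow> 0" for s
    unfolding t_def by real_asymp
  have limc: "(\<lambda>k. cutoff (t k s)) \<longlonglongrightarrow> 1" for s
  proof -
    have "isCont cutoff 0" using contc[of UNIV] by (simp add: continuous_on_eq_continuous_at)
    from isCont_tendsto_compose[OF this limt] show ?thesis by (simp add: cutoff_def)
  qed
  have limc': "(\<lambda>k. cutoff' (t k s) / (real k + 1)) \<longlonglongrightarrow> 0" for s
  proof (rule Lim_null_comparison)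
    show "(\<lambda>k. 4 / (real k + 1)) \<longlonglongrightarrow> 0" by real_asymp
    show "eventually (\<lambda>k. norm (cutoff' (t k s) / (real k + 1)) \<le> 4 / (real k + 1)) sequentially"
      using cutoff_bounds(3) by (intro always_eventually) (auto intro!: divide_right_mono simp: abs_mult)
  qed
  have e1: "(\<lambda>k. \<integral>\<^sup>+ s. ennreal (s powr (- p) * \<bar>\<psi> k s - v s\<bar> powr p) \<partial>lborel) \<longlonglongrightarrow> (\<integral>\<^sup>+ (s::real). 0 \<partial>lborel)"
  proof (rule nn_integral_dominated_convergence[where w = "\<lambda>s. ennreal (s powr (- p) * v s powr p)"])
    show "(\<integral>\<^sup>+ s. ennreal (s powr (- p) * v s powr p) \<partial>lborel) < \<infinity>"
      using I2 by (subst nn_integral_eq_integral) auto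
    show "AE s in lborel. ennreal (s powr (- p) * \<bar>\<psi> k s - v s\<bar> powr p) \<le> ennreal (s powr (- p) * v s powr p)" for k
    proof (rule AE_I2)
      fix s
      have "\<bar>\<psi> k s - v s\<bar> \<le> \<bar>v s\<bar>"
      proof (cases "s > 0")
        case True
        then have "\<psi> k s - v s = v s * (cutoff (t k s) - 1)" by (simp add: \<psi>_def algebra_simps)
        moreover have "\<bar>cutoff (t k s) - 1\<bar> = 1 - cutoff (t k s)" using cutoff_bounds(2)[of "t k s"] by simp
        ultimately have "\<bar>\<psi> k s - v s\<bar> = \<bar>v s\<bar> * (1 - cutoff (t k s))" by (simp add: abs_mult)
        also have "\<dots> \<le> \<bar>v s\<bar> * 1" using cutoff_bounds(1)[of "t k s"] by (intro mult_left_mono) auto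
        finally show ?thesis by simp
      qed (simp add: \<psi>_def)
      then have "\<bar>\<psi> k s - v s\<bar> powr p \<le> \<bar>v s\<bar> powr p" using p by (intro powr_mono2) auto
      then show "ennreal (s powr (- p) * \<bar>\<psi> k s - v s\<bar> powr p) \<le> ennreal (s powr (- p) * v s powr p)"
        by (intro ennreal_leI mult_left_mono) auto
    qed
    show "AE s in lborel. (\<lambda>k. ennreal (s powr (- p) * \<bar>\<psi> k s - v s\<bar> powr p)) \<longlonglongrightarrow> 0"
    proof (rule AE_I2)
      fix s
      have "(\<lambda>k. \<psi> k s) \<longlonglongrightarrow> v s"
      proof (cases "s > 0")
        case True
        then show ?thesis using tendsto_mult[OF tendsto_const limc, of "v s" s] by (simp add: \<psi>_def)
      qed (use z in \<open>simp add: \<psi>_def\<close>)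
      then have "(\<lambda>k. \<bar>\<psi> k s - v s\<bar>) \<longlonglongrightarrow> 0" by (simp add: tendsto_rabs_zero_iff LIM_zero_iff)
      then have "(\<lambda>k. s powr (- p) * \<bar>\<psi> k s - v s\<bar> powr p) \<longlonglongrightarrow> s powr (- p) * 0 powr p"
        using p by (intro tendsto_mult tendsto_const isCont_tendsto_compose[OF isCont_abs_powr]) auto
      then show "(\<lambda>k. ennreal (s powr (- p) * \<bar>\<psi> k s - v s\<bar> powr p)) \<longlonglongrightarrow> 0"
        by (subst ennreal_0[symmetric], intro tendsto_ennrealI) simp
    qed
  qed measurable
  \<comment> \<open>The majorant comes from \<open>powr_add_le\<close> with t = 1 / 2; the number 4
    is the bound for the derivative of the cut-off.\<close>
  define w where "w s = (1 - 1 / 2) powr (1 - p) * g s powr p + (1 / 2) powr (1 - p) * (4 powr p * (s powr (- p) * v s powr p))" for s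
  have Iw: "integrable lborel w" unfolding w_def[abs_def] using I1 I2 by auto
  have [measurable]: "w \<in> borel_measurable borel" unfolding w_def[abs_def] by measurable
  have w0: "w s \<ge> 0" for s by (simp add: w_def)
  have e2: "(\<lambda>k. \<integral>\<^sup>+ s. ennreal ((\<psi>' k s - g s) powr p) \<partial>lborel) \<longlonglongrightarrow> (\<integral>\<^sup>+ (s::real). 0 \<partial>lborel)"
  proof (rule nn_integral_dominated_convergence[where w = "\<lambda>s. ennreal (w s)"])
    show "(\<integral>\<^sup>+ s. ennreal (w s) \<partial>lborel) < \<infinity>"
      using Iw w0 by (subst nn_integral_eq_integral) auto
    show "AE s in lborel. ennreal ((\<psi>' k s - g s) powr p) \<le> ennreal (w s)" for k
    proof (intro AE_I2 ennreal_leI)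
      fix s
      show "(\<psi>' k s - g s) powr p \<le> w s"
      proof (cases "s > 0")
        case True
        define A where "A = g s * (cutoff (t k s) - 1)"
        define B where "B = v s / s * (cutoff' (t k s) / (real k + 1))"
        have eq: "\<psi>' k s - g s = A + B" using True by (simp add: \<psi>'_def A_def B_def algebra_simps)
        have "\<bar>A\<bar> \<le> \<bar>g s\<bar> * 1" unfolding A_def abs_mult
          using cutoff_bounds(1,2)[of "t k s"] by (intro mult_left_mono) auto
        then have A: "A powr p \<le> g s powr p" using p powr_mono2[of p "\<bar>A\<bar>" "\<bar>g s\<bar>"] by simp
        have "\<bar>cutoff' (t k s) / (real k + 1)\<bar> \<le> 4 / 1" unfolding abs_divide
          using cutoff_bounds(3)[of "t k s"] by (intro frac_le) auto
        then have "\<bar>B\<bar> \<le> \<bar>v s / s\<bar> * 4" unfolding B_def abs_mult by (intro mult_left_mono) auto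
        then have "B powr p \<le> (\<bar>v s / s\<bar> * 4) powr p" using p powr_mono2[of p "\<bar>B\<bar>" "\<bar>v s / s\<bar> * 4"] by simp
        also have "\<dots> = 4 powr p * (s powr (- p) * v s powr p)"
          using True by (simp add: powr_mult powr_divide powr_minus_divide)
        finally have B: "B powr p \<le> 4 powr p * (s powr (- p) * v s powr p)" .
        have "(A + B) powr p \<le> (1 - 1 / 2) powr (1 - p) * A powr p + (1 / 2) powr (1 - p) * B powr p"
          by (rule powr_add_le[OF p]) auto
        also have "\<dots> \<le> w s" unfolding w_def by (intro add_mono mult_left_mono A B) auto
        finally show ?thesis unfolding eq .
      qed (use z w0 in \<open>simp add: \<psi>'_def\<close>)
    qed
    show "AE s in lborel. (\<lambda>k. ennreal ((\<psi>' k s - g s) powr p)) \<longlonglongrightarrow> 0"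
    proof (rule AE_I2)
      fix s
      have "(\<lambda>k. \<psi>' k s) \<longlonglongrightarrow> g s"
      proof (cases "s > 0")
        case True
        have "(\<lambda>k. g s * cutoff (t k s) + v s / s * (cutoff' (t k s) / (real k + 1))) \<longlonglongrightarrow> g s * 1 + v s / s * 0"
          by (intro tendsto_add tendsto_mult tendsto_const limc limc')
        then show ?thesis using True by (simp add: \<psi>'_def)
      qed (use z in \<open>simp add: \<psi>'_def\<close>)
      then have "(\<lambda>k. \<psi>' k s - g s) \<longlonglongrightarrow> 0" by (simp add: LIM_zero_iff)
      then have "(\<lambda>k. (\<psi>' k s - g s) powr p) \<longlonglongrightarrow> 0 powr p"
        using p by (intro isCont_tendsto_compose[OF isCont_abs_powr]) auto
      then show "(\<lambda>k. ennreal ((\<psi>' k s - g s) powr p)) \<longlonglongrightarrow> 0"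
        by (subst ennreal_0[symmetric], intro tendsto_ennrealI) simp
    qed
  qed measurable
  show ?thesis
    unfolding has_D_gradient_def
  proof (intro conjI exI allI)
    show "(\<lambda>x. \<psi> k (\<sigma> x)) \<in> C1_c_radial" for k by (rule C1_c_radial_of_cc1(1)[OF \<kappa>0 cc])
    have "integral\<^sup>N lborel (\<lambda>x :: real ^ 'n. ennreal (norm x powr (\<alpha> - p) * \<bar>\<psi> k (\<sigma> x) - v (\<sigma> x)\<bar> powr p))
      = ennreal \<omega> * (\<integral>\<^sup>+ s. ennreal (s powr (- p) * \<bar>\<psi> k s - v s\<bar> powr p) \<partial>lborel)" for k
      by (rule hardy_integral) (auto simp: z \<psi>_def)
    moreover have "(\<lambda>k. ennreal \<omega> * (\<integral>\<^sup>+ s. ennreal (s powr (- p) * \<bar>\<psi> k s - v s\<bar> powr p) \<partial>lborel)) \<longlonglongrightarrow> ennreal \<omega> * (\<integral>\<^sup>+ (s::real). 0 \<partial>lborel)"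
      by (rule ennreal_tendsto_cmult[OF _ e1]) simp
    ultimately show "(\<lambda>k. \<integral>\<^sup>+ x. ennreal (norm x powr (\<alpha> - p) * \<bar>\<psi> k (\<sigma> x) - v (\<sigma> x)\<bar> powr p) \<partial>lborel) \<longlonglongrightarrow> 0"
      by simp
    have "integral\<^sup>N lborel (\<lambda>x :: real ^ 'n. ennreal (norm x powr \<alpha> * norm (gradient (\<lambda>x. \<psi> k (\<sigma> x)) x - g (\<sigma> x) *\<^sub>R \<sigma>' x) powr p))
      = ennreal (\<omega> * \<bar>\<kappa>\<bar> powr p) * (\<integral>\<^sup>+ s. ennreal ((\<psi>' k s - g s) powr p) \<partial>lborel)" for k
    proof -
      have eq: "norm x powr \<alpha> * norm (gradient (\<lambda>x. \<psi> k (\<sigma> x)) x - g (\<sigma> x) *\<^sub>R \<sigma>' x) powr p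
         = norm x powr \<alpha> * norm (\<sigma>' x) powr p * (\<psi>' k (\<sigma> x) - g (\<sigma> x)) powr p" for x
        unfolding C1_c_radial_of_cc1(2)[OF \<kappa>0 cc] scaleR_diff_left[symmetric]
        by (simp add: powr_mult mult_ac)
      show ?thesis unfolding eq by (rule energy_integrals(1)) (auto simp: z \<psi>'_def)
    qed
    moreover have "(\<lambda>k. ennreal (\<omega> * \<bar>\<kappa>\<bar> powr p) * (\<integral>\<^sup>+ s. ennreal ((\<psi>' k s - g s) powr p) \<partial>lborel)) \<longlonglongrightarrow> ennreal (\<omega> * \<bar>\<kappa>\<bar> powr p) * (\<integral>\<^sup>+ (s::real). 0 \<partial>lborel)"
      by (rule ennreal_tendsto_cmult[OF _ e2]) simp
    ultimately show "(\<lambda>k. \<integral>\<^sup>+ x. ennreal (norm x powr \<alpha> * norm (gradient (\<lambda>x. \<psi> k (\<sigma> x)) x - g (\<sigma> x) *\<^sub>R \<sigma>' x) powr p) \<partial>lborel) \<longlonglongrightarrow> 0"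
      by simp
  qed measurable
qed

end

section \<open>Weak solutions\<close>

text \<open>By continuity the set of disagreement is open, and a nonempty open set is not
  negligible.\<close>

lemma AE_eq_imp_eq_pos:
  fixes f h :: "real \<Rightarrow> real"
  assumes f: "continuous_on {0<..} f" and h: "continuous_on {0<..} h" and ae: "AE s in lborel. 0 < s \<longrightarrow> f s = h s" and s: "s > 0"
  shows "f s = h s"
proof (rule ccontr)
  assume ne: "f s \<noteq> h s"
  define S where "S = {t \<in> {0<..}. f t - h t \<noteq> 0}"
  have "open ((\<lambda>t. f t - h t) -` (- {0}) \<inter> {0<..})"
    by (rule continuous_on_open_vimage[THEN iffD1, rule_format]) (auto intro!: continuous_intros f h)
  also have "(\<lambda>t. f t - h t) -` (- {0}) \<inter> {0<..} = S" by (auto simp: S_def)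
  finally have "open S" .
  have "S = {t \<in> space lborel. \<not> (0 < t \<longrightarrow> f t = h t)}" by (auto simp: S_def)
  moreover have "{t \<in> space lborel. \<not> (0 < t \<longrightarrow> f t = h t)} \<in> null_sets lborel"
    using ae \<open>open S\<close> calculation by (subst AE_iff_null[symmetric]) (auto intro: borel_open)
  ultimately have "negligible S"
    by (simp add: negligible_iff_null_sets null_sets_completionI)
  moreover have "S \<noteq> {}" using ne s by (auto simp: S_def)
  ultimately show False using open_not_negligible[OF \<open>open S\<close>] by blast
qed

context bliss begin

text \<open>Under the integral g may be replaced by its continuous representative f, which makes the
  primitive classically differentiable.\<close>

lemma DERIV_prim:
  assumes lim: "energy_limit \<psi> \<psi>' g" and ae: "AE s in lborel. 0 < s \<longrightarrow> g s = f s" and cont: "continuous_on {0<..} f" and s: "s > 0"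
  shows "(prim g has_real_derivative f s) (at s)"
proof -
  note [measurable] = energy_limit_measurable(1)[OF lim]
  define a where "a = s / 2"
  have a: "0 < a" "a < s" using s by (auto simp: a_def)
  have contf: "continuous_on {a..t} f" for t by (rule continuous_on_subset[OF cont]) (use a in auto)
  have eq: "prim g t = prim g a + integral {a..t} f" if "t \<ge> a" for t
  proof -
    have sf: "set_integrable lborel {a..t} f" by (rule borel_integrable_atLeastAtMost'[OF contf])
    have "prim g t - prim g a = (LINT r:{a..t}|lborel. g r)" using a that by (intro prim_Icc[OF lim]) auto
    also have "\<dots> = (LINT r:{a..t}|lborel. f r)"
      unfolding set_lebesgue_integral_def
    proof (rule integral_cong_AE)
      show "AE r in lborel. indicator {a..t} r *\<^sub>R g r = indicator {a..t} r *\<^sub>R f r"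
        using ae by eventually_elim (use a in \<open>auto simp: indicator_def\<close>)
      show "(\<lambda>r. indicator {a..t} r *\<^sub>R f r) \<in> borel_measurable lborel"
        using sf by (simp add: set_integrable_def)
    qed measurable
    also have "\<dots> = integral {a..t} f" by (rule set_borel_integral_eq_integral(2)[OF sf])
    finally show ?thesis by simp
  qed
  have "((\<lambda>t. integral {a..t} f) has_vector_derivative f s) (at s within {a..s + 1})"
    using a by (intro integral_has_vector_derivative contf) auto
  then have "((\<lambda>t. integral {a..t} f) has_vector_derivative f s) (at s within {a<..<s + 1})"
    by (rule has_vector_derivative_within_subset) auto
  moreover have "s \<in> {a<..<s + 1}" using a by simp
  ultimately have "((\<lambda>t. integral {a..t} f) has_real_derivative f s) (at s)"
    unfolding has_real_derivative_iff_has_vector_derivative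
    using has_vector_derivative_within_open[OF _ open_greaterThanLessThan] by blast
  then have "((\<lambda>t. prim g a + integral {a..t} f) has_real_derivative 0 + f s) (at s)"
    by (intro DERIV_add DERIV_const)
  then have "((\<lambda>t. prim g a + integral {a..t} f) has_real_derivative f s) (at s)" by simp
  then show ?thesis
    by (rule has_field_derivative_transform_within_open[of _ _ _ "{a<..}"]) (use a eq[symmetric] in auto)
qed

text \<open>Two continuous functions that agree almost everywhere agree everywhere, so g and v' have
  the same integral over each interval. This pins down the weak derivative of a classically known
  profile.\<close>

lemma prim_unique:
  assumes lim: "energy_limit \<psi> \<psi>' g" and D: "\<And>s. s > 0 \<Longrightarrow> (v has_real_derivative v' s) (at s)"
    and cont: "continuous_on {0<..} v'" and [measurable]: "v' \<in> borel_measurable borel"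
    and ae: "AE s in lborel. 0 < s \<longrightarrow> prim g s = v s"
  shows "AE s in lborel. 0 < s \<longrightarrow> g s = v' s"
proof -
  note [measurable] = energy_limit_measurable(1)[OF lim]
  have contv: "continuous_on {0<..} v"
    using D by (intro continuous_at_imp_continuous_on) (auto intro: DERIV_isCont)
  have eq: "prim g s = v s" if "s > 0" for s
    by (rule AE_eq_imp_eq_pos[OF prim_continuous[OF lim] contv ae that])
  have contS: "continuous_on {a..b} v'" if "a > 0" for a b by (rule continuous_on_subset[OF cont]) (use that in auto)
  have "AE s in lborel. 0 < s \<longrightarrow> g s - v' s = 0"
  proof (rule AE_eq_0_of_integral_Icc_eq_0)
    fix a b :: real assume ab: "0 < a" "a < b"
    have sg: "set_integrable lborel {a..b} g"
      using set_integrable_of_powr(1)[OF p energy_limit_measurable(1)[OF lim] energy_limit_integrable[OF lim]] ab by auto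
    have sv: "set_integrable lborel {a..b} v'" by (rule borel_integrable_atLeastAtMost'[OF contS[OF ab(1)]])
    show "set_integrable lborel {a..b} (\<lambda>s. g s - v' s)" by (rule set_integral_diff(1)[OF sg sv])
    have "(LINT s:{a..b}|lborel. g s) = v b - v a" using prim_Icc[OF lim, of a b] ab eq by simp
    moreover have "(LBINT s. indicator {a..b} s *\<^sub>R v' s) = v b - v a"
    proof (rule integral_FTC_atLeastAtMost[OF _ _ contS[OF ab(1)]])
      show "(v has_vector_derivative v' s) (at s within {a..b})" if "a \<le> s" "s \<le> b" for s
        using D[of s] that ab by (metis has_real_derivative_iff_has_vector_derivative has_vector_derivative_at_within less_le_trans)
    qed (use ab in simp)
    ultimately show "(LINT s:{a..b}|lborel. g s - v' s) = 0"
      unfolding set_integral_diff(2)[OF sg sv] by (simp add: set_lebesgue_integral_def)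
  qed measurable
  then show ?thesis by auto
qed

text \<open>The factor \<open>c\<close> is absorbed by scaling the amplitude.\<close>

lemma distributional_solution:
  assumes lim: "energy_limit \<psi> \<psi>' g" and c: "c > 0"
    and eq: "\<And>\<phi> \<phi>'. cc1 \<phi> \<phi>' \<Longrightarrow> (LINT s|lborel. spow (p - 1) (g s) * \<phi>' s)
       = c * (LINT s|lborel. wt s * (spow (q - 1) (prim g s) * \<phi> s))"
    and nontriv: "\<exists>s>0. prim g s \<noteq> 0"
  defines "C \<equiv> (q * \<gamma> / c) powr (1 / (q - p))"
  shows "\<exists>\<tau>>0. \<exists>\<epsilon>\<in>{1,-1}. \<forall>s>0. prim g s = C * (\<epsilon> * (\<tau> powr (- \<gamma>) * V (\<tau> * s)))"
proof -
  note [measurable] = energy_limit_measurable(1)[OF lim]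
  have q\<gamma>: "q * \<gamma> > 0" using \<gamma>_pos p q by simp
  then have qc: "q * \<gamma> / c > 0" using c by (rule divide_pos_pos)
  then have C: "C > 0" unfolding C_def by (subst powr_gt_zero) linarith
  have Cqp: "C powr (q - p) = q * \<gamma> / c"
  proof -
    have "1 / (q - p) * (q - p) = 1" using q by simp
    then show ?thesis unfolding C_def powr_powr using powr_one[OF less_imp_le[OF qc]] by simp
  qed
  define R where "R s = - (c * (wt s * spow (q - 1) (prim g s)))" for s
  have contR: "continuous_on {0<..} R"
    unfolding R_def[abs_def] using p q
    by (intro continuous_intros continuous_on_compose2[OF continuous_on_spow[of "q - 1" UNIV] prim_continuous[OF lim]]) auto
  \<comment> \<open>An antiderivative of the right-hand side: integration by parts turns the weak
    equation into orthogonality of the difference H to all derivatives of test profiles.\<close>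
  obtain K where K: "\<And>s. s > 0 \<Longrightarrow> (K has_real_derivative R s) (at s)"
  proof -
    have "\<exists>K. \<forall>s. ereal 0 < ereal s \<longrightarrow> ereal s < \<infinity> \<longrightarrow> (K has_vector_derivative R s) (at s)"
      using contR by (intro einterval_antiderivative) (auto simp: continuous_on_eq_continuous_at)
    then show ?thesis using that by (auto simp: has_real_derivative_iff_has_vector_derivative)
  qed
  have contK: "continuous_on {0<..} K"
    using K by (intro continuous_at_imp_continuous_on) (auto intro: DERIV_isCont)
  have contK': "continuous_on {a..b} K" if "a > 0" for a b by (rule continuous_on_subset[OF contK]) (use that in auto)
  define H where "H s = spow (p - 1) (g s) - indicator {0<..} s *\<^sub>R K s" for s
  have [measurable]: "(\<lambda>s. indicator {0<..} s *\<^sub>R K s) \<in> borel_measurable borel"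
    by (rule borel_measurable_continuous_on_indicator[OF _ contK]) simp
  have [measurable]: "H \<in> borel_measurable borel" unfolding H_def[abs_def] by measurable
  have sp: "set_integrable lborel {a..b} (\<lambda>s. spow (p - 1) (g s))" if "a \<le> b" for a b
  proof (rule set_integrable_of_powr(1)[OF _ _ _ that])
    show "1 < p / (p - 1)" using p by simp
    show "integrable lborel (\<lambda>s. spow (p - 1) (g s) powr (p / (p - 1)))"
      using energy_limit_integrable[OF lim] p by simp
  qed measurable
  obtain m where m: "AE s in lborel. 0 < s \<longrightarrow> H s = m"
  proof (rule du_Bois_Reymond[of H])
    fix a b :: real assume ab: "0 < a" "a < b"
    have "set_integrable lborel {a..b} (\<lambda>s. indicator {0<..} s *\<^sub>R K s)"
      by (rule set_integrable_cong[THEN iffD1, OF refl refl _ borel_integrable_atLeastAtMost'[OF contK'[OF ab(1)]]])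
         (use ab in auto)
    with sp[of a b] ab show "set_integrable lborel {a..b} H"
      unfolding H_def[abs_def] by (intro set_integral_diff(1)) auto
  next
    fix \<phi> \<phi>' assume cc: "cc1 \<phi> \<phi>'"
    have z: "s \<le> 0 \<Longrightarrow> \<phi>' s = 0" for s using cc1_nonpos(2)[OF cc] .
    have I1: "integrable lborel (\<lambda>s. spow (p - 1) (g s) * \<phi>' s)"
    proof (rule Holder_inequality_integral(1)[of _ _ _ "p / (p - 1)" p])
      show "1 < p / (p - 1)" "1 / (p / (p - 1)) + 1 / p = 1" using p by (auto simp: field_simps)
      show "integrable lborel (\<lambda>s. spow (p - 1) (g s) powr (p / (p - 1)))"
        using energy_limit_integrable[OF lim] p by simp
      show "integrable lborel (\<lambda>s. \<phi>' s powr p)" by (rule cc1_integrable_energy[OF cc])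
    qed (use p cc1_measurable[OF cc] in auto)
    note bp = cc1_by_parts[OF cc K contR]
    have "(LINT s|lborel. H s * \<phi>' s) = (LINT s|lborel. spow (p - 1) (g s) * \<phi>' s - K s * \<phi>' s)"
      by (rule Bochner_Integration.integral_cong) (use z in \<open>auto simp: H_def indicator_def algebra_simps\<close>)
    also have "\<dots> = (LINT s|lborel. spow (p - 1) (g s) * \<phi>' s) + (LINT s|lborel. R s * \<phi> s)"
      using I1 bp by simp
    also have "(LINT s|lborel. R s * \<phi> s) = - (LINT s|lborel. spow (p - 1) (g s) * \<phi>' s)"
    proof -
      have "(LINT s|lborel. R s * \<phi> s) = (LINT s|lborel. - (c * (wt s * (spow (q - 1) (prim g s) * \<phi> s))))"
        by (rule Bochner_Integration.integral_cong) (auto simp: R_def)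
      then show ?thesis unfolding eq[OF cc] by simp
    qed
    finally show "(LINT s|lborel. H s * \<phi>' s) = 0" by simp
  qed (auto intro: that)
  \<comment> \<open>The continuous representative of the momentum. It is differentiable by
    construction, and inverting \<open>spow (p - 1)\<close> makes the derivative of the profile
    continuous too.\<close>
  define y where "y s = K s + m" for s
  have gy: "AE s in lborel. 0 < s \<longrightarrow> g s = spow (1 / (p - 1)) (y s)"
    using m
  proof eventually_elim
    case (elim s)
    show ?case
    proof
      assume "0 < s"
      then have "y s = spow (p - 1) (g s)" using elim by (simp add: H_def y_def)
      then show "g s = spow (1 / (p - 1)) (y s)" using p by (simp add: spow_spow)
    qed
  qed
  have Dy: "(y has_real_derivative R s) (at s)" if "s > 0" for s
    unfolding y_def[abs_def] using DERIV_add[OF K[OF that] DERIV_const] by simp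
  have contg: "continuous_on {0<..} (\<lambda>s. spow (1 / (p - 1)) (y s))"
    unfolding y_def using p
    by (intro continuous_on_compose2[OF continuous_on_spow[of "1 / (p - 1)" UNIV]] continuous_intros contK) auto
  have Dv: "(prim g has_real_derivative spow (1 / (p - 1)) (y s)) (at s)" if "s > 0" for s
    by (rule DERIV_prim[OF lim gy contg that])
  define v1 where "v1 s = prim g s / C" for s
  define y1 where "y1 s = y s / C powr (p - 1)" for s
  have spC: "spow a (x / C) = spow a x / C powr a" for a x
    using spow_mult[of a x "1 / C"] C by (simp add: spow_pos powr_divide)
  have "\<exists>\<tau>>0. \<exists>\<epsilon>\<in>{1,-1}. \<forall>s>0. v1 s = \<epsilon> * (\<tau> powr (- \<gamma>) * V (\<tau> * s))"
  proof (rule classify_extremals[of v1 y1])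
    fix s :: real assume s: "s > 0"
    have "spow (1 / (p - 1)) (y1 s) = spow (1 / (p - 1)) (y s) / C"
      using spow_mult[of "1 / (p - 1)" "y s" "1 / C powr (p - 1)"] C p
      by (simp add: y1_def spow_pos powr_divide powr_powr)
    then show "(v1 has_real_derivative spow (1 / (p - 1)) (y1 s)) (at s)"
      using DERIV_cdivide[OF Dv[OF s], of C] by (simp add: v1_def[abs_def])
    have "R s / C powr (p - 1) = - (q * \<gamma> * spow (q - 1) (v1 s) * wt s)"
    proof -
      have "C powr (q - 1) = C powr (p - 1) * C powr (q - p)" by (simp flip: powr_add)
      then have "c * C powr (q - 1) = q * \<gamma> * C powr (p - 1)" unfolding Cqp using c by simp
      then have e: "q * \<gamma> / C powr (q - 1) = c / C powr (p - 1)" using C by (simp add: field_simps)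
      have "q * \<gamma> * spow (q - 1) (v1 s) * wt s
         = (q * \<gamma> / C powr (q - 1)) * (spow (q - 1) (prim g s) * wt s)"
        unfolding v1_def spC by simp
      then show ?thesis unfolding e R_def by (simp add: mult_ac)
    qed
    then show "(y1 has_real_derivative - (q * \<gamma> * spow (q - 1) (v1 s) * wt s)) (at s)"
      using DERIV_cdivide[OF Dy[OF s], of "C powr (p - 1)"] by (simp add: y1_def[abs_def])
  next
    have "((\<lambda>s. s powr (- \<gamma>) * prim g s / C) \<longlongrightarrow> 0 / C) (at_right 0)"
      using C by (intro tendsto_divide tendsto_const prim_scaled_limit[OF lim]) auto
    then show "((\<lambda>s. s powr (- \<gamma>) * v1 s) \<longlongrightarrow> 0) (at_right 0)" by (simp add: v1_def)
  next
    have "integrable lborel (\<lambda>s. indicator {0<..} s *\<^sub>R (g s powr p / C powr p))"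
      using energy_limit_integrable[OF lim] by (intro integrable_mult_indicator) auto
    moreover have "AE s in lborel. indicator {0<..} s *\<^sub>R (g s powr p / C powr p) = indicator {0<..} s * y1 s powr (p / (p - 1))"
      using gy
    proof eventually_elim
      case (elim s)
      have "y1 s powr (p / (p - 1)) = y s powr (p / (p - 1)) / C powr p"
        using C p by (simp add: y1_def powr_divide powr_powr)
      then show ?case using elim by (auto simp: indicator_def)
    qed
    moreover have "(\<lambda>s. indicator {0<..} s * y1 s powr (p / (p - 1))) \<in> borel_measurable lborel"
    proof -
      have cy: "continuous_on {0<..} (\<lambda>s. y1 s powr (p / (p - 1)))"
        unfolding y1_def y_def using p C
        by (intro continuous_on_compose2[OF continuous_on_abs_powr[of "p / (p - 1)" UNIV]] continuous_intros contK) auto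
      show ?thesis using borel_measurable_continuous_on_indicator[OF _ cy] by simp
    qed
    ultimately show "integrable lborel (\<lambda>s. indicator {0<..} s * y1 s powr (p / (p - 1)))"
      by (subst integrable_cong_AE[symmetric]) auto
  next
    show "\<exists>s>0. v1 s \<noteq> 0" using nontriv C by (auto simp: v1_def)
  qed
  then obtain \<tau> \<epsilon> where *: "\<tau> > 0" "\<epsilon> \<in> {1,-1}" "\<And>s. s > 0 \<Longrightarrow> v1 s = \<epsilon> * (\<tau> powr (- \<gamma>) * V (\<tau> * s))"
    by blast
  have "prim g s = C * (\<epsilon> * (\<tau> powr (- \<gamma>) * V (\<tau> * s)))" if "s > 0" for s
    unfolding *(3)[OF that, symmetric] using C by (simp add: v1_def)
  then show ?thesis using *(1,2) by blast
qed

end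

section \<open>Weak equation and Rayleigh quotient in terms of profiles\<close>

context radial_bliss begin

lemma D_grad_has: "u \<in> D_radial p \<alpha> \<Longrightarrow> has_D_gradient p \<alpha> u (D_grad p \<alpha> u)" for u :: "real ^ 'n \<Rightarrow> real"
  unfolding D_radial_def D_grad_def mem_Collect_eq by (erule someI_ex[of "has_D_gradient p \<alpha> u"])

text \<open>\<open>D_grad\<close> is an arbitrary choice among the gradients. By
  \<open>D_structure\<close> the chosen one comes from a one-dimensional derivative, which
  \<open>prim_unique\<close> identifies with the classical one.\<close>

lemma D_grad_AE:
  fixes D :: "real ^ 'n \<Rightarrow> real ^ 'n"
  assumes u: "has_D_gradient p \<alpha> (\<lambda>x. v (\<sigma> x)) D"
    and [measurable]: "v \<in> borel_measurable borel" and g: "v' \<in> borel_measurable borel"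
    and Dv: "\<And>s. s > 0 \<Longrightarrow> (v has_real_derivative v' s) (at s)" and cont: "continuous_on {0<..} v'"
  shows "AE x in lborel. D_grad p \<alpha> (\<lambda>x. v (\<sigma> x)) x = v' (\<sigma> x) *\<^sub>R \<sigma>' x"
proof -
  have "(\<lambda>x. v (\<sigma> x)) \<in> D_radial p \<alpha>" using u by (auto simp: D_radial_def)
  from D_grad_has[OF this] obtain \<psi> \<psi>' g where lim: "energy_limit \<psi> \<psi>' g"
    and eq: "AE x in lborel. v (\<sigma> x) = prim g (\<sigma> x)" and grad: "AE x in lborel. D_grad p \<alpha> (\<lambda>x. v (\<sigma> x)) x = g (\<sigma> x) *\<^sub>R \<sigma>' x"
    by (rule D_structure) blast
  note [measurable] = prim_measurable[OF lim]
  have "AE s in lborel. 0 < s \<longrightarrow> v s = prim g s"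
    by (rule AE_radius_powerD[OF \<kappa>0 eq]) measurable
  then have "AE s in lborel. 0 < s \<longrightarrow> prim g s = v s" by eventually_elim auto
  from prim_unique[OF lim Dv cont g this] have "AE s in lborel. 0 < s \<longrightarrow> g s = v' s" .
  from AE_radius_powerI[OF \<kappa>0 this, where ?'n = 'n] grad
  show ?thesis by eventually_elim simp
qed

lemma grad_product:
  assumes "x \<noteq> 0"
  shows "norm x powr \<alpha> * norm (a *\<^sub>R \<sigma>' x) powr (p - 2) * ((a *\<^sub>R \<sigma>' x) \<bullet> (b *\<^sub>R \<sigma>' x))
    = norm x powr \<alpha> * norm (\<sigma>' x) powr p * (spow (p - 1) a * b)"
proof -
  define d where "d = \<sigma>' x"
  have d: "norm d > 0" using assms \<kappa>0 by (simp add: d_def norm_radius_power_grad del: zero_less_norm_iff)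
  have 1: "norm d powr (p - 2) * (norm d)\<^sup>2 = norm d powr p"
    using d by (simp flip: powr_numeral powr_add)
  have 2: "a powr (p - 2) * a = spow (p - 1) a" using powr_mult_self_eq_spow[of a "p - 1"] by simp
  have E: "norm (a *\<^sub>R d) powr (p - 2) * ((a *\<^sub>R d) \<bullet> (b *\<^sub>R d)) = (a powr (p - 2) * a) * b * (norm d powr (p - 2) * (norm d)\<^sup>2)"
    by (simp add: powr_mult power2_norm_eq_inner)
  show ?thesis
    unfolding mult.assoc[of "norm x powr \<alpha>" "norm (a *\<^sub>R \<sigma>' x) powr (p - 2)"] E[unfolded 1 2, unfolded d_def]
    by (simp only: mult_ac)
qed

lemma weak_integrals:
  fixes u \<phi> :: "real ^ 'n \<Rightarrow> real"
  assumes mu: "u \<in> borel_measurable borel" "Du \<in> borel_measurable borel" "\<phi> \<in> borel_measurable borel" "D\<phi> \<in> borel_measurable borel"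
    and m: "g \<in> borel_measurable borel" "\<eta> \<in> borel_measurable borel" "v \<in> borel_measurable borel" "\<psi> \<in> borel_measurable borel"
    and z: "\<And>s. s \<le> 0 \<Longrightarrow> g s = 0" "\<And>s. s \<le> 0 \<Longrightarrow> v s = 0"
    and eq: "AE x in lborel. u x = v (\<sigma> x)" "AE x in lborel. Du x = g (\<sigma> x) *\<^sub>R \<sigma>' x"
      "AE x in lborel. \<phi> x = \<psi> (\<sigma> x)" "AE x in lborel. D\<phi> x = \<eta> (\<sigma> x) *\<^sub>R \<sigma>' x"
  shows "integrable lborel (\<lambda>x. norm x powr \<alpha> * norm (Du x) powr (p - 2) * (Du x \<bullet> D\<phi> x)) \<longleftrightarrow> integrable lborel (\<lambda>s. spow (p - 1) (g s) * \<eta> s)"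
    "(LINT x|lborel. norm x powr \<alpha> * norm (Du x) powr (p - 2) * (Du x \<bullet> D\<phi> x)) = \<omega> * \<bar>\<kappa>\<bar> powr p * (LINT s|lborel. spow (p - 1) (g s) * \<eta> s)"
    "integrable lborel (\<lambda>x. rhs_weight p \<alpha> q x * \<bar>u x\<bar> powr (q - 2) * u x * \<phi> x) \<longleftrightarrow> integrable lborel (\<lambda>s. wt s * (spow (q - 1) (v s) * \<psi> s))"
    "(LINT x|lborel. rhs_weight p \<alpha> q x * \<bar>u x\<bar> powr (q - 2) * u x * \<phi> x) = \<omega> * (LINT s|lborel. wt s * (spow (q - 1) (v s) * \<psi> s))"
proof -
  note [measurable] = mu m
  have [measurable]: "(rhs_weight p \<alpha> q :: real ^ 'n \<Rightarrow> real) \<in> borel_measurable borel"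
    unfolding rhs_weight_def[abs_def] by measurable
  have ae1: "AE x in lborel. norm x powr \<alpha> * norm (Du x) powr (p - 2) * (Du x \<bullet> D\<phi> x)
      = norm x powr \<alpha> * norm (\<sigma>' x) powr p * (spow (p - 1) (g (\<sigma> x)) * \<eta> (\<sigma> x))"
    using AE_nonzero eq(2,4)
  proof eventually_elim
    case (elim x)
    show ?case unfolding elim(2,3) by (rule grad_product[OF elim(1)])
  qed
  have ae2: "AE x in lborel. rhs_weight p \<alpha> q x * \<bar>u x\<bar> powr (q - 2) * u x * \<phi> x
      = rhs_weight p \<alpha> q x * (spow (q - 1) (v (\<sigma> x)) * \<psi> (\<sigma> x))"
    using eq(1,3)
  proof eventually_elim
    case (elim x)
    have e: "v (\<sigma> x) powr (q - 2) * v (\<sigma> x) = spow (q - 1) (v (\<sigma> x))"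
      using powr_mult_self_eq_spow[of "v (\<sigma> x)" "q - 1"] by simp
    have "rhs_weight p \<alpha> q x * \<bar>u x\<bar> powr (q - 2) * u x * \<phi> x
        = rhs_weight p \<alpha> q x * ((v (\<sigma> x) powr (q - 2) * v (\<sigma> x)) * \<psi> (\<sigma> x))"
      by (simp only: elim abs_powr_real mult.assoc)
    then show ?case unfolding e .
  qed
  note E = energy_integrals[where F = "\<lambda>s. spow (p - 1) (g s) * \<eta> s"]
  note P = potential_integrals[where F = "\<lambda>s. spow (q - 1) (v s) * \<psi> s"]
  show "integrable lborel (\<lambda>x. norm x powr \<alpha> * norm (Du x) powr (p - 2) * (Du x \<bullet> D\<phi> x)) \<longleftrightarrow> integrable lborel (\<lambda>s. spow (p - 1) (g s) * \<eta> s)"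
    by (subst integrable_cong_AE[OF _ _ ae1], measurable, rule E(2)) (auto simp: z)
  show "(LINT x|lborel. norm x powr \<alpha> * norm (Du x) powr (p - 2) * (Du x \<bullet> D\<phi> x)) = \<omega> * \<bar>\<kappa>\<bar> powr p * (LINT s|lborel. spow (p - 1) (g s) * \<eta> s)"
    by (subst integral_cong_AE[OF _ _ ae1], measurable, rule E(3)) (auto simp: z)
  show "integrable lborel (\<lambda>x. rhs_weight p \<alpha> q x * \<bar>u x\<bar> powr (q - 2) * u x * \<phi> x) \<longleftrightarrow> integrable lborel (\<lambda>s. wt s * (spow (q - 1) (v s) * \<psi> s))"
    by (subst integrable_cong_AE[OF _ _ ae2], measurable, rule P(1)) (auto simp: z)
  show "(LINT x|lborel. rhs_weight p \<alpha> q x * \<bar>u x\<bar> powr (q - 2) * u x * \<phi> x) = \<omega> * (LINT s|lborel. wt s * (spow (q - 1) (v s) * \<psi> s))"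
    by (subst integral_cong_AE[OF _ _ ae2], measurable, rule P(2)) (auto simp: z)
qed

lemma rayleigh_eq:
  fixes u :: "real ^ 'n \<Rightarrow> real"
  assumes mu: "u \<in> borel_measurable borel" "D_grad p \<alpha> u \<in> borel_measurable borel"
    and m: "g \<in> borel_measurable borel" "v \<in> borel_measurable borel"
    and z: "\<And>s. s \<le> 0 \<Longrightarrow> g s = 0" "\<And>s. s \<le> 0 \<Longrightarrow> v s = 0"
    and eq: "AE x in lborel. u x = v (\<sigma> x)" "AE x in lborel. D_grad p \<alpha> u x = g (\<sigma> x) *\<^sub>R \<sigma>' x"
  shows "rayleigh_quotient p \<alpha> q u = (\<omega> * \<bar>\<kappa>\<bar> powr p * (LINT s|lborel. g s powr p))
    / (\<omega> * (LINT s|lborel. wt s * v s powr q)) powr (p / q)"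
proof -
  note [measurable] = mu m
  have [measurable]: "(rhs_weight p \<alpha> q :: real ^ 'n \<Rightarrow> real) \<in> borel_measurable borel"
    unfolding rhs_weight_def[abs_def] by measurable
  have "(LINT x|lborel. norm x powr \<alpha> * norm (D_grad p \<alpha> u x) powr p)
      = (LINT x|lborel. norm x powr \<alpha> * norm (\<sigma>' x) powr p * (g (\<sigma> x) powr p))"
  proof (rule integral_cong_AE)
    show "AE x in lborel. norm x powr \<alpha> * norm (D_grad p \<alpha> u x) powr p = norm x powr \<alpha> * norm (\<sigma>' x) powr p * (g (\<sigma> x) powr p)"
      using eq(2) by eventually_elim (simp add: powr_mult mult_ac)
  qed measurable
  also have "\<dots> = \<omega> * \<bar>\<kappa>\<bar> powr p * (LINT s|lborel. g s powr p)"
    by (rule energy_integrals(3)) (auto simp: z)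
  finally have 1: "(LINT x|lborel. norm x powr \<alpha> * norm (D_grad p \<alpha> u x) powr p) = \<omega> * \<bar>\<kappa>\<bar> powr p * (LINT s|lborel. g s powr p)" .
  have "(LINT x|lborel. rhs_weight p \<alpha> q x * \<bar>u x\<bar> powr q) = (LINT x|lborel. rhs_weight p \<alpha> q x * v (\<sigma> x) powr q)"
  proof (rule integral_cong_AE)
    show "AE x in lborel. rhs_weight p \<alpha> q x * \<bar>u x\<bar> powr q = rhs_weight p \<alpha> q x * v (\<sigma> x) powr q"
      using eq(1) by eventually_elim simp
  qed measurable
  also have "\<dots> = \<omega> * (LINT s|lborel. wt s * v s powr q)"
    by (rule potential_integrals(2)) (auto simp: z)
  finally show ?thesis by (simp only: rayleigh_quotient_def 1)
qed

text \<open>A multiple C V solves the equation when C^(q-p) = q \<gamma> |\<kappa>|^p: the factor q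
  \<gamma> comes from the equation of \<open>V\<close>, and |\<kappa>|^p from the gradient of
  \<open>radius_power\<close>.\<close>

definition amp :: real where "amp = (q * \<gamma> * \<bar>\<kappa>\<bar> powr p) powr (1 / (q - p))"
definition U :: "real ^ 'n \<Rightarrow> real" where "U x = amp * V (\<sigma> x)"

lemma amp_pos: "amp > 0" using \<gamma>_pos p q \<kappa>0 by (simp add: amp_def)
lemma amp_powr: "amp powr (q - p) = q * \<gamma> * \<bar>\<kappa>\<bar> powr p"
  using \<gamma>_pos p q \<kappa>0 by (simp add: amp_def powr_powr)

lemma continuous_on_G: "continuous_on {0<..} G"
proof -
  have "G = J 0 (1 / k + 1)" by (rule ext) (simp add: G_def J_def)
  then show ?thesis using isCont_J by (auto intro!: continuous_at_imp_continuous_on)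
qed

lemma U_gradient: "has_D_gradient p \<alpha> U (\<lambda>x. (amp * G (\<sigma> x)) *\<^sub>R \<sigma>' x)"
  unfolding U_def[abs_def]
proof (rule D_intro[where v = "\<lambda>s. amp * V s" and g = "\<lambda>s. amp * G s"])
  show "((\<lambda>s. amp * V s) has_real_derivative amp * G s) (at s)" if "s > 0" for s
    by (rule DERIV_cmult[OF DERIV_V[OF that]])
  show "continuous_on {0<..} (\<lambda>s. amp * G s)" by (intro continuous_intros continuous_on_G)
  show "integrable lborel (\<lambda>s. (amp * G s) powr p)" using integrable_G_powr by (simp add: powr_mult)
  have "(\<lambda>s. s powr (- p) * (amp * V s) powr p) = (\<lambda>s. amp powr p * (s powr (- p) * V s powr p))"
    by (rule ext) (simp add: powr_mult)
  then show "integrable lborel (\<lambda>s. s powr (- p) * (amp * V s) powr p)" using integrable_V_hardy by simp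
qed (auto simp: V_def G_def)

lemma U_D_radial: "U \<in> D_radial p \<alpha>" using U_gradient by (auto simp: D_radial_def)

lemma U_measurable [measurable]: "U \<in> borel_measurable borel" unfolding U_def[abs_def] by measurable

lemma U_D_grad: "AE x in lborel. D_grad p \<alpha> U x = (amp * G (\<sigma> x)) *\<^sub>R \<sigma>' x"
  using U_gradient unfolding U_def[abs_def]
  by (rule D_grad_AE[where v = "\<lambda>s. amp * V s" and v' = "\<lambda>s. amp * G s"])
     (auto intro!: DERIV_cmult DERIV_V continuous_intros continuous_on_G)

lemma U_weak_solution: "weak_solution p \<alpha> q U"
  unfolding weak_solution_def
proof (intro conjI ballI U_D_radial)
  fix \<phi> :: "real ^ 'n \<Rightarrow> real" assume "\<phi> \<in> D_radial p \<alpha>"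
  then have h: "has_D_gradient p \<alpha> \<phi> (D_grad p \<alpha> \<phi>)" by (rule D_grad_has)
  then obtain \<psi> \<psi>' \<eta> where lim: "energy_limit \<psi> \<psi>' \<eta>" and eq: "AE x in lborel. \<phi> x = prim \<eta> (\<sigma> x)"
    "AE x in lborel. D_grad p \<alpha> \<phi> x = \<eta> (\<sigma> x) *\<^sub>R \<sigma>' x"
    by (rule D_structure) blast
  have meas: "\<phi> \<in> borel_measurable borel" "D_grad p \<alpha> \<phi> \<in> borel_measurable borel" "D_grad p \<alpha> U \<in> borel_measurable borel"
    using h D_grad_has[OF U_D_radial] by (auto simp: has_D_gradient_def)
  note W = weak_integrals[of U "D_grad p \<alpha> U" \<phi> "D_grad p \<alpha> \<phi>" "\<lambda>s. amp * G s" \<eta> "\<lambda>s. amp * V s" "prim \<eta>",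
      OF U_measurable meas(3,1,2) _ energy_limit_measurable(1)[OF lim] _ prim_measurable[OF lim] _ _ _ U_D_grad eq]
  note X = extremal_weak[OF lim]
  have e1: "(\<lambda>s. spow (p - 1) (amp * G s) * \<eta> s) = (\<lambda>s. amp powr (p - 1) * (G s powr (p - 1) * \<eta> s))"
    using amp_pos G_nonneg by (auto simp: spow_nonneg powr_mult)
  have e2: "(\<lambda>s. wt s * (spow (q - 1) (amp * V s) * prim \<eta> s))
      = (\<lambda>s. amp powr (q - 1) * (wt s * V s powr (q - 1) * prim \<eta> s))"
    using amp_pos V_nonneg by (auto simp: spow_nonneg powr_mult)
  note W' = W[unfolded e1 e2]
  show "integrable lborel (\<lambda>x. norm x powr \<alpha> * norm (D_grad p \<alpha> U x) powr (p - 2) * (D_grad p \<alpha> U x \<bullet> D_grad p \<alpha> \<phi> x))"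
    by (subst W'(1)) (use X(1) in \<open>auto simp: V_def G_def U_def\<close>)
  show "integrable lborel (\<lambda>x. rhs_weight p \<alpha> q x * \<bar>U x\<bar> powr (q - 2) * U x * \<phi> x)"
    by (subst W'(3)) (use X(2) in \<open>auto simp: V_def G_def U_def\<close>)
  have ae: "AE x in lborel. U x = amp * V (\<sigma> x)" by (simp add: U_def)
  have mm: "(\<lambda>s. amp * G s) \<in> borel_measurable borel" "(\<lambda>s. amp * V s) \<in> borel_measurable borel" by measurable
  have zz: "\<And>s. s \<le> 0 \<Longrightarrow> amp * G s = 0" "\<And>s. s \<le> 0 \<Longrightarrow> amp * V s = 0" by (auto simp: V_def G_def)
  have "amp powr (q - 1) = amp powr (p - 1) * amp powr (q - p)" by (simp flip: powr_add)
  then have "amp powr (q - 1) = amp powr (p - 1) * (q * \<gamma> * \<bar>\<kappa>\<bar> powr p)" unfolding amp_powr .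
  moreover have "(LINT x|lborel. norm x powr \<alpha> * norm (D_grad p \<alpha> U x) powr (p - 2) * (D_grad p \<alpha> U x \<bullet> D_grad p \<alpha> \<phi> x))
      = \<omega> * \<bar>\<kappa>\<bar> powr p * (LINT s|lborel. amp powr (p - 1) * (G s powr (p - 1) * \<eta> s))"
    by (rule W'(2)[OF mm zz ae])
  moreover have "(LINT x|lborel. rhs_weight p \<alpha> q x * \<bar>U x\<bar> powr (q - 2) * U x * \<phi> x)
      = \<omega> * (LINT s|lborel. amp powr (q - 1) * (wt s * V s powr (q - 1) * prim \<eta> s))"
    by (rule W'(4)[OF mm zz ae])
  ultimately show "(LINT x|lborel. norm x powr \<alpha> * norm (D_grad p \<alpha> U x) powr (p - 2) * (D_grad p \<alpha> U x \<bullet> D_grad p \<alpha> \<phi> x))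
        = (LINT x|lborel. rhs_weight p \<alpha> q x * \<bar>U x\<bar> powr (q - 2) * U x * \<phi> x)"
    using X(3) by (simp del: abs_powr_real)
qed

lemma U_nonzero: "ae_nonzero U"
  unfolding ae_nonzero_def
proof
  assume A: "AE x in lborel. U x = 0"
  have "AE x :: real ^ 'n in lborel. False"
    using A AE_nonzero
  proof eventually_elim
    case (elim x)
    then show False using V_pos[OF radius_power_pos[OF elim(2), of \<kappa>]] amp_pos by (simp add: U_def)
  qed
  then show False by (simp add: eventually_False ae_filter_eq_bot_iff)
qed

lemma profile_nonzero:
  fixes u :: "real ^ 'n \<Rightarrow> real"
  assumes "AE x in lborel. u x = v (\<sigma> x)" "ae_nonzero u"
  shows "\<not> (AE s in lborel. 0 < s \<longrightarrow> v s = 0)"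
proof
  assume "AE s in lborel. 0 < s \<longrightarrow> v s = 0"
  from AE_radius_powerI[OF \<kappa>0 this, where ?'n = 'n] assms(1) have "AE x in lborel. u x = 0"
    by eventually_elim simp
  then show False using assms(2) by (simp add: ae_nonzero_def)
qed

text \<open>Testing with lifts of one-dimensional test profiles already yields the equation on the
  half line. The constant \<omega> cancels and the factor |\<kappa>|^p remains, which fixes the
  amplitude as \<open>amp\<close>.\<close>

lemma weak_solution_unique:
  fixes u :: "real ^ 'n \<Rightarrow> real"
  assumes u: "weak_solution p \<alpha> q u" and nz: "ae_nonzero u"
  shows "\<exists>\<rho>>0. \<exists>s\<in>{1, -1}. AE x in lborel. u x = s * (\<rho> powr ((real CARD('n) - p + \<alpha>) / p) * U (\<rho> *\<^sub>R x))"
proof -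
  have uD: "u \<in> D_radial p \<alpha>" using u by (simp add: weak_solution_def)
  have h: "has_D_gradient p \<alpha> u (D_grad p \<alpha> u)" by (rule D_grad_has[OF uD])
  then obtain \<psi> \<psi>' g where lim: "energy_limit \<psi> \<psi>' g" and g0: "\<And>s. s \<le> 0 \<Longrightarrow> g s = 0" and eq: "AE x in lborel. u x = prim g (\<sigma> x)"
    "AE x in lborel. D_grad p \<alpha> u x = g (\<sigma> x) *\<^sub>R \<sigma>' x"
    by (rule D_structure) blast
  have mu: "u \<in> borel_measurable borel" "D_grad p \<alpha> u \<in> borel_measurable borel"
    using h by (auto simp: has_D_gradient_def)
  define c where "c = 1 / \<bar>\<kappa>\<bar> powr p"
  have c: "c > 0" using \<kappa>0 by (simp add: c_def)
  have ampc: "amp = (q * \<gamma> / c) powr (1 / (q - p))" by (simp add: amp_def c_def)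
  have "\<exists>\<tau>>0. \<exists>\<epsilon>\<in>{1,-1}. \<forall>s>0. prim g s = amp * (\<epsilon> * (\<tau> powr (- \<gamma>) * V (\<tau> * s)))"
    unfolding ampc
  proof (rule distributional_solution[OF lim c])
    fix \<phi> \<phi>' assume cc: "cc1 \<phi> \<phi>'"
    define f where "f = (\<lambda>x :: real ^ 'n. \<phi> (\<sigma> x))"
    have m\<phi>: "\<phi> \<in> borel_measurable borel" "\<phi>' \<in> borel_measurable borel" using cc1_measurable[OF cc] by auto
    have hf: "has_D_gradient p \<alpha> f (\<lambda>x. \<phi>' (\<sigma> x) *\<^sub>R \<sigma>' x)"
      unfolding f_def
    proof (rule D_intro[OF m\<phi> _ cc1_cont(2)[OF cc] cc1_nonpos[OF cc] cc1_integrable_energy[OF cc]])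
      show "(\<phi> has_real_derivative \<phi>' s) (at s)" for s using cc by (simp add: cc1_def)
      show "integrable lborel (\<lambda>s. s powr (- p) * \<phi> s powr p)"
      proof (rule cc1_integrable[OF cc])
        show "continuous_on S (\<lambda>s. s powr (- p) * \<phi> s powr p)" if "S \<subseteq> {0<..}" for S
          by (intro continuous_on_mult continuous_on_powr continuous_on_id continuous_on_const
              continuous_on_compose2[OF continuous_on_abs_powr[of p UNIV] cc1_cont(1)[OF cc]])
             (use p that in auto)
      qed simp
    qed auto
    then have fD: "f \<in> D_radial p \<alpha>" by (auto simp: D_radial_def)
    have Df: "AE x in lborel. D_grad p \<alpha> f x = \<phi>' (\<sigma> x) *\<^sub>R \<sigma>' x"
      using hf unfolding f_def
      by (rule D_grad_AE[OF _ m\<phi> _ cc1_cont(2)[OF cc]]) (use cc in \<open>auto simp: cc1_def\<close>)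
    have mf: "f \<in> borel_measurable borel" "D_grad p \<alpha> f \<in> borel_measurable borel"
      using D_grad_has[OF fD] by (auto simp: has_D_gradient_def)
    have ef: "AE x in lborel. f x = \<phi> (\<sigma> x)" by (simp add: f_def)
    note W = weak_integrals[OF mu mf energy_limit_measurable(1)[OF lim] m\<phi>(2) prim_measurable[OF lim] m\<phi>(1) g0 prim_nonpos[OF lim] eq ef Df]
    have h: "(LINT x|lborel. norm x powr \<alpha> * norm (D_grad p \<alpha> u x) powr (p - 2) * (D_grad p \<alpha> u x \<bullet> D_grad p \<alpha> f x))
        = (LINT x|lborel. rhs_weight p \<alpha> q x * \<bar>u x\<bar> powr (q - 2) * u x * f x)"
      using u fD unfolding weak_solution_def by blast
    have "\<omega> * \<bar>\<kappa>\<bar> powr p * (LINT s|lborel. spow (p - 1) (g s) * \<phi>' s) = \<omega> * (LINT s|lborel. wt s * (spow (q - 1) (prim g s) * \<phi> s))"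
      by (rule trans[OF W(2)[symmetric] trans[OF h W(4)]])
    then have "\<bar>\<kappa>\<bar> powr p * (LINT s|lborel. spow (p - 1) (g s) * \<phi>' s) = (LINT s|lborel. wt s * (spow (q - 1) (prim g s) * \<phi> s))"
      using \<omega>_pos by (simp del: abs_powr_real)
    then show "(LINT s|lborel. spow (p - 1) (g s) * \<phi>' s) = c * (LINT s|lborel. wt s * (spow (q - 1) (prim g s) * \<phi> s))"
      using \<kappa>0 by (simp add: c_def field_simps)
  next
    show "\<exists>s>0. prim g s \<noteq> 0"
    proof (rule ccontr)
      assume "\<not> (\<exists>s>0. prim g s \<noteq> 0)"
      then have "AE s in lborel. 0 < s \<longrightarrow> prim g s = 0" by simp
      then show False using profile_nonzero[OF eq(1) nz] by simp
    qed
  qed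
  then obtain \<tau> \<epsilon> where \<tau>: "\<tau> > 0" "\<epsilon> \<in> {1, -1}" and sol: "\<And>s. s > 0 \<Longrightarrow> prim g s = amp * (\<epsilon> * (\<tau> powr (- \<gamma>) * V (\<tau> * s)))"
    by blast
  \<comment> \<open>Since \<open>radius_power\<close> is homogeneous of degree - \<kappa>, dilating
    x by \<rho> dilates s by \<tau>; the prefactor \<tau>^(-\<gamma>) becomes the required power of
    \<rho>.\<close>
  define \<rho> where "\<rho> = \<tau> powr (- 1 / \<kappa>)"
  have \<rho>: "\<rho> > 0" "\<rho> powr (- \<kappa>) = \<tau>" using \<tau> \<kappa>0 by (auto simp: \<rho>_def powr_powr)
  have \<rho>H: "\<rho> powr ((real CARD('n) - p + \<alpha>) / p) = \<tau> powr (- \<gamma>)"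
  proof -
    have "- 1 / \<kappa> * (\<kappa> * (p - 1) / p) = - \<gamma>" using \<kappa>0 p by (simp add: \<gamma>_def field_simps)
    then show ?thesis unfolding dim_eq \<rho>_def powr_powr by simp
  qed
  have "AE x in lborel. u x = \<epsilon> * (\<rho> powr ((real CARD('n) - p + \<alpha>) / p) * U (\<rho> *\<^sub>R x))"
    using eq(1) AE_nonzero
  proof eventually_elim
    case (elim x)
    have "\<sigma> (\<rho> *\<^sub>R x) = \<tau> * \<sigma> x" using \<rho> by (simp add: radius_power_def powr_mult)
    then show ?case
      unfolding \<rho>H using elim sol[OF radius_power_pos[OF elim(2), of \<kappa>]] by (simp add: U_def mult_ac)
  qed
  then show ?thesis using \<rho>(1) \<tau>(2) by blast
qed

lemma U_rayleigh: "rayleigh_quotient p \<alpha> q U = (\<omega> * \<bar>\<kappa>\<bar> powr p * A0) / (\<omega> * B0) powr (p / q)"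
proof -
  have "rayleigh_quotient p \<alpha> q U = (\<omega> * \<bar>\<kappa>\<bar> powr p * (LINT s|lborel. (amp * G s) powr p))
    / (\<omega> * (LINT s|lborel. wt s * (amp * V s) powr q)) powr (p / q)"
  proof (rule rayleigh_eq[OF U_measurable _ _ _ _ _ _ U_D_grad])
    show "D_grad p \<alpha> U \<in> borel_measurable borel" using D_grad_has[OF U_D_radial] by (simp add: has_D_gradient_def)
  qed (auto simp: U_def V_def G_def)
  also have "(LINT s|lborel. (amp * G s) powr p) = amp powr p * A0" by (simp add: powr_mult A0_def)
  also have "(LINT s|lborel. wt s * (amp * V s) powr q) = amp powr q * B0"
  proof -
    have "(\<lambda>s. wt s * (amp * V s) powr q) = (\<lambda>s. amp powr q * (wt s * V s powr q))"
      by (rule ext) (simp add: powr_mult)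
    then show ?thesis by (simp add: B0_def)
  qed
  also have "(\<omega> * (amp powr q * B0)) powr (p / q) = amp powr p * (\<omega> * B0) powr (p / q)"
    using p q by (simp add: powr_mult powr_powr)
  finally show ?thesis using amp_pos by simp
qed

lemma rayleigh_lower_bound:
  fixes u :: "real ^ 'n \<Rightarrow> real"
  assumes uD: "u \<in> D_radial p \<alpha>" and nz: "ae_nonzero u"
  shows "(\<omega> * \<bar>\<kappa>\<bar> powr p * A0) / (\<omega> * B0) powr (p / q) \<le> rayleigh_quotient p \<alpha> q u"
proof -
  have h: "has_D_gradient p \<alpha> u (D_grad p \<alpha> u)" by (rule D_grad_has[OF uD])
  then obtain \<psi> \<psi>' g where lim: "energy_limit \<psi> \<psi>' g" and g0: "\<And>s. s \<le> 0 \<Longrightarrow> g s = 0" and eq: "AE x in lborel. u x = prim g (\<sigma> x)"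
    "AE x in lborel. D_grad p \<alpha> u x = g (\<sigma> x) *\<^sub>R \<sigma>' x"
    by (rule D_structure) blast
  have mu: "u \<in> borel_measurable borel" "D_grad p \<alpha> u \<in> borel_measurable borel"
    using h by (auto simp: has_D_gradient_def)
  define A where "A = (LINT s|lborel. g s powr p)"
  define B where "B = (LINT s|lborel. wt s * prim g s powr q)"
  have R: "rayleigh_quotient p \<alpha> q u = (\<omega> * \<bar>\<kappa>\<bar> powr p * A) / (\<omega> * B) powr (p / q)"
    unfolding A_def B_def
    by (rule rayleigh_eq[OF mu energy_limit_measurable(1)[OF lim] prim_measurable[OF lim] g0 prim_nonpos[OF lim] eq])
  \<comment> \<open>A quotient with denominator 0 has the value 0 and would violate the bound, so
    positivity has to be derived from nontriviality. A vanishing integral forces the integrand to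
    vanish because \<open>bliss_limit\<close> provides its integrability.\<close>
  have "B \<noteq> 0"
  proof
    assume "B = 0"
    then have "AE s in lborel. wt s * prim g s powr q = 0"
      unfolding B_def by (subst (asm) integral_nonneg_eq_0_iff_AE[OF bliss_limit(1)[OF lim]]) auto
    then have "AE s in lborel. 0 < s \<longrightarrow> prim g s = 0" by eventually_elim auto
    then show False using profile_nonzero[OF eq(1) nz] by simp
  qed
  moreover have "B \<ge> 0" by (auto simp: B_def)
  ultimately have B: "B > 0" by simp
  have "A0 * (B / B0) powr (p / q) \<le> A" using bliss_limit(2)[OF lim] by (simp add: A_def B_def)
  then have "A0 * B powr (p / q) \<le> A * B0 powr (p / q)"
    using B0_pos by (simp add: powr_divide field_simps)
  then have "A0 / B0 powr (p / q) \<le> A / B powr (p / q)" using B0_pos B by (simp add: field_simps)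
  then have "(\<omega> * \<bar>\<kappa>\<bar> powr p / \<omega> powr (p / q)) * (A0 / B0 powr (p / q)) \<le> (\<omega> * \<bar>\<kappa>\<bar> powr p / \<omega> powr (p / q)) * (A / B powr (p / q))"
    using \<omega>_pos by (intro mult_left_mono) auto
  then show ?thesis unfolding R powr_mult by (simp add: field_simps)
qed

text \<open>A lower bound of a set that belongs to the set is its infimum, so boundedness from below
  needs no separate argument.\<close>

lemma U_best_constant: "rayleigh_quotient p \<alpha> q U = best_constant TYPE('n) p \<alpha> q"
  unfolding best_constant_def
proof (rule cInf_eq_minimum[symmetric])
  show "rayleigh_quotient p \<alpha> q U \<in> rayleigh_quotient p \<alpha> q ` {u :: real ^ 'n \<Rightarrow> real. u \<in> D_radial p \<alpha> \<and> ae_nonzero u}"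
    by (rule imageI) (simp add: U_D_radial U_nonzero)
  fix z assume "z \<in> rayleigh_quotient p \<alpha> q ` {u :: real ^ 'n \<Rightarrow> real. u \<in> D_radial p \<alpha> \<and> ae_nonzero u}"
  then show "rayleigh_quotient p \<alpha> q U \<le> z" using rayleigh_lower_bound unfolding U_rayleigh by blast
qed

text \<open>The factor t^(-\<kappa>) in front is the power - 1 / k of t^(\<kappa> k), so it can be
  drawn into the bracket, which turns 1 + t^(-\<kappa> k) into 1 + t^(\<kappa> k). The origin is
  excluded because \<open>U\<close> has the value 0 there.\<close>

lemma U_formula:
  assumes x: "x \<noteq> 0"
  shows "U x = (q / p * (\<bar>real CARD('n) - p + \<alpha>\<bar> powr p / (p - 1) powr (p - 1))) powr (1 / (q - p))
          * (1 + norm x powr ((real CARD('n) - p + \<alpha>) * (q - p) / (p * (p - 1)))) powr (p / (p - q))"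
proof -
  have k': "p / (p - q) = - 1 / k" using p q by (simp add: k_def field_simps)
  have e: "(real CARD('n) - p + \<alpha>) * (q - p) / (p * (p - 1)) = \<kappa> * k"
    unfolding dim_eq using p by (simp add: k_def field_simps)
  have f1: "(p - 1) powr p = (p - 1) powr (p - 1) * (p - 1)" using p powr_mult_base[of "p - 1" "p - 1"] by (simp add: mult.commute)
  have f2: "\<bar>\<kappa> * (p - 1)\<bar> powr p = \<bar>\<kappa>\<bar> powr p * (p - 1) powr p" by (simp add: powr_mult)
  have a: "q / p * (\<bar>real CARD('n) - p + \<alpha>\<bar> powr p / (p - 1) powr (p - 1)) = q * \<gamma> * \<bar>\<kappa>\<bar> powr p"
    unfolding dim_eq f2 f1 using p by (simp add: \<gamma>_def field_simps)
  define t where "t = norm x"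
  have t: "t > 0" using x by (simp add: t_def)
  have "V (\<sigma> x) = t powr (- \<kappa>) * (1 + (t powr (- \<kappa>)) powr k) powr (- 1 / k)"
    using t by (simp add: V_def radius_power_def t_def)
  also have "t powr (- \<kappa>) = (t powr (\<kappa> * k)) powr (- 1 / k)" using k_pos by (simp add: powr_powr)
  also have "(t powr (\<kappa> * k)) powr (- 1 / k) * (1 + ((t powr (\<kappa> * k)) powr (- 1 / k)) powr k) powr (- 1 / k)
      = (t powr (\<kappa> * k) * (1 + t powr (- (\<kappa> * k)))) powr (- 1 / k)"
    using k_pos by (simp add: powr_mult powr_powr)
  also have "t powr (\<kappa> * k) * (1 + t powr (- (\<kappa> * k))) = 1 + t powr (\<kappa> * k)"
    using t by (simp add: distrib_left flip: powr_add)
  finally show ?thesis unfolding U_def amp_def a e k' t_def by simp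
qed

end

theorem theorem1p4:
  fixes p q \<alpha> :: real
  assumes "CARD('n::finite) \<ge> 2" and "p > 1" and "\<alpha> \<noteq> p - real CARD('n)" and "q > p"
  shows "\<exists>U :: real ^ 'n \<Rightarrow> real.
     radial U \<and> ae_nonzero U \<and> weak_solution p \<alpha> q U \<and>
     (\<forall>v :: real ^ 'n \<Rightarrow> real. weak_solution p \<alpha> q v \<and> ae_nonzero v \<longrightarrow>
        (\<exists>\<rho>>0. \<exists>s\<in>{1, -1}. AE x in lborel.
           v x = s * (\<rho> powr ((real CARD('n) - p + \<alpha>) / p) * U (\<rho> *\<^sub>R x)))) \<and>
     rayleigh_quotient p \<alpha> q U = best_constant TYPE('n) p \<alpha> q \<and>
     (\<forall>x. x \<noteq> 0 \<longrightarrow>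
        U x = (q / p * (\<bar>real CARD('n) - p + \<alpha>\<bar> powr p / (p - 1) powr (p - 1))) powr (1 / (q - p))
          * (1 + norm x powr ((real CARD('n) - p + \<alpha>) * (q - p) / (p * (p - 1)))) powr (p / (p - q)))"
proof -
  \<comment> \<open>The denominator p - 1 is positive, and \<alpha> \<noteq> p - n makes the
    quotient nonzero.\<close>
  interpret radial_bliss p q "TYPE('n)" \<alpha> "(real CARD('n) - p + \<alpha>) / (p - 1)"
    by unfold_locales (use assms in auto)
  have "radial U" by (simp add: radial_def U_def radius_power_def)
  then show ?thesis
    using U_nonzero U_weak_solution weak_solution_unique U_best_constant U_formula
    by (intro exI[of _ U] conjI allI impI) blast+
qed

end
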